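(* Let $E=\{y^2=x^3+1\}$. To every point $(x_t,y_t)\in E$ associate the genus $2$ curve $$X_t:=\{Y^2+(x_t+1)(X^2-1)\bigl(3X^4+3(x_t-1)X^2+x_t^2-x_t+1\bigr)=0\}$$ together with the map $\phi_t:X_t\to\mathbb P^1$ given by $$\phi_t(X,Y)=\frac{(x_t-2)^2X^2(Y-3y_t)+4(x_t^2-x_t+1)(y_t-Y)+(x_t^2+2x_t+1-3y_t)X^6-6y_t(x_t-2)X^4}{2(1+x_t)^2X^6}.$$ Then $\phi_t$ is a branched covering of degree $6$ which ramifies totally over $0$, $1$ and $\infty$ to order $3$, $3$ and $6$ respectively. Outside these three fibres it has exactly one branch point (with a single, simple ramification point above it), namely $$\phi_t(0,y_t)=\frac{x_t(x_t^3-8)}{4(x_t^3+1)}.$$ Moreover, the curve $X_t$ is bielliptic: it is a double covering of the elliptic curve $E$.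
   Context: Curves are over $\mathbb C$, and $X_t$ and $E$ denote the smooth projective curves defined by the given affine equations. "Ramifies totally over a point to order $p$" means that every point of the fibre has ramification order (local degree) $p$. A branch point is a critical value of $\phi_t$ in $\mathbb P^1$, and a ramification point is simple if the local degree there is $2$. The point $(X,Y)=(0,y_t)$ lies on $X_t$, and $\phi_t(0,y_t)$ denotes the value there of the map $X_t\to\mathbb P^1$ defined by the rational expression.
   Formalization: The printed value of φ_t(0,y_t) is false; it is replaced by (1+(x_t^6+20x_t^3-8)/(8y_t^3))/2. Points with y_t=0 (X_t not of genus 2) are excluded, and order 3 over 0 or 1 and the extra branch point are claimed only when φ_t(0,y_t) differs from 0, from 1, or from both, respectively. *)

theory Defs
  imports "HOL-Complex_Analysis.Complex_Analysis" "HOL-Computational_Algebra.Computational_Algebra"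
begin

section \<open>Riemann surfaces\<close>

text \<open>
  A Riemann surface is given by an atlas; its points are the points covered by the charts, and
  its topology is the one that makes the charts homeomorphisms onto open subsets of the plane.
\<close>

type_synonym 'a chart = "'a set \<times> ('a \<Rightarrow> complex)"
type_synonym 'a atlas = "'a chart set"

definition rs_points :: "'a atlas \<Rightarrow> 'a set" where
  "rs_points A = (\<Union>(U, \<phi>)\<in>A. U)"

definition rs_topology :: "'a atlas \<Rightarrow> 'a topology" where
  "rs_topology A = topology (\<lambda>V. V \<subseteq> rs_points A \<and> (\<forall>(U, \<phi>)\<in>A. open (\<phi> ` (V \<inter> U))))"

definition holomorphic_atlas :: "'a atlas \<Rightarrow> bool" where
  "holomorphic_atlas A \<longleftrightarrow>
     (\<forall>(U, \<phi>)\<in>A. inj_on \<phi> U \<and> open (\<phi> ` U)) \<and>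
     (\<forall>(U, \<phi>)\<in>A. \<forall>(W, \<psi>)\<in>A. open (\<phi> ` (U \<inter> W)) \<and>
        (\<psi> \<circ> inv_into U \<phi>) holomorphic_on \<phi> ` (U \<inter> W))"

definition compact_riemann_surface :: "'a atlas \<Rightarrow> bool" where
  "compact_riemann_surface A \<longleftrightarrow>
     holomorphic_atlas A \<and> rs_points A \<noteq> {} \<and> Hausdorff_space (rs_topology A) \<and>
     compact_space (rs_topology A) \<and> connected_space (rs_topology A)"

text \<open>
  A holomorphic 1-form is a family of coefficient functions \<open>\<omega> (U, \<phi>)\<close>, holomorphic on the image
  of the chart, with \<open>\<omega> (U, \<phi>) dz\<close> independent of the chart. The coefficients are set to 0
  where they have no meaning, so that equality of forms is equality of functions.
\<close>

definition holomorphic_forms :: "'a atlas \<Rightarrow> ('a chart \<Rightarrow> complex \<Rightarrow> complex) set" where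
  "holomorphic_forms A = {\<omega>.
     (\<forall>U \<phi> z. (U, \<phi>) \<notin> A \<or> z \<notin> \<phi> ` U \<longrightarrow> \<omega> (U, \<phi>) z = 0) \<and>
     (\<forall>(U, \<phi>)\<in>A. \<omega> (U, \<phi>) holomorphic_on \<phi> ` U) \<and>
     (\<forall>(U, \<phi>)\<in>A. \<forall>(W, \<psi>)\<in>A. \<forall>p\<in>U \<inter> W.
        \<omega> (U, \<phi>) (\<phi> p) = \<omega> (W, \<psi>) (\<psi> p) * deriv (\<psi> \<circ> inv_into U \<phi>) (\<phi> p))}"

text \<open>The genus is the dimension of the space of holomorphic 1-forms: there is a basis with
  \<open>g\<close> elements.\<close>

definition has_genus :: "'a atlas \<Rightarrow> nat \<Rightarrow> bool" where
  "has_genus A g \<longleftrightarrow>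
     compact_riemann_surface A \<and>
     (\<exists>b :: nat \<Rightarrow> 'a chart \<Rightarrow> complex \<Rightarrow> complex.
        (\<forall>c :: nat \<Rightarrow> complex. (\<lambda>u z. \<Sum>i<g. c i * b i u z) \<in> holomorphic_forms A) \<and>
        (\<forall>\<omega>\<in>holomorphic_forms A. \<exists>!c :: nat \<Rightarrow> complex.
           (\<forall>i\<ge>g. c i = 0) \<and> \<omega> = (\<lambda>u z. \<Sum>i<g. c i * b i u z)))"

section \<open>Branched coverings\<close>

definition holomorphic_map :: "'a atlas \<Rightarrow> 'b atlas \<Rightarrow> ('a \<Rightarrow> 'b) \<Rightarrow> bool" where
  "holomorphic_map A B F \<longleftrightarrow>
     continuous_map (rs_topology A) (rs_topology B) F \<and>
     (\<forall>(U, \<phi>)\<in>A. \<forall>(W, \<psi>)\<in>B.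
        (\<psi> \<circ> F \<circ> inv_into U \<phi>) holomorphic_on \<phi> ` (U \<inter> F -` W))"

text \<open>The local degree (ramification order) is read off in arbitrarily chosen charts around the
  point and its image; for non-constant holomorphic maps it does not depend on that choice.\<close>

definition local_degree :: "'a atlas \<Rightarrow> 'b atlas \<Rightarrow> ('a \<Rightarrow> 'b) \<Rightarrow> 'a \<Rightarrow> nat" where
  "local_degree A B F p =
     (let (U, \<phi>) = (SOME c. c \<in> A \<and> p \<in> fst c);
          (W, \<psi>) = (SOME c. c \<in> B \<and> F p \<in> fst c)
      in nat (zorder (\<lambda>z. \<psi> (F (inv_into U \<phi> z)) - \<psi> (F p)) (\<phi> p)))"

definition fibre :: "'a atlas \<Rightarrow> ('a \<Rightarrow> 'b) \<Rightarrow> 'b \<Rightarrow> 'a set" where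
  "fibre A F q = {p \<in> rs_points A. F p = q}"

definition branched_covering :: "'a atlas \<Rightarrow> 'b atlas \<Rightarrow> nat \<Rightarrow> ('a \<Rightarrow> 'b) \<Rightarrow> bool" where
  "branched_covering A B d F \<longleftrightarrow>
     compact_riemann_surface A \<and> compact_riemann_surface B \<and> holomorphic_map A B F \<and> d > 0 \<and>
     (\<forall>q\<in>rs_points B. finite (fibre A F q) \<and> (\<Sum>p\<in>fibre A F q. local_degree A B F p) = d)"

definition ramifies_totally_to_order ::
    "'a atlas \<Rightarrow> 'b atlas \<Rightarrow> ('a \<Rightarrow> 'b) \<Rightarrow> 'b \<Rightarrow> nat \<Rightarrow> bool" where
  "ramifies_totally_to_order A B F q k \<longleftrightarrow>
     (\<forall>p\<in>fibre A F q. local_degree A B F p = k)"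

definition ramification_points :: "'a atlas \<Rightarrow> 'b atlas \<Rightarrow> ('a \<Rightarrow> 'b) \<Rightarrow> 'a set" where
  "ramification_points A B F = {p \<in> rs_points A. local_degree A B F p \<ge> 2}"

definition branch_points :: "'a atlas \<Rightarrow> 'b atlas \<Rightarrow> ('a \<Rightarrow> 'b) \<Rightarrow> 'b set" where
  "branch_points A B F = F ` ramification_points A B F"

section \<open>The Riemann sphere\<close>

text \<open>\<open>None\<close> is the point at infinity.\<close>

definition riemann_sphere :: "complex option atlas" where
  "riemann_sphere = {(range Some, the), (- {Some 0}, case_option 0 inverse)}"

section \<open>The smooth projective curve with affine equation \<open>Y\<^sup>2 = f(X)\<close>\<close>

text \<open>
  For squarefree \<open>f\<close> the affine curve is smooth: at every point one of the partial derivatives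
  \<open>2Y\<close> and \<open>-f'(X)\<close> of \<open>Y\<^sup>2 - f(X)\<close> is nonzero, and \<open>X\<close>, respectively \<open>Y\<close>, is a local coordinate.
\<close>

definition affine_curve :: "complex poly \<Rightarrow> (complex \<times> complex) set" where
  "affine_curve f = {(X, Y). Y\<^sup>2 = poly f X}"

definition affine_charts :: "complex poly \<Rightarrow> (complex \<times> complex) atlas" where
  "affine_charts f =
     {(S, fst) | S. openin (top_of_set (affine_curve f)) S \<and> inj_on fst S \<and>
                    (\<forall>(X, Y)\<in>S. Y \<noteq> 0)} \<union>
     {(S, snd) | S. openin (top_of_set (affine_curve f)) S \<and> inj_on snd S \<and>
                    (\<forall>(X, Y)\<in>S. poly (pderiv f) X \<noteq> 0)}"

text \<open>
  Let \<open>n = \<lceil>deg f / 2\<rceil>\<close>. The smooth projective curve is glued from the affine curve and the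
  affine curve \<open>V\<^sup>2 = U\<^sup>2\<^sup>n f(1/U)\<close> along \<open>U = 1/X\<close>, \<open>V = Y/X\<^sup>n\<close>; it is the closure of the affine
  curve in the weighted projective plane with weights 1, n, 1. The points at infinity are those
  with \<open>U = 0\<close>, which are determined by \<open>V\<close>.
\<close>

datatype curve_point = Affine complex complex | Infinite complex

definition half_degree :: "complex poly \<Rightarrow> nat" where
  "half_degree f = (degree f + 1) div 2"

definition poly_at_infinity :: "complex poly \<Rightarrow> complex poly" where
  "poly_at_infinity f = monom 1 (2 * half_degree f - degree f) * reflect_poly f"

definition affine_incl :: "complex \<times> complex \<Rightarrow> curve_point" where
  "affine_incl = (\<lambda>(X, Y). Affine X Y)"

definition infinite_incl :: "nat \<Rightarrow> complex \<times> complex \<Rightarrow> curve_point" where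
  "infinite_incl n = (\<lambda>(U, V). if U = 0 then Infinite V else Affine (1 / U) (V / U ^ n))"

definition transport_charts :: "('a \<Rightarrow> 'b) \<Rightarrow> 'a atlas \<Rightarrow> 'b atlas" where
  "transport_charts \<iota> A = {(\<iota> ` S, \<phi> \<circ> inv \<iota>) | S \<phi>. (S, \<phi>) \<in> A}"

definition projective_curve :: "complex poly \<Rightarrow> curve_point atlas" where
  "projective_curve f =
     transport_charts affine_incl (affine_charts f) \<union>
     transport_charts (infinite_incl (half_degree f)) (affine_charts (poly_at_infinity f))"

text \<open>A map to the Riemann sphere given by a rational expression is the holomorphic map which
  agrees with that expression wherever the denominator does not vanish.\<close>

definition given_by_rational_expression ::
    "complex poly \<Rightarrow> (complex \<Rightarrow> complex \<Rightarrow> complex) \<Rightarrow> (complex \<Rightarrow> complex \<Rightarrow> complex) \<Rightarrow>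
     (curve_point \<Rightarrow> complex option) \<Rightarrow> bool" where
  "given_by_rational_expression f P Q F \<longleftrightarrow>
     holomorphic_map (projective_curve f) riemann_sphere F \<and>
     (\<forall>X Y. Affine X Y \<in> rs_points (projective_curve f) \<and> Q X Y \<noteq> 0 \<longrightarrow>
            F (Affine X Y) = Some (P X Y / Q X Y))"

section \<open>The curves \<open>E\<close> and \<open>X\<^sub>t\<close> and the map \<open>\<phi>\<^sub>t\<close>\<close>

definition E_poly :: "complex poly" where
  "E_poly = [:1, 0, 0, 1:]"

definition E_curve :: "curve_point atlas" where
  "E_curve = projective_curve E_poly"

definition X_poly :: "complex \<Rightarrow> complex poly" where
  "X_poly x = - (smult (x + 1) ([:-1, 0, 1:] * [:x\<^sup>2 - x + 1, 0, 3 * (x - 1), 0, 3:]))"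

definition X_curve :: "complex \<Rightarrow> curve_point atlas" where
  "X_curve x = projective_curve (X_poly x)"

definition phi_num :: "complex \<Rightarrow> complex \<Rightarrow> complex \<Rightarrow> complex \<Rightarrow> complex" where
  "phi_num x y X Y =
     (x - 2)\<^sup>2 * X\<^sup>2 * (Y - 3 * y) + 4 * (x\<^sup>2 - x + 1) * (y - Y)
     + (x\<^sup>2 + 2 * x + 1 - 3 * y) * X ^ 6 - 6 * y * (x - 2) * X ^ 4"

definition phi_den :: "complex \<Rightarrow> complex \<Rightarrow> complex \<Rightarrow> complex" where
  "phi_den x X Y = 2 * (1 + x)\<^sup>2 * X ^ 6"

text \<open>
  The value of \<open>\<phi>\<^sub>t\<close> at \<open>(0, y\<^sub>t)\<close>. With \<open>2P\<close> the double of \<open>P = (x\<^sub>t, y\<^sub>t)\<close> in the group \<open>E\<close>, it is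
  \<open>(1 + y(2P)) / 2\<close>, where \<open>y(2P) = (x\<^sub>t\<^sup>6 + 20 x\<^sub>t\<^sup>3 - 8) / (8 y\<^sub>t\<^sup>3)\<close>. The expression
  \<open>x\<^sub>t (x\<^sub>t\<^sup>3 - 8) / (4 (x\<^sub>t\<^sup>3 + 1))\<close> printed in the source for this value is \<open>x(2P)\<close> instead:
  for \<open>P = (2, 3)\<close> the value of \<open>\<phi>\<^sub>t\<close> is 1, whereas \<open>x(2P) = 0\<close>.
\<close>

definition branch_value :: "complex \<Rightarrow> complex \<Rightarrow> complex" where
  "branch_value x y = (1 + (x ^ 6 + 20 * x ^ 3 - 8) / (8 * y ^ 3)) / 2"

lemma branch_value_on_E:
  assumes "y\<^sup>2 = x ^ 3 + 1" and "y \<noteq> 0"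
  shows "(2 * branch_value x y - 1)\<^sup>2 = (x * (x ^ 3 - 8) / (4 * (x ^ 3 + 1))) ^ 3 + 1"
proof -
  have y6: "(y ^ 3)\<^sup>2 = (x ^ 3 + 1) ^ 3"
    using assms(1) by (metis power_mult mult.commute)
  have nz: "x ^ 3 + 1 \<noteq> 0"
    using assms by (metis power_not_zero)
  have "2 * branch_value x y - 1 = (x ^ 6 + 20 * x ^ 3 - 8) / (8 * y ^ 3)"
  proof -
    have "2 * ((1 + a) / 2) - 1 = a" for a :: complex
      by (simp add: field_simps)
    then show ?thesis
      unfolding branch_value_def .
  qed
  then have "(2 * branch_value x y - 1)\<^sup>2 = (x ^ 6 + 20 * x ^ 3 - 8)\<^sup>2 / (64 * (x ^ 3 + 1) ^ 3)"
    by (simp only: power_divide power_mult_distrib y6) simp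
  also have "(x ^ 6 + 20 * x ^ 3 - 8)\<^sup>2 = (x * (x ^ 3 - 8)) ^ 3 + 64 * (x ^ 3 + 1) ^ 3"
    by algebra
  also have "\<dots> / (64 * (x ^ 3 + 1) ^ 3) = (x * (x ^ 3 - 8) / (4 * (x ^ 3 + 1))) ^ 3 + 1"
    using nz by (simp add: power_divide power_mult_distrib add_divide_distrib
      del: distrib_left_numeral)
  finally show ?thesis .
qed

text \<open>So the branch value collides with 0 or 1 exactly at the points of \<open>E\<close> with
  \<open>x\<^sub>t (x\<^sub>t\<^sup>3 - 8) = 0\<close>.\<close>

lemma branch_value_eq_0_or_1_iff:
  assumes "y\<^sup>2 = x ^ 3 + 1" and "y \<noteq> 0"
  shows "branch_value x y \<in> {0, 1} \<longleftrightarrow> x * (x ^ 3 - 8) = 0"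
proof -
  have nz: "x ^ 3 + 1 \<noteq> 0"
    using assms by (metis power_not_zero)
  have "4 * (branch_value x y * (branch_value x y - 1)) =
        (x * (x ^ 3 - 8) / (4 * (x ^ 3 + 1))) ^ 3"
    using branch_value_on_E[OF assms] by algebra
  then have "branch_value x y * (branch_value x y - 1) = 0 \<longleftrightarrow>
             x * (x ^ 3 - 8) / (4 * (x ^ 3 + 1)) = 0"
    by (metis mult_eq_0_iff power_eq_0_iff zero_neq_numeral zero_less_numeral)
  moreover have "4 * (x ^ 3 + 1) \<noteq> 0"
    using nz by (simp del: distrib_left_numeral)
  ultimately show ?thesis
    by (simp del: distrib_left_numeral)
qed

end

theory Submission
  imports Defs
begin

text \<open>
  In the coordinates \<open>\<xi> = (2 - x - 3 X\<^sup>2) / (x + 1)\<close> and \<open>\<eta> = 3 Y / (x + 1)\<^sup>2\<close> the equation of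
  \<open>X\<^sub>t\<close> becomes \<open>\<eta>\<^sup>2 = \<xi>\<^sup>3 + 1\<close>, so \<open>(X, Y) \<mapsto> (\<xi>, \<eta>)\<close> is a double cover of \<open>E\<close>, branched over the two
  points \<open>\<plusminus>Q\<close> below \<open>X = 0\<close>. The function \<open>(1 + \<eta>) / 2\<close> is a triple cover of the sphere by \<open>E\<close>
  which is totally ramified over \<open>0\<close>, \<open>1\<close> and \<open>\<infinity>\<close> and nowhere else, and \<open>\<phi>\<^sub>t\<close> is the
  composite of the double cover, the involution \<open>P \<mapsto> Q - P\<close> of \<open>E\<close> and this triple cover. One
  branch point of the double cover is sent to \<open>\<infinity>\<close>, which makes the ramification there of order 6,
  and the other one gives the additional simple branch point of \<open>\<phi>\<^sub>t\<close>. Local degrees multiply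
  under composition, so they only have to be computed for the three factors.

  The genus is found by dividing a holomorphic form on \<open>Y\<^sup>2 = f(X)\<close> by \<open>dX / Y\<close>. The quotient
  \<open>h\<close> is holomorphic on the affine curve and grows at most like \<open>X\<^sup>n\<^sup>-\<^sup>2\<close>, where
  \<open>n = \<lceil>deg f / 2\<rceil>\<close>, so by Liouville's theorem \<open>h(X, Y) + h(X, -Y)\<close> is a polynomial of degree
  at most \<open>n - 2\<close>, while \<open>Y (h(X, Y) - h(X, -Y))\<close> is a polynomial of degree at most \<open>2 n - 2\<close>
  which vanishes at the \<open>deg f\<close> roots of \<open>f\<close>, hence is zero. The same two entire functions, formed
  with the indicator function of a clopen set, show that the curve is connected.
\<close>

section \<open>Holomorphic maps in charts\<close>

text \<open>Write P for the given point (x, y). The point Q is P + (-1, 0), a translate by a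
  2-torsion point, so 2 Q = 2 P. The point (0, y) of the genus 2 curve lies over -Q and is sent to Q
  + Q = 2 P, which is why its value is (1 + y(2 P)) / 2; the point (0, -y) lies over Q and is sent
  to the origin of E, at infinity. The condition y \<noteq> 0 excludes x = -1 and makes Q differ
  from -Q, as smoothness of the genus 2 curve requires.

  The definition of \<open>local_degree\<close> chooses charts arbitrarily and takes
  \<open>zorder\<close>, which is awkward under composition and change of chart. Orders are
  therefore carried as a relation, a local factorization g(w) (w - z)^k with g analytic and nonzero
  at z, which passes through both; \<open>zorder\<close> enters only at the end. The involution
  needs no order computation, since an injective holomorphic map has order 1. Its cost is holomorphy
  at Q, at -Q and at infinity, where the chord formula is undefined and has to be rewritten.\<close>

abbreviation near :: "'a atlas \<Rightarrow> 'a \<Rightarrow> 'a filter" where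
  "near A p \<equiv> nhdsin (rs_topology A) p"

text \<open>Intersections are the delicate point: the image of an intersection is the intersection
  of the images because each chart is injective. Until this is known, \<open>topology\<close> in
  \<open>rs_topology\<close> says nothing about the open sets.\<close>

lemma istopology_rs:
  assumes "holomorphic_atlas A"
  shows "istopology (\<lambda>V. V \<subseteq> rs_points A \<and> (\<forall>(U, \<phi>)\<in>A. open (\<phi> ` (V \<inter> U))))"
  unfolding istopology_def
proof (intro conjI allI impI)
  fix S T
  assume S: "S \<subseteq> rs_points A \<and> (\<forall>(U, \<phi>)\<in>A. open (\<phi> ` (S \<inter> U)))"
    and T: "T \<subseteq> rs_points A \<and> (\<forall>(U, \<phi>)\<in>A. open (\<phi> ` (T \<inter> U)))"
  then show "S \<inter> T \<subseteq> rs_points A" by blast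
  show "\<forall>(U, \<phi>)\<in>A. open (\<phi> ` (S \<inter> T \<inter> U))"
  proof clarify
    fix U \<phi> assume c: "(U, \<phi>) \<in> A"
    then have "inj_on \<phi> U" using assms by (auto simp: holomorphic_atlas_def)
    then have "\<phi> ` (S \<inter> T \<inter> U) = \<phi> ` (S \<inter> U) \<inter> \<phi> ` (T \<inter> U)"
      by (auto simp: inj_on_def)
    then show "open (\<phi> ` (S \<inter> T \<inter> U))" using S T c by auto
  qed
next
  fix K
  assume K: "\<forall>S\<in>K. S \<subseteq> rs_points A \<and> (\<forall>(U, \<phi>)\<in>A. open (\<phi> ` (S \<inter> U)))"
  then show "\<Union>K \<subseteq> rs_points A" by blast
  show "\<forall>(U, \<phi>)\<in>A. open (\<phi> ` (\<Union>K \<inter> U))"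
  proof clarify
    fix U \<phi> assume c: "(U, \<phi>) \<in> A"
    have "\<phi> ` (\<Union>K \<inter> U) = (\<Union>S\<in>K. \<phi> ` (S \<inter> U))" by blast
    moreover have "open (\<Union>S\<in>K. \<phi> ` (S \<inter> U))" using K c by (intro open_UN) blast
    ultimately show "open (\<phi> ` (\<Union>K \<inter> U))" by simp
  qed
qed

lemma openin_rs:
  assumes "holomorphic_atlas A"
  shows "openin (rs_topology A) V \<longleftrightarrow> V \<subseteq> rs_points A \<and> (\<forall>(U, \<phi>)\<in>A. open (\<phi> ` (V \<inter> U)))"
  unfolding rs_topology_def using istopology_rs[OF assms] by (simp add: topology_inverse')

lemma chart_subset_points: "(U, \<phi>) \<in> A \<Longrightarrow> U \<subseteq> rs_points A"
  by (auto simp: rs_points_def)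

lemma chart_inj: "holomorphic_atlas A \<Longrightarrow> (U, \<phi>) \<in> A \<Longrightarrow> inj_on \<phi> U"
  by (auto simp: holomorphic_atlas_def)

lemma chart_open_image: "holomorphic_atlas A \<Longrightarrow> (U, \<phi>) \<in> A \<Longrightarrow> open (\<phi> ` U)"
  by (auto simp: holomorphic_atlas_def)

lemma chart_overlap_open:
  "holomorphic_atlas A \<Longrightarrow> (U, \<phi>) \<in> A \<Longrightarrow> (W, \<psi>) \<in> A \<Longrightarrow> open (\<phi> ` (U \<inter> W))"
  by (fastforce simp: holomorphic_atlas_def)

lemma chart_transition:
  "holomorphic_atlas A \<Longrightarrow> (U, \<phi>) \<in> A \<Longrightarrow> (W, \<psi>) \<in> A \<Longrightarrow>
   (\<psi> \<circ> inv_into U \<phi>) holomorphic_on \<phi> ` (U \<inter> W)"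
  by (fastforce simp: holomorphic_atlas_def)

lemma topspace_rs [simp]:
  assumes "holomorphic_atlas A"
  shows "topspace (rs_topology A) = rs_points A"
proof -
  have "\<forall>(U, \<phi>)\<in>A. open (\<phi> ` (rs_points A \<inter> U))"
    using chart_open_image[OF assms] chart_subset_points by (fastforce simp: Int_absorb1)
  then have "openin (rs_topology A) (rs_points A)"
    by (simp add: openin_rs[OF assms])
  moreover have "\<And>V. openin (rs_topology A) V \<Longrightarrow> V \<subseteq> rs_points A"
    by (simp add: openin_rs[OF assms])
  ultimately show ?thesis
    by (meson openin_subset openin_topspace subset_antisym)
qed

text \<open>Inside one chart domain a single test suffices: the image in any other chart is the
  preimage of an open set under a continuous transition map.\<close>

lemma openin_rs_chart:
  assumes A: "holomorphic_atlas A" and c: "(U, \<phi>) \<in> A" and "V \<subseteq> U"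
  shows "openin (rs_topology A) V \<longleftrightarrow> open (\<phi> ` V)"
proof
  assume "openin (rs_topology A) V"
  then have "open (\<phi> ` (V \<inter> U))" using c by (auto simp: openin_rs[OF A])
  then show "open (\<phi> ` V)" using \<open>V \<subseteq> U\<close> by (simp add: Int_absorb2)
next
  assume o: "open (\<phi> ` V)"
  have "open (\<psi> ` (V \<inter> W))" if d: "(W, \<psi>) \<in> A" for W \<psi>
  proof -
    let ?t = "\<phi> \<circ> inv_into W \<psi>"
    have "open (\<psi> ` (W \<inter> U) \<inter> ?t -` (\<phi> ` V))"
      by (intro continuous_open_preimage holomorphic_on_imp_continuous_on
          chart_transition[OF A d c] chart_overlap_open[OF A d c] o)
    also have "\<psi> ` (W \<inter> U) \<inter> ?t -` (\<phi> ` V) = \<psi> ` (V \<inter> W)"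
      using \<open>V \<subseteq> U\<close> inj_onD[OF chart_inj[OF A c]] chart_inj[OF A d]
      by (fastforce simp: subset_iff)
    finally show ?thesis .
  qed
  then show "openin (rs_topology A) V"
    using \<open>V \<subseteq> U\<close> chart_subset_points[OF c] by (auto simp: openin_rs[OF A])
qed

lemma chart_open: "holomorphic_atlas A \<Longrightarrow> (U, \<phi>) \<in> A \<Longrightarrow> openin (rs_topology A) U"
  by (simp add: openin_rs_chart chart_open_image)

text \<open>Turns neighbourhoods on the surface into neighbourhoods in the plane, so that later
  arguments about germs take place in one complex variable.\<close>

lemma eventually_rs:
  assumes A: "holomorphic_atlas A" and c: "(U, \<phi>) \<in> A" and p: "p \<in> U"
  shows "eventually P (near A p) \<longleftrightarrow>
         (\<forall>\<^sub>F z in nhds (\<phi> p). P (inv_into U \<phi> z))"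
proof -
  have pp: "p \<in> topspace (rs_topology A)"
    using chart_subset_points[OF c] p topspace_rs[OF A] by blast
  note inj = chart_inj[OF A c]
  show ?thesis
  proof
    assume "eventually P (near A p)"
    then obtain S where S: "openin (rs_topology A) S" "p \<in> S" "\<forall>x\<in>S. P x"
      using pp by (auto simp: eventually_nhdsin)
    then have "open (\<phi> ` (S \<inter> U))" using c by (auto simp: openin_rs[OF A])
    moreover have "\<phi> p \<in> \<phi> ` (S \<inter> U)" using S p by auto
    moreover have "\<forall>z\<in>\<phi> ` (S \<inter> U). P (inv_into U \<phi> z)" using S inj by auto
    ultimately show "\<forall>\<^sub>F z in nhds (\<phi> p). P (inv_into U \<phi> z)"
      unfolding eventually_nhds by blast
  next
    assume "\<forall>\<^sub>F z in nhds (\<phi> p). P (inv_into U \<phi> z)"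
    then obtain S where S: "open S" "\<phi> p \<in> S" "\<forall>z\<in>S. P (inv_into U \<phi> z)"
      unfolding eventually_nhds by blast
    define V where "V = {q \<in> U. \<phi> q \<in> S}"
    have "\<phi> ` V = S \<inter> \<phi> ` U" by (auto simp: V_def)
    then have "openin (rs_topology A) V"
      using openin_rs_chart[OF A c, of V] S chart_open_image[OF A c] by (auto simp: V_def)
    moreover have "p \<in> V" using S p by (simp add: V_def)
    moreover have "\<forall>q\<in>V. P q" using S inj by (auto simp: V_def)
    ultimately show "eventually P (near A p)"
      by (auto simp: eventually_nhdsin)
  qed
qed

lemma eventually_in_chart:
  assumes A: "holomorphic_atlas A" and c: "(U, \<phi>) \<in> A" and p: "p \<in> U"
  shows "\<forall>\<^sub>F z in nhds (\<phi> p). z \<in> \<phi> ` U"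
  using chart_open_image[OF A c] p by (intro eventually_nhds_in_open) auto

lemma eventually_nhdsin_self:
  "p \<in> topspace X \<Longrightarrow> eventually P (nhdsin X p) \<Longrightarrow> P p"
  by (auto simp: eventually_nhdsin)

lemma transition_analytic:
  assumes A: "holomorphic_atlas A" and c: "(U, \<phi>) \<in> A" and d: "(W, \<psi>) \<in> A"
    and p: "p \<in> U" "p \<in> W"
  shows "(\<lambda>z. \<psi> (inv_into U \<phi> z)) analytic_on {\<phi> p}"
  using chart_transition[OF A c d] chart_overlap_open[OF A c d] p
  by (auto simp: analytic_at o_def)

text \<open>Asked in some chart, so that it can be proved in the most convenient one;
  \<open>local_holo_chart\<close> then supplies every other chart.\<close>

definition local_holo :: "'a atlas \<Rightarrow> ('a \<Rightarrow> complex) \<Rightarrow> 'a \<Rightarrow> bool" where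
  "local_holo A F p \<longleftrightarrow>
     (\<exists>U \<phi>. (U, \<phi>) \<in> A \<and> p \<in> U \<and> (\<lambda>z. F (inv_into U \<phi> z)) analytic_on {\<phi> p})"

lemma local_holo_chart:
  assumes A: "holomorphic_atlas A" and c: "(U, \<phi>) \<in> A" and p: "p \<in> U"
  shows "local_holo A F p \<longleftrightarrow> (\<lambda>z. F (inv_into U \<phi> z)) analytic_on {\<phi> p}"
proof
  assume "local_holo A F p"
  then obtain W \<psi> where d: "(W, \<psi>) \<in> A" "p \<in> W" "(\<lambda>z. F (inv_into W \<psi> z)) analytic_on {\<psi> p}"
    unfolding local_holo_def by blast
  let ?t = "\<lambda>z. \<psi> (inv_into U \<phi> z)"
  have t: "?t analytic_on {\<phi> p}" by (rule transition_analytic[OF A c d(1) p d(2)])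
  have tp: "?t (\<phi> p) = \<psi> p" using chart_inj[OF A c] p by simp
  have an: "((\<lambda>z. F (inv_into W \<psi> z)) \<circ> ?t) analytic_on {\<phi> p}"
    using d(3) by (intro analytic_on_compose t) (simp add: tp)
  have "\<forall>\<^sub>F z in nhds (\<phi> p). z \<in> \<phi> ` (U \<inter> W)"
    using chart_overlap_open[OF A c d(1)] p d(2) by (intro eventually_nhds_in_open) auto
  then have "\<forall>\<^sub>F z in nhds (\<phi> p). ((\<lambda>z. F (inv_into W \<psi> z)) \<circ> ?t) z = F (inv_into U \<phi> z)"
    by eventually_elim (use chart_inj[OF A c] chart_inj[OF A d(1)] in auto)
  from analytic_at_cong[OF this refl] an
  show "(\<lambda>z. F (inv_into U \<phi> z)) analytic_on {\<phi> p}" by blast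
qed (use assms in \<open>auto simp: local_holo_def\<close>)

text \<open>The factorization excludes functions that vanish identically near z, and it can be
  substituted into another one, which is what composition needs.\<close>

definition order_at :: "(complex \<Rightarrow> complex) \<Rightarrow> complex \<Rightarrow> nat \<Rightarrow> bool" where
  "order_at h z k \<longleftrightarrow>
     (\<exists>g. g analytic_on {z} \<and> g z \<noteq> 0 \<and> (\<forall>\<^sub>F w in nhds z. h w = g w * (w - z) ^ k))"

lemma order_at_cong:
  assumes "\<forall>\<^sub>F w in nhds z. h w = h' w" and "order_at h z k"
  shows "order_at h' z k"
proof -
  obtain g where g: "g analytic_on {z}" "g z \<noteq> 0" "\<forall>\<^sub>F w in nhds z. h w = g w * (w - z) ^ k"
    using assms(2) unfolding order_at_def by blast
  have "\<forall>\<^sub>F w in nhds z. h' w = g w * (w - z) ^ k"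
    using assms(1) g(3) by eventually_elim auto
  with g show ?thesis unfolding order_at_def by blast
qed

lemma order_at_analytic:
  assumes "order_at h z k" shows "h analytic_on {z}"
proof -
  obtain g where g: "g analytic_on {z}" "\<forall>\<^sub>F w in nhds z. h w = g w * (w - z) ^ k"
    using assms unfolding order_at_def by blast
  have "(\<lambda>w. g w * (w - z) ^ k) analytic_on {z}" by (intro analytic_intros g)
  with analytic_at_cong[OF g(2) refl] show ?thesis by blast
qed

lemma order_at_imp_zorder:
  assumes "order_at h z k" shows "zorder h z = int k"
proof -
  obtain g where g: "g analytic_on {z}" "g z \<noteq> 0" "\<forall>\<^sub>F w in nhds z. h w = g w * (w - z) ^ k"
    using assms unfolding order_at_def by blast
  obtain S where S: "open S" "z \<in> S" "g holomorphic_on S" using g(1) by (auto simp: analytic_at)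
  obtain T where T: "open T" "z \<in> T" "\<forall>w\<in>T. h w = g w * (w - z) ^ k"
    using g(3) by (auto simp: eventually_nhds)
  show ?thesis
  proof (rule zorder_eqI)
    show "open (S \<inter> T)" "z \<in> S \<inter> T" using S T by auto
    show "g holomorphic_on S \<inter> T" using S(3) holomorphic_on_subset by blast
  qed (use T g in auto)
qed

text \<open>Substituting T w - T z = f (w - z)^l into g (T w - T z)^k leaves the unit g(T w) f^k, so
  orders multiply.\<close>

lemma order_at_compose:
  assumes h: "order_at h (T z) k" and T: "order_at (\<lambda>w. T w - T z) z l"
  shows "order_at (\<lambda>w. h (T w)) z (k * l)"
proof -
  obtain g where g: "g analytic_on {T z}" "g (T z) \<noteq> 0"
      "\<forall>\<^sub>F w in nhds (T z). h w = g w * (w - T z) ^ k"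
    using h unfolding order_at_def by blast
  obtain f where f: "f analytic_on {z}" "f z \<noteq> 0"
      "\<forall>\<^sub>F w in nhds z. T w - T z = f w * (w - z) ^ l"
    using T unfolding order_at_def by blast
  have "(\<lambda>w. (T w - T z) + T z) analytic_on {z}"
    by (intro analytic_intros order_at_analytic[OF T])
  then have Ta: "T analytic_on {z}" by simp
  then have "isCont T z" by (simp add: analytic_at_imp_isCont)
  then have "filterlim T (nhds (T z)) (nhds z)"
    by (simp add: isCont_def tendsto_nhds_iff)
  from eventually_compose_filterlim[OF g(3) this] f(3)
  have ev: "\<forall>\<^sub>F w in nhds z. h (T w) = (g (T w) * f w ^ k) * (w - z) ^ (k * l)"
    by eventually_elim (simp add: power_mult_distrib power_mult [symmetric] mult.commute)
  have "(\<lambda>w. (g \<circ> T) w * f w ^ k) analytic_on {z}"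
    by (intro analytic_intros f analytic_on_compose Ta) (use g in simp)
  then show ?thesis unfolding order_at_def
    by (intro exI[of _ "\<lambda>w. g (T w) * f w ^ k"]) (use ev g f in \<open>auto simp: o_def\<close>)
qed

lemma order_at_one:
  assumes h: "h analytic_on {z}" and d: "deriv h z \<noteq> 0"
  shows "order_at (\<lambda>w. h w - h z) z 1"
proof -
  obtain S where S: "open S" "z \<in> S" "h holomorphic_on S" using h by (auto simp: analytic_at)
  obtain g r where g: "0 < r" "g holomorphic_on ball z r"
      "\<And>w. w \<in> ball z r \<Longrightarrow> h w - h z = (w - z) ^ 1 * g w" "\<And>w. w \<in> ball z r \<Longrightarrow> g w \<noteq> 0"
    by (rule holomorphic_factor_order_of_zero[OF S(3,1,2), of 1]) (use d in auto)
  have "g analytic_on {z}" using g(1,2) by (auto simp: analytic_at intro!: exI[of _ "ball z r"])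
  moreover have "\<forall>\<^sub>F w in nhds z. w \<in> ball z r" using g(1) by (intro eventually_nhds_in_open) auto
  then have "\<forall>\<^sub>F w in nhds z. h w - h z = g w * (w - z) ^ 1"
    by eventually_elim (use g(3) in \<open>simp add: mult.commute\<close>)
  ultimately show ?thesis unfolding order_at_def using g(1,4) by (metis centre_in_ball)
qed

lemma deriv_transition:
  assumes A: "holomorphic_atlas A" and c: "(U, \<phi>) \<in> A" and d: "(W, \<psi>) \<in> A"
    and p: "p \<in> U" "p \<in> W"
    and F: "local_holo A F p"
  shows "deriv (\<lambda>z. F (inv_into U \<phi> z)) (\<phi> p) =
         deriv (\<lambda>z. F (inv_into W \<psi> z)) (\<psi> p) * deriv (\<lambda>z. \<psi> (inv_into U \<phi> z)) (\<phi> p)"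
proof -
  let ?t = "\<lambda>z. \<psi> (inv_into U \<phi> z)" and ?f = "\<lambda>z. F (inv_into W \<psi> z)"
  have tp: "?t (\<phi> p) = \<psi> p" using chart_inj[OF A c] p by simp
  have t: "?t analytic_on {\<phi> p}" by (rule transition_analytic[OF A c d p])
  have f: "?f analytic_on {\<psi> p}" using F by (simp only: local_holo_chart[OF A d p(2)])
  have "\<forall>\<^sub>F z in nhds (\<phi> p). z \<in> \<phi> ` (U \<inter> W)"
    using chart_overlap_open[OF A c d] p by (intro eventually_nhds_in_open) auto
  then have "\<forall>\<^sub>F z in nhds (\<phi> p). F (inv_into U \<phi> z) = (?f \<circ> ?t) z"
    by eventually_elim (use chart_inj[OF A c] chart_inj[OF A d] in auto)
  then have "deriv (\<lambda>z. F (inv_into U \<phi> z)) (\<phi> p) = deriv (?f \<circ> ?t) (\<phi> p)"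
    by (rule deriv_cong_ev) simp
  also have "\<dots> = deriv ?f (?t (\<phi> p)) * deriv ?t (\<phi> p)"
    using t f by (intro deriv_chain) (auto simp: tp analytic_on_imp_differentiable_at)
  finally show ?thesis by (simp only: tp)
qed

lemma local_holo_coord:
  assumes A: "holomorphic_atlas A" and c: "(U, \<phi>) \<in> A" and p: "p \<in> U"
  shows "local_holo A \<phi> p"
  using transition_analytic[OF A c c p p] local_holo_chart[OF A c p] by simp

lemma deriv_self_chart:
  assumes A: "holomorphic_atlas A" and c: "(U, \<phi>) \<in> A" and p: "p \<in> U"
  shows "deriv (\<lambda>z. \<phi> (inv_into U \<phi> z)) (\<phi> p) = 1"
proof -
  have "\<forall>\<^sub>F z in nhds (\<phi> p). \<phi> (inv_into U \<phi> z) = z"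
    using eventually_in_chart[OF A c p] by eventually_elim (simp add: f_inv_into_f)
  from deriv_cong_ev[OF this refl] show ?thesis by simp
qed

text \<open>The coordinate \<phi> has derivative 1 in its own chart, and the chain rule through
  \<psi> makes the transition derivative a factor of this 1.\<close>

lemma deriv_transition_nonzero:
  assumes A: "holomorphic_atlas A" and c: "(U, \<phi>) \<in> A" and d: "(W, \<psi>) \<in> A"
    and p: "p \<in> U" "p \<in> W"
  shows "deriv (\<lambda>z. \<psi> (inv_into U \<phi> z)) (\<phi> p) \<noteq> 0"
  using deriv_transition[OF A c d p local_holo_coord[OF A c p(1)]]
    deriv_self_chart[OF A c p(1)] by auto

lemma order_at_transition:
  assumes A: "holomorphic_atlas A" and c: "(U, \<phi>) \<in> A" and d: "(W, \<psi>) \<in> A"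
    and p: "p \<in> U" "p \<in> W"
  shows "order_at (\<lambda>z. \<psi> (inv_into U \<phi> z) - \<psi> p) (\<phi> p) 1"
  using order_at_one[OF transition_analytic[OF A c d p] deriv_transition_nonzero[OF A c d p]]
    chart_inj[OF A c] p by simp

definition local_order :: "'a atlas \<Rightarrow> ('a \<Rightarrow> complex) \<Rightarrow> 'a \<Rightarrow> nat \<Rightarrow> bool" where
  "local_order A F p k \<longleftrightarrow>
     (\<exists>U \<phi>. (U, \<phi>) \<in> A \<and> p \<in> U \<and> order_at (\<lambda>z. F (inv_into U \<phi> z) - F p) (\<phi> p) k)"

text \<open>A transition map has order 1, so passing through it multiplies the order by 1.\<close>

lemma local_order_chart:
  assumes A: "holomorphic_atlas A" and c: "(U, \<phi>) \<in> A" and p: "p \<in> U"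
  shows "local_order A F p k \<longleftrightarrow> order_at (\<lambda>z. F (inv_into U \<phi> z) - F p) (\<phi> p) k"
proof
  assume "local_order A F p k"
  then obtain W \<psi> where d: "(W, \<psi>) \<in> A" "p \<in> W"
      "order_at (\<lambda>z. F (inv_into W \<psi> z) - F p) (\<psi> p) k"
    unfolding local_order_def by blast
  let ?t = "\<lambda>z. \<psi> (inv_into U \<phi> z)"
  have tp: "?t (\<phi> p) = \<psi> p" using chart_inj[OF A c] p by simp
  have "order_at (\<lambda>z. F (inv_into W \<psi> (?t z)) - F p) (\<phi> p) (k * 1)"
    by (rule order_at_compose) (use order_at_transition[OF A c d(1) p d(2)] d(3) tp in simp_all)
  moreover have "\<forall>\<^sub>F z in nhds (\<phi> p). z \<in> \<phi> ` (U \<inter> W)"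
    using chart_overlap_open[OF A c d(1)] p d(2) by (intro eventually_nhds_in_open) auto
  then have "\<forall>\<^sub>F z in nhds (\<phi> p). F (inv_into W \<psi> (?t z)) - F p = F (inv_into U \<phi> z) - F p"
    by eventually_elim (use chart_inj[OF A c] chart_inj[OF A d(1)] in auto)
  ultimately show "order_at (\<lambda>z. F (inv_into U \<phi> z) - F p) (\<phi> p) k"
    unfolding mult_1_right by - (rule order_at_cong, assumption+)
qed (use assms in \<open>auto simp: local_order_def\<close>)

lemma chart_at:
  assumes "p \<in> rs_points A"
  obtains U \<phi> where "(U, \<phi>) \<in> A" "p \<in> U"
  using assms by (auto simp: rs_points_def)

lemma local_order_imp_holo:
  assumes "local_order A F p k" shows "local_holo A F p"
proof -
  obtain U \<phi> where c: "(U, \<phi>) \<in> A" "p \<in> U" "order_at (\<lambda>z. F (inv_into U \<phi> z) - F p) (\<phi> p) k"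
    using assms unfolding local_order_def by blast
  have "(\<lambda>z. (F (inv_into U \<phi> z) - F p) + F p) analytic_on {\<phi> p}"
    by (intro analytic_intros order_at_analytic[OF c(3)])
  then show ?thesis using c unfolding local_holo_def by auto
qed

lemma local_holo_cong:
  assumes A: "holomorphic_atlas A"
    and ev: "\<forall>\<^sub>F q in near A p. F q = G q" and F: "local_holo A F p"
  shows "local_holo A G p"
proof -
  obtain U \<phi> where c: "(U, \<phi>) \<in> A" "p \<in> U" "(\<lambda>z. F (inv_into U \<phi> z)) analytic_on {\<phi> p}"
    using F unfolding local_holo_def by blast
  have "\<forall>\<^sub>F z in nhds (\<phi> p). F (inv_into U \<phi> z) = G (inv_into U \<phi> z)"
    using ev by (simp only: eventually_rs[OF A c(1,2)])
  from analytic_at_cong[OF this refl] c show ?thesis unfolding local_holo_def by blast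
qed

lemma local_order_cong:
  assumes A: "holomorphic_atlas A"
    and ev: "\<forall>\<^sub>F q in near A p. F q = G q" and F: "local_order A F p k"
  shows "local_order A G p k"
proof -
  obtain U \<phi> where c: "(U, \<phi>) \<in> A" "p \<in> U" "order_at (\<lambda>z. F (inv_into U \<phi> z) - F p) (\<phi> p) k"
    using F unfolding local_order_def by blast
  have ev': "\<forall>\<^sub>F z in nhds (\<phi> p). F (inv_into U \<phi> z) = G (inv_into U \<phi> z)"
    using ev by (simp only: eventually_rs[OF A c(1,2)])
  have "F p = G p"
    using eventually_nhds_x_imp_x[OF ev'] chart_inj[OF A c(1)] c(2) by simp
  then have "\<forall>\<^sub>F z in nhds (\<phi> p). F (inv_into U \<phi> z) - F p = G (inv_into U \<phi> z) - G p"
    using ev' by (auto elim: eventually_mono)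
  from order_at_cong[OF this c(3)] c show ?thesis unfolding local_order_def by blast
qed

lemma local_holo_const: "p \<in> rs_points A \<Longrightarrow> local_holo A (\<lambda>q. c) p"
  by (auto simp: local_holo_def elim!: chart_at)

text \<open>The premise \<open>op\<close> is told the values at p, since division needs a
  denominator that is nonzero there.\<close>

lemma local_holo_combine:
  assumes A: "holomorphic_atlas A" and F: "local_holo A F p" and G: "local_holo A G p"
    and op: "\<And>f g z. f analytic_on {z} \<Longrightarrow> g analytic_on {z} \<Longrightarrow> f z = F p \<Longrightarrow> g z = G p \<Longrightarrow>
      (\<lambda>w. h (f w) (g w)) analytic_on {z}"
  shows "local_holo A (\<lambda>q. h (F q) (G q)) p"
proof -
  obtain U \<phi> where c: "(U, \<phi>) \<in> A" "p \<in> U" "(\<lambda>z. F (inv_into U \<phi> z)) analytic_on {\<phi> p}"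
    using F unfolding local_holo_def by blast
  have "(\<lambda>z. G (inv_into U \<phi> z)) analytic_on {\<phi> p}"
    using G by (simp only: local_holo_chart[OF A c(1,2)])
  from op[OF c(3) this] show ?thesis
    using c chart_inj[OF A c(1)] unfolding local_holo_def by auto
qed

lemma local_holo_add: "holomorphic_atlas A \<Longrightarrow> local_holo A F p \<Longrightarrow> local_holo A G p \<Longrightarrow>
    local_holo A (\<lambda>q. F q + G q) p"
  by (erule local_holo_combine) (auto intro: analytic_intros)

lemma local_holo_diff: "holomorphic_atlas A \<Longrightarrow> local_holo A F p \<Longrightarrow> local_holo A G p \<Longrightarrow>
    local_holo A (\<lambda>q. F q - G q) p"
  by (erule local_holo_combine) (auto intro: analytic_intros)

lemma local_holo_mult: "holomorphic_atlas A \<Longrightarrow> local_holo A F p \<Longrightarrow> local_holo A G p \<Longrightarrow>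
    local_holo A (\<lambda>q. F q * G q) p"
  by (erule local_holo_combine) (auto intro: analytic_intros)

lemma local_holo_divide: "holomorphic_atlas A \<Longrightarrow> local_holo A F p \<Longrightarrow> local_holo A G p \<Longrightarrow>
    G p \<noteq> 0 \<Longrightarrow> local_holo A (\<lambda>q. F q / G q) p"
  by (erule local_holo_combine) (auto intro: analytic_intros)

lemma local_holo_power: "holomorphic_atlas A \<Longrightarrow> local_holo A F p \<Longrightarrow>
    local_holo A (\<lambda>q. F q ^ n) p"
  using local_holo_combine[of A F p F "\<lambda>f g. f ^ n"] by (auto intro: analytic_intros)

lemmas local_holo_intros =
  local_holo_const local_holo_add local_holo_diff local_holo_mult local_holo_divide local_holo_power

lemma local_holo_continuous:
  assumes A: "holomorphic_atlas A" and F: "local_holo A F p"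
  shows "filterlim F (nhds (F p)) (near A p)"
proof -
  obtain U \<phi> where c: "(U, \<phi>) \<in> A" "p \<in> U" "(\<lambda>z. F (inv_into U \<phi> z)) analytic_on {\<phi> p}"
    using F unfolding local_holo_def by blast
  have "isCont (\<lambda>z. F (inv_into U \<phi> z)) (\<phi> p)" using c(3) by (rule analytic_at_imp_isCont)
  then have "filterlim (\<lambda>z. F (inv_into U \<phi> z)) (nhds (F p)) (nhds (\<phi> p))"
    using chart_inj[OF A c(1)] c(2) by (simp add: isCont_def tendsto_nhds_iff)
  then show ?thesis
    by (simp add: filterlim_iff eventually_rs[OF A c(1,2)])
qed

lemma local_holo_eventually_ne:
  assumes "holomorphic_atlas A" "local_holo A F p" "F p \<noteq> c"
  shows "\<forall>\<^sub>F q in near A p. F q \<noteq> c"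
  using eventually_compose_filterlim[OF t1_space_nhds[OF assms(3)] local_holo_continuous[OF assms(1,2)]] .

section \<open>Holomorphic maps between surfaces and their orders\<close>

definition map_holo :: "'a atlas \<Rightarrow> 'b atlas \<Rightarrow> ('a \<Rightarrow> 'b) \<Rightarrow> 'a \<Rightarrow> bool" where
  "map_holo A B F p \<longleftrightarrow> (\<exists>W \<psi>. (W, \<psi>) \<in> B \<and> F p \<in> W \<and>
     (\<forall>\<^sub>F q in near A p. F q \<in> W) \<and> local_holo A (\<lambda>q. \<psi> (F q)) p)"

text \<open>Values of \<psi> outside W carry no information, so staying in W near p is part of the
  notion; continuity at p is then a consequence.\<close>

definition map_order :: "'a atlas \<Rightarrow> 'b atlas \<Rightarrow> ('a \<Rightarrow> 'b) \<Rightarrow> 'a \<Rightarrow> nat \<Rightarrow> bool" where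
  "map_order A B F p k \<longleftrightarrow> (\<exists>W \<psi>. (W, \<psi>) \<in> B \<and> F p \<in> W \<and>
     (\<forall>\<^sub>F q in near A p. F q \<in> W) \<and> local_order A (\<lambda>q. \<psi> (F q)) p k)"

lemma map_order_imp_holo: "map_order A B F p k \<Longrightarrow> map_holo A B F p"
  unfolding map_order_def map_holo_def
  by (elim exE conjE, intro exI conjI, assumption+, erule local_order_imp_holo)

text \<open>The coordinate of F q tends to that of F p while F q stays in W, where \<psi> is
  injective; hence F q enters V.\<close>

lemma map_holo_continuous:
  assumes A: "holomorphic_atlas A" and B: "holomorphic_atlas B" and F: "map_holo A B F p"
    and V: "openin (rs_topology B) V" "F p \<in> V"
  shows "\<forall>\<^sub>F q in near A p. F q \<in> V"
proof -
  obtain W \<psi> where d: "(W, \<psi>) \<in> B" "F p \<in> W" "\<forall>\<^sub>F q in near A p. F q \<in> W"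
      "local_holo A (\<lambda>q. \<psi> (F q)) p"
    using F unfolding map_holo_def by blast
  have "open (\<psi> ` (V \<inter> W))" using V d(1) by (auto simp: openin_rs[OF B])
  then have "\<forall>\<^sub>F w in nhds (\<psi> (F p)). w \<in> \<psi> ` (V \<inter> W)"
    using V d(2) by (intro eventually_nhds_in_open) auto
  from eventually_compose_filterlim[OF this local_holo_continuous[OF A d(4)]] d(3)
  show ?thesis
    by eventually_elim (use inj_onD[OF chart_inj[OF B d(1)]] in auto)
qed

lemma map_order_chart:
  assumes A: "holomorphic_atlas A" and B: "holomorphic_atlas B" and F: "map_order A B F p k"
    and c: "(W, \<psi>) \<in> B" "F p \<in> W"
  shows "local_order A (\<lambda>q. \<psi> (F q)) p k"
proof -
  obtain W' \<psi>' where d: "(W', \<psi>') \<in> B" "F p \<in> W'" "local_order A (\<lambda>q. \<psi>' (F q)) p k"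
    and ev: "\<forall>\<^sub>F q in near A p. F q \<in> W'"
    using F unfolding map_order_def by blast
  obtain U \<phi> where u: "(U, \<phi>) \<in> A" "p \<in> U"
      "order_at (\<lambda>z. \<psi>' (F (inv_into U \<phi> z)) - \<psi>' (F p)) (\<phi> p) k"
    using d(3) unfolding local_order_def by blast
  let ?t = "\<lambda>z. \<psi>' (F (inv_into U \<phi> z))"
  have tp: "?t (\<phi> p) = \<psi>' (F p)" using chart_inj[OF A u(1)] u(2) by simp
  have "order_at (\<lambda>z. \<psi> (inv_into W' \<psi>' (?t z)) - \<psi> (F p)) (\<phi> p) (1 * k)"
    by (rule order_at_compose[where h = "\<lambda>w. \<psi> (inv_into W' \<psi>' w) - \<psi> (F p)"])
      (use order_at_transition[OF B d(1) c(1) d(2) c(2)] u(3) in \<open>simp_all add: tp\<close>)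
  moreover have "\<forall>\<^sub>F z in nhds (\<phi> p). F (inv_into U \<phi> z) \<in> W'"
    using ev by (simp only: eventually_rs[OF A u(1,2)])
  then have "\<forall>\<^sub>F z in nhds (\<phi> p). \<psi> (inv_into W' \<psi>' (?t z)) - \<psi> (F p)
      = \<psi> (F (inv_into U \<phi> z)) - \<psi> (F p)"
    by eventually_elim (use chart_inj[OF B d(1)] in simp)
  ultimately have "order_at (\<lambda>z. \<psi> (F (inv_into U \<phi> z)) - \<psi> (F p)) (\<phi> p) k"
    unfolding mult_1_left by - (rule order_at_cong, assumption+)
  then show ?thesis using u unfolding local_order_def by blast
qed

lemma map_order_compose:
  assumes A: "holomorphic_atlas A" and B: "holomorphic_atlas B" and C: "holomorphic_atlas C"
    and F: "map_order A B F p k" and G: "map_order B C G (F p) l"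
  shows "map_order A C (G \<circ> F) p (l * k)"
proof -
  obtain W \<psi> where d: "(W, \<psi>) \<in> B" "F p \<in> W" "local_order A (\<lambda>q. \<psi> (F q)) p k"
    and ev: "\<forall>\<^sub>F q in near A p. F q \<in> W"
    using F unfolding map_order_def by blast
  obtain Z \<theta> where e: "(Z, \<theta>) \<in> C" "G (F p) \<in> Z" "local_order B (\<lambda>q. \<theta> (G q)) (F p) l"
    and ev2: "\<forall>\<^sub>F q in near B (F p). G q \<in> Z"
    using G unfolding map_order_def by blast
  obtain U \<phi> where u: "(U, \<phi>) \<in> A" "p \<in> U"
      "order_at (\<lambda>z. \<psi> (F (inv_into U \<phi> z)) - \<psi> (F p)) (\<phi> p) k"
    using d(3) unfolding local_order_def by blast
  let ?t = "\<lambda>z. \<psi> (F (inv_into U \<phi> z))"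
  have tp: "?t (\<phi> p) = \<psi> (F p)" using chart_inj[OF A u(1)] u(2) by simp
  have "order_at (\<lambda>w. \<theta> (G (inv_into W \<psi> w)) - \<theta> (G (F p))) (\<psi> (F p)) l"
    using e(3) by (simp only: local_order_chart[OF B d(1,2)])
  then have "order_at (\<lambda>z. \<theta> (G (inv_into W \<psi> (?t z))) - \<theta> (G (F p))) (\<phi> p) (l * k)"
    by (intro order_at_compose[where h = "\<lambda>w. \<theta> (G (inv_into W \<psi> w)) - \<theta> (G (F p))"])
      (use u(3) in \<open>simp_all add: tp\<close>)
  moreover have "\<forall>\<^sub>F z in nhds (\<phi> p). F (inv_into U \<phi> z) \<in> W"
    using ev by (simp only: eventually_rs[OF A u(1,2)])
  then have "\<forall>\<^sub>F z in nhds (\<phi> p). \<theta> (G (inv_into W \<psi> (?t z))) - \<theta> (G (F p))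
      = \<theta> ((G \<circ> F) (inv_into U \<phi> z)) - \<theta> ((G \<circ> F) p)"
    by eventually_elim (use chart_inj[OF B d(1)] in simp)
  ultimately have "order_at (\<lambda>z. \<theta> ((G \<circ> F) (inv_into U \<phi> z)) - \<theta> ((G \<circ> F) p)) (\<phi> p) (l * k)"
    by - (rule order_at_cong, assumption+)
  then have 1: "local_order A (\<lambda>q. \<theta> ((G \<circ> F) q)) p (l * k)"
    using u unfolding local_order_def by blast
  have "F p \<in> topspace (rs_topology B)" using chart_subset_points[OF d(1)] d(2) B by auto
  then obtain S where S: "openin (rs_topology B) S" "F p \<in> S" "\<forall>q\<in>S. G q \<in> Z"
    using ev2 by (auto simp: eventually_nhdsin)
  have "\<forall>\<^sub>F q in near A p. F q \<in> S"
    by (rule map_holo_continuous[OF A B map_order_imp_holo[OF F] S(1,2)])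
  then have "\<forall>\<^sub>F q in near A p. (G \<circ> F) q \<in> Z"
    by eventually_elim (use S in auto)
  with 1 e show ?thesis unfolding map_order_def by auto
qed

text \<open>Both clauses of \<open>holomorphic_map\<close> are local: openness of preimages is
  tested pointwise, and in a prescribed target chart F is its expression in a good chart followed by
  a transition.\<close>

lemma holomorphic_mapI:
  assumes A: "holomorphic_atlas A" and B: "holomorphic_atlas B"
    and F: "\<And>p. p \<in> rs_points A \<Longrightarrow> map_holo A B F p"
  shows "holomorphic_map A B F"
proof -
  have FB: "F p \<in> rs_points B" if "p \<in> rs_points A" for p
    using F[OF that] chart_subset_points unfolding map_holo_def by blast
  have "continuous_map (rs_topology A) (rs_topology B) F"
    unfolding continuous_map_def
  proof (intro conjI allI impI)
    show "F \<in> topspace (rs_topology A) \<rightarrow> topspace (rs_topology B)" using FB A B by auto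
    fix V assume V: "openin (rs_topology B) V"
    show "openin (rs_topology A) {x \<in> topspace (rs_topology A). F x \<in> V}"
    proof (subst openin_subopen, clarify)
      fix p assume p: "p \<in> topspace (rs_topology A)" "F p \<in> V"
      have "\<forall>\<^sub>F q in near A p. F q \<in> V"
        using p A by (intro map_holo_continuous[OF A B F V]) auto
      then obtain S where "openin (rs_topology A) S" "p \<in> S" "\<forall>q\<in>S. F q \<in> V"
        using p by (auto simp: eventually_nhdsin)
      then show "\<exists>T. openin (rs_topology A) T \<and> p \<in> T \<and> T \<subseteq> {x \<in> topspace (rs_topology A). F x \<in> V}"
        using openin_subset by (intro exI[of _ S]) blast
    qed
  qed
  moreover have "(\<psi> \<circ> F \<circ> inv_into U \<phi>) holomorphic_on \<phi> ` (U \<inter> F -` W)"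
    if c: "(U, \<phi>) \<in> A" and d: "(W, \<psi>) \<in> B" for U \<phi> W \<psi>
  proof -
    have "(\<psi> \<circ> F \<circ> inv_into U \<phi>) analytic_on \<phi> ` (U \<inter> F -` W)"
    proof (subst analytic_on_analytic_at, clarify)
      fix p assume p: "p \<in> U" "F p \<in> W"
      have mh: "map_holo A B F p" using F chart_subset_points[OF c] p by blast
      then obtain W' \<psi>' where e: "(W', \<psi>') \<in> B" "F p \<in> W'" "local_holo A (\<lambda>q. \<psi>' (F q)) p"
        and ev: "\<forall>\<^sub>F q in near A p. F q \<in> W'"
        unfolding map_holo_def by blast
      have ev2: "\<forall>\<^sub>F q in near A p. F q \<in> W' \<inter> W"
        using ev map_holo_continuous[OF A B mh chart_open[OF B d] p(2)]
        by eventually_elim auto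
      let ?t = "\<lambda>z. \<psi>' (F (inv_into U \<phi> z))"
      have tp: "?t (\<phi> p) = \<psi>' (F p)" using chart_inj[OF A c] p by simp
      have t: "?t analytic_on {\<phi> p}" using e(3) by (simp only: local_holo_chart[OF A c p(1)])
      have an: "((\<lambda>w. \<psi> (inv_into W' \<psi>' w)) \<circ> ?t) analytic_on {\<phi> p}"
        by (intro analytic_on_compose t)
          (use transition_analytic[OF B e(1) d e(2) p(2)] in \<open>simp add: tp\<close>)
      have "\<forall>\<^sub>F z in nhds (\<phi> p). F (inv_into U \<phi> z) \<in> W' \<inter> W"
        using ev2 by (simp only: eventually_rs[OF A c p(1)])
      then have "\<forall>\<^sub>F z in nhds (\<phi> p). ((\<lambda>w. \<psi> (inv_into W' \<psi>' w)) \<circ> ?t) z = (\<psi> \<circ> F \<circ> inv_into U \<phi>) z"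
        by eventually_elim (use chart_inj[OF B e(1)] in simp)
      from analytic_at_cong[OF this refl] an
      show "(\<psi> \<circ> F \<circ> inv_into U \<phi>) analytic_on {\<phi> p}" by blast
    qed
    then show ?thesis by (rule analytic_imp_holomorphic)
  qed
  ultimately show ?thesis unfolding holomorphic_map_def by blast
qed

text \<open>An injective holomorphic function of one variable has nowhere vanishing derivative. This
  gives order 1 for the involution without any local expansion.\<close>

lemma map_order_injective:
  assumes A: "holomorphic_atlas A" and B: "holomorphic_atlas B"
    and F: "map_holo A B F p" and inj: "inj_on F (rs_points A)" and p: "p \<in> rs_points A"
  shows "map_order A B F p 1"
proof -
  obtain W \<psi> where d: "(W, \<psi>) \<in> B" "F p \<in> W" "local_holo A (\<lambda>q. \<psi> (F q)) p"
    and ev: "\<forall>\<^sub>F q in near A p. F q \<in> W"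
    using F unfolding map_holo_def by blast
  obtain U \<phi> where c: "(U, \<phi>) \<in> A" "p \<in> U" using chart_at[OF p] .
  let ?t = "\<lambda>z. \<psi> (F (inv_into U \<phi> z))"
  have tp: "?t (\<phi> p) = \<psi> (F p)" using chart_inj[OF A c(1)] c(2) by simp
  have t: "?t analytic_on {\<phi> p}" using d(3) by (simp only: local_holo_chart[OF A c])
  then obtain S where S: "open S" "\<phi> p \<in> S" "?t holomorphic_on S" by (auto simp: analytic_at)
  have "\<forall>\<^sub>F z in nhds (\<phi> p). F (inv_into U \<phi> z) \<in> W" using ev by (simp only: eventually_rs[OF A c])
  then obtain T where T: "open T" "\<phi> p \<in> T" "\<forall>z\<in>T. F (inv_into U \<phi> z) \<in> W"
    by (auto simp: eventually_nhds)
  \<comment> \<open>On R the coordinate expression is holomorphic and F stays inside the target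
    chart, so injectivity of F passes to the expression.\<close>
  define R where "R = S \<inter> T \<inter> \<phi> ` U"
  have "inj_on ?t R"
  proof (rule inj_onI)
    fix z w assume zw: "z \<in> R" "w \<in> R" "?t z = ?t w"
    then have "F (inv_into U \<phi> z) = F (inv_into U \<phi> w)"
      using inj_onD[OF chart_inj[OF B d(1)]] T(3) by (auto simp: R_def)
    moreover have "inv_into U \<phi> z \<in> U" "inv_into U \<phi> w \<in> U"
      using zw by (auto simp: R_def inv_into_into)
    ultimately have "inv_into U \<phi> z = inv_into U \<phi> w"
      using inj chart_subset_points[OF c(1)] by (auto simp: inj_on_def)
    then show "z = w" using zw by (auto simp: R_def dest: inv_into_injective)
  qed
  moreover have "open R" "\<phi> p \<in> R" using S T chart_open_image[OF A c(1)] c(2) by (auto simp: R_def)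
  moreover have "?t holomorphic_on R" using S(3) by (rule holomorphic_on_subset) (auto simp: R_def)
  ultimately have "deriv ?t (\<phi> p) \<noteq> 0" using holomorphic_injective_imp_regular by blast
  from order_at_one[OF t this] have "local_order A (\<lambda>q. \<psi> (F q)) p 1"
    using c tp unfolding local_order_def by auto
  then show ?thesis using d ev unfolding map_order_def by blast
qed

text \<open>The one place that meets the chart choices in \<open>local_degree\<close>: the order is
  the same in all charts, in particular in the chosen ones.\<close>

lemma map_order_imp_local_degree:
  assumes A: "holomorphic_atlas A" and B: "holomorphic_atlas B"
    and F: "map_order A B F p k" and p: "p \<in> rs_points A"
  shows "local_degree A B F p = k"
proof -
  define c where "c = (SOME c. c \<in> A \<and> p \<in> fst c)"
  define d where "d = (SOME c. c \<in> B \<and> F p \<in> fst c)"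
  have "\<exists>c. c \<in> A \<and> p \<in> fst c" using p by (force simp: rs_points_def)
  from someI_ex[OF this] have c: "(fst c, snd c) \<in> A" "p \<in> fst c" by (auto simp: c_def)
  have "\<exists>c. c \<in> B \<and> F p \<in> fst c" using F unfolding map_order_def by force
  from someI_ex[OF this] have d: "(fst d, snd d) \<in> B" "F p \<in> fst d" by (auto simp: d_def)
  have "order_at (\<lambda>z. snd d (F (inv_into (fst c) (snd c) z)) - snd d (F p)) (snd c p) k"
    using map_order_chart[OF A B F d] by (simp only: local_order_chart[OF A c])
  from order_at_imp_zorder[OF this] show ?thesis
    unfolding local_degree_def c_def [symmetric] d_def [symmetric] by (simp add: case_prod_unfold)
qed

section \<open>Counting points in fibres\<close>

lemma branched_coveringI:
  assumes A: "compact_riemann_surface A" and B: "compact_riemann_surface B"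
    and F: "\<And>p. p \<in> rs_points A \<Longrightarrow> map_order A B F p (e p)" and "d > 0"
    and fin: "\<And>q. q \<in> rs_points B \<Longrightarrow> finite (fibre A F q)"
    and sum: "\<And>q. q \<in> rs_points B \<Longrightarrow> (\<Sum>p\<in>fibre A F q. e p) = d"
  shows "branched_covering A B d F"
proof -
  have hA: "holomorphic_atlas A" and hB: "holomorphic_atlas B"
    using A B by (auto simp: compact_riemann_surface_def)
  have "(\<Sum>p\<in>fibre A F q. local_degree A B F p) = (\<Sum>p\<in>fibre A F q. e p)" for q
    by (intro sum.cong refl map_order_imp_local_degree[OF hA hB F]) (auto simp: fibre_def)
  moreover have "holomorphic_map A B F"
    by (rule holomorphic_mapI[OF hA hB map_order_imp_holo[OF F]])
  ultimately show ?thesis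
    unfolding branched_covering_def using A B \<open>d > 0\<close> fin sum by metis
qed

text \<open>The fibre of the composite is the disjoint union of the fibres of F over the fibre of G,
  and on each of them the factor \<open>e' (F p)\<close> is constant.\<close>

lemma fibre_sum_compose:
  fixes e e' :: "_ \<Rightarrow> nat"
  assumes FB: "\<And>p. p \<in> rs_points A \<Longrightarrow> F p \<in> rs_points B"
    and finF: "\<And>q. q \<in> rs_points B \<Longrightarrow> finite (fibre A F q)"
    and sumF: "\<And>q. q \<in> rs_points B \<Longrightarrow> (\<Sum>p\<in>fibre A F q. e p) = d"
    and finG: "finite (fibre B G r)" and sumG: "(\<Sum>q\<in>fibre B G r. e' q) = d'"
  shows "finite (fibre A (G \<circ> F) r)" and "(\<Sum>p\<in>fibre A (G \<circ> F) r. e' (F p) * e p) = d' * d"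
proof -
  have eq: "fibre A (G \<circ> F) r = (\<Union>q\<in>fibre B G r. fibre A F q)"
    using FB by (auto simp: fibre_def)
  have fin: "\<forall>q\<in>fibre B G r. finite (fibre A F q)" using finF by (auto simp: fibre_def)
  show "finite (fibre A (G \<circ> F) r)" unfolding eq using finG fin by blast
  have "(\<Sum>p\<in>fibre A (G \<circ> F) r. e' (F p) * e p) =
        (\<Sum>q\<in>fibre B G r. \<Sum>p\<in>fibre A F q. e' (F p) * e p)"
    unfolding eq by (rule sum.UNION_disjoint[OF finG fin]) (auto simp: fibre_def)
  also have "\<dots> = (\<Sum>q\<in>fibre B G r. e' q * d)"
  proof (rule sum.cong[OF refl])
    fix q assume "q \<in> fibre B G r"
    then have q: "q \<in> rs_points B" by (auto simp: fibre_def)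
    have "(\<Sum>p\<in>fibre A F q. e' (F p) * e p) = (\<Sum>p\<in>fibre A F q. e' q * e p)"
      by (rule sum.cong) (auto simp: fibre_def)
    then show "(\<Sum>p\<in>fibre A F q. e' (F p) * e p) = e' q * d"
      using sumF[OF q] by (simp add: sum_distrib_left [symmetric])
  qed
  finally show "(\<Sum>p\<in>fibre A (G \<circ> F) r. e' (F p) * e p) = d' * d"
    using sumG by (simp add: sum_distrib_right [symmetric])
qed

section \<open>Spaces glued from two pieces\<close>

text \<open>Two pieces are glued along \<open>a u * a v = 1\<close>; the sets \<open>|a| \<le> 1\<close> in the two pieces cover
  the space, and the sets \<open>|a| < 1\<close> separate the points which lie in only one of the pieces.\<close>

lemma glued_space:
  fixes \<iota> \<kappa> :: "'b::t2_space \<Rightarrow> 'a" and a :: "'b \<Rightarrow> complex"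
  assumes cont: "continuous_map (top_of_set S) X \<iota>" "continuous_map (top_of_set T) X \<kappa>"
    and opn: "\<And>V. openin (top_of_set S) V \<Longrightarrow> openin X (\<iota> ` V)"
      "\<And>V. openin (top_of_set T) V \<Longrightarrow> openin X (\<kappa> ` V)"
    and inj: "inj_on \<iota> S" "inj_on \<kappa> T"
    and cover: "topspace X = \<iota> ` S \<union> \<kappa> ` T"
    and a: "continuous_on S a" "continuous_on T a"
    and cpt: "compact {u \<in> S. norm (a u) \<le> 1}" "compact {u \<in> T. norm (a u) \<le> 1}"
    and conn: "connected S" "connected T"
    and overlap: "\<And>u v. u \<in> S \<Longrightarrow> v \<in> T \<Longrightarrow> \<iota> u = \<kappa> v \<Longrightarrow> a u * a v = 1"
      "\<And>u. u \<in> S \<Longrightarrow> a u \<noteq> 0 \<Longrightarrow> \<iota> u \<in> \<kappa> ` T" "\<And>u. u \<in> T \<Longrightarrow> a u \<noteq> 0 \<Longrightarrow> \<kappa> u \<in> \<iota> ` S"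
    and ne: "\<exists>u\<in>S. a u \<noteq> 0"
  shows "Hausdorff_space X" and "compact_space X" and "connected_space X"
proof -
  have sep1: "\<exists>U V. openin X U \<and> openin X V \<and> p \<in> U \<and> q \<in> V \<and> disjnt U V"
    if j: "inj_on j R" and o: "\<And>V. openin (top_of_set R) V \<Longrightarrow> openin X (j ` V)"
      and pq: "p \<in> j ` R" "q \<in> j ` R" "p \<noteq> q" for j :: "'b \<Rightarrow> 'a" and R p q
  proof -
    obtain u v where uv: "u \<in> R" "v \<in> R" "p = j u" "q = j v" "u \<noteq> v" using pq by auto
    obtain U V where UV: "open U" "open V" "u \<in> U" "v \<in> V" "U \<inter> V = {}"
      using hausdorff[OF uv(5)] by blast
    have "openin X (j ` (R \<inter> U))" "openin X (j ` (R \<inter> V))"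
      using UV by (auto intro!: o openin_open_Int)
    moreover have "disjnt (j ` (R \<inter> U)) (j ` (R \<inter> V))"
      using UV j by (fastforce simp: disjnt_def inj_on_def)
    ultimately show ?thesis using uv UV by (intro exI[of _ "j ` (R \<inter> U)"] exI[of _ "j ` (R \<inter> V)"]) auto
  qed
  have small: "openin (top_of_set R) {u \<in> R. norm (a u) < 1}" if "continuous_on R a" for R
  proof -
    have "openin (top_of_set R) (R \<inter> (\<lambda>u. norm (a u)) -` {..<1})"
      using that by (intro continuous_openin_preimage_gen continuous_on_norm) auto
    also have "R \<inter> (\<lambda>u. norm (a u)) -` {..<1} = {u \<in> R. norm (a u) < 1}" by auto
    finally show ?thesis .
  qed
  have sep2: "\<exists>U V. openin X U \<and> openin X V \<and> p \<in> U \<and> q \<in> V \<and> disjnt U V"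
    if pq: "p \<in> \<iota> ` S - \<kappa> ` T" "q \<in> \<kappa> ` T - \<iota> ` S" for p q
  proof -
    obtain u v where uv: "u \<in> S" "v \<in> T" "p = \<iota> u" "q = \<kappa> v" using pq by auto
    have "a u = 0" "a v = 0" using overlap(2,3) uv pq by blast+
    moreover have "disjnt (\<iota> ` {u \<in> S. norm (a u) < 1}) (\<kappa> ` {u \<in> T. norm (a u) < 1})"
    proof (clarsimp simp: disjnt_iff)
      fix u v assume h: "u \<in> S" "norm (a u) < 1" "v \<in> T" "norm (a v) < 1" "\<iota> u = \<kappa> v"
      then have "norm (a u) * norm (a v) = 1" using overlap(1)[of u v] by (metis norm_mult norm_one)
      then show False
        using h mult_strict_mono[of "norm (a u)" 1 "norm (a v)" 1] by simp
    qed
    ultimately show ?thesis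
      using uv opn(1)[OF small[OF a(1)]] opn(2)[OF small[OF a(2)]]
      by (intro exI[of _ "\<iota> ` {u \<in> S. norm (a u) < 1}"] exI[of _ "\<kappa> ` {u \<in> T. norm (a u) < 1}"]) auto
  qed
  show "Hausdorff_space X"
    unfolding Hausdorff_space_def
  proof clarify
    fix p q assume pq: "p \<in> topspace X" "q \<in> topspace X" "p \<noteq> q"
    consider "p \<in> \<iota> ` S" "q \<in> \<iota> ` S" | "p \<in> \<kappa> ` T" "q \<in> \<kappa> ` T"
      | "p \<in> \<iota> ` S - \<kappa> ` T" "q \<in> \<kappa> ` T - \<iota> ` S" | "q \<in> \<iota> ` S - \<kappa> ` T" "p \<in> \<kappa> ` T - \<iota> ` S"
      using pq unfolding cover by blast
    then show "\<exists>U V. openin X U \<and> openin X V \<and> p \<in> U \<and> q \<in> V \<and> disjnt U V"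
    proof cases
      case 1 show ?thesis by (rule sep1[OF inj(1) opn(1) 1 pq(3)])
    next
      case 2 show ?thesis by (rule sep1[OF inj(2) opn(2) 2 pq(3)])
    next
      case 3 show ?thesis by (rule sep2[OF 3])
    next
      case 4
      obtain U V where "openin X U" "openin X V" "q \<in> U" "p \<in> V" "disjnt U V"
        using sep2[OF 4] by blast
      then show ?thesis by (intro exI[of _ V] exI[of _ U]) (simp add: disjnt_sym)
    qed
  qed
  let ?K = "{u \<in> S. norm (a u) \<le> 1}" and ?L = "{u \<in> T. norm (a u) \<le> 1}"
  have "topspace X \<subseteq> \<iota> ` ?K \<union> \<kappa> ` ?L"
  proof
    fix p assume "p \<in> topspace X"
    then consider u where "u \<in> S" "p = \<iota> u" | v where "v \<in> T" "p = \<kappa> v"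
      unfolding cover by blast
    then show "p \<in> \<iota> ` ?K \<union> \<kappa> ` ?L"
    proof cases
      case 1
      show ?thesis
      proof (cases "norm (a u) \<le> 1")
        case False
        then have "a u \<noteq> 0" by auto
        then obtain v where v: "v \<in> T" "\<iota> u = \<kappa> v" using overlap(2) 1 by blast
        then have "norm (a u) * norm (a v) = 1" using overlap(1)[of u v] 1 by (metis norm_mult norm_one)
        then have "norm (a v) \<le> 1"
          using False mult_right_mono[of 1 "norm (a u)" "norm (a v)"] by simp
        then show ?thesis using v 1 by blast
      qed (use 1 in auto)
    next
      case 2
      show ?thesis
      proof (cases "norm (a v) \<le> 1")
        case False
        then have "a v \<noteq> 0" by auto
        then obtain u where u: "u \<in> S" "\<kappa> v = \<iota> u" using overlap(3) 2 by blast
        then have "norm (a u) * norm (a v) = 1" using overlap(1)[of u v] 2 by (metis norm_mult norm_one)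
        then have "norm (a u) \<le> 1"
          using False mult_left_mono[of 1 "norm (a v)" "norm (a u)"] by simp
        then show ?thesis using u 2 by blast
      qed (use 2 in auto)
    qed
  qed
  then have eq: "topspace X = \<iota> ` ?K \<union> \<kappa> ` ?L" using cover by auto
  have "compactin X (\<iota> ` ?K)"
    by (rule image_compactin[OF _ cont(1)]) (use cpt(1) in \<open>auto simp: compactin_subtopology\<close>)
  moreover have "compactin X (\<kappa> ` ?L)"
    by (rule image_compactin[OF _ cont(2)]) (use cpt(2) in \<open>auto simp: compactin_subtopology\<close>)
  ultimately show "compact_space X"
    unfolding compact_space_def eq by (rule compactin_Un)
  have "connectedin X (\<iota> ` S)"
    by (rule connectedin_continuous_map_image[OF cont(1)])
      (use conn(1) in \<open>auto simp: connectedin_subtopology\<close>)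
  moreover have "connectedin X (\<kappa> ` T)"
    by (rule connectedin_continuous_map_image[OF cont(2)])
      (use conn(2) in \<open>auto simp: connectedin_subtopology\<close>)
  moreover have "\<iota> ` S \<inter> \<kappa> ` T \<noteq> {}" using overlap(2) ne by blast
  ultimately have "connectedin X (topspace X)" unfolding cover by (rule connectedin_Un)
  then show "connected_space X" by (simp add: connectedin_topspace)
qed

section \<open>The Riemann sphere as a compact Riemann surface\<close>

lemma rs_points_sphere [simp]: "rs_points riemann_sphere = UNIV"
  by (auto simp: rs_points_def riemann_sphere_def)

lemma inv_into_the: "inv_into (range Some) the z = Some z"
  by (rule inv_into_f_eq) (auto simp: inj_on_def)

lemma inj_on_sphere_infinity: "inj_on (case_option 0 inverse) (- {Some (0 :: complex)})"
  by (auto simp: inj_on_def split: option.splits)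

lemma image_sphere_infinity: "case_option 0 inverse ` (- {Some (0 :: complex)}) = UNIV"
proof -
  have "z \<in> case_option 0 inverse ` (- {Some 0})" for z :: complex
    by (rule image_eqI[of _ _ "if z = 0 then None else Some (inverse z)"]) auto
  then show ?thesis by blast
qed

lemma inv_into_sphere_infinity:
  "inv_into (- {Some (0 :: complex)}) (case_option 0 inverse) z = (if z = 0 then None else Some (inverse z))"
  by (rule inv_into_f_eq[OF inj_on_sphere_infinity]) auto

lemma holomorphic_atlas_sphere: "holomorphic_atlas riemann_sphere"
proof -
  have r1: "the ` (range Some \<inter> - {Some (0 :: complex)}) = - {0}"
  proof -
    have "z \<in> the ` (range Some \<inter> - {Some 0})" if "z \<noteq> 0" for z :: complex
      by (rule image_eqI[of _ _ "Some z"]) (use that in auto)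
    then show ?thesis by auto
  qed
  have r2: "case_option 0 inverse ` (- {Some (0 :: complex)} \<inter> range Some) = - {0}"
  proof -
    have "z \<in> case_option 0 inverse ` (- {Some 0} \<inter> range Some)" if "z \<noteq> 0" for z :: complex
      by (rule image_eqI[of _ _ "Some (inverse z)"]) (use that in auto)
    then show ?thesis by auto
  qed
  have "(case_option 0 inverse \<circ> inv_into (range Some) the) holomorphic_on - {0 :: complex}"
    by (rule holomorphic_transform[of inverse]) (auto simp: inv_into_the intro!: holomorphic_intros)
  moreover have "(the \<circ> inv_into (- {Some (0 :: complex)}) (case_option 0 inverse)) holomorphic_on - {0}"
    by (rule holomorphic_transform[of inverse])
      (auto simp: inv_into_sphere_infinity intro!: holomorphic_intros)
  moreover have "(the \<circ> inv_into (range Some) the) holomorphic_on (UNIV :: complex set)"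
    by (rule holomorphic_transform[of "\<lambda>z. z"]) (auto simp: inv_into_the)
  moreover have "(case_option 0 inverse \<circ> inv_into (- {Some (0 :: complex)}) (case_option 0 inverse))
      holomorphic_on UNIV"
    by (rule holomorphic_transform[of "\<lambda>z. z"]) (auto simp: inv_into_sphere_infinity)
  moreover have "the ` range Some = (UNIV :: complex set)" by (auto simp: image_image)
  moreover have "inj_on the (range Some)" by (auto simp: inj_on_def)
  ultimately show ?thesis
    unfolding holomorphic_atlas_def riemann_sphere_def
    by (auto simp: r1 r2 image_sphere_infinity inj_on_sphere_infinity)
qed

text \<open>The sphere is two planes glued along u v = 1, so the gluing lemma applies with the
  coordinate itself as the function \<open>a\<close>.\<close>

lemma compact_riemann_surface_sphere: "compact_riemann_surface riemann_sphere"
proof -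
  note A = holomorphic_atlas_sphere
  have c: "(range Some, the) \<in> riemann_sphere" "(- {Some 0}, case_option 0 inverse) \<in> riemann_sphere"
    by (auto simp: riemann_sphere_def)
  \<comment> \<open>The inverse of the chart at infinity, used as the second inclusion of the
    plane.\<close>
  define j where "j = (\<lambda>z :: complex. if z = 0 then None else Some (inverse z))"
  have o1: "openin (rs_topology riemann_sphere) (Some ` V)" if "open V" for V
    using that openin_rs_chart[OF A c(1), of "Some ` V"] by (auto simp: image_image)
  have o2: "openin (rs_topology riemann_sphere) (j ` V)" if "open V" for V
  proof -
    have "case_option 0 inverse ` j ` V = V"
    proof -
      have "case_option 0 inverse (j z) = z" for z :: complex by (simp add: j_def)
      then show ?thesis unfolding image_image by simp
    qed
    moreover have "j ` V \<subseteq> - {Some 0}" by (auto simp: j_def)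
    ultimately show ?thesis using that openin_rs_chart[OF A c(2), of "j ` V"] by simp
  qed
  have inj2: "inj j" by (auto simp: inj_on_def j_def split: if_splits)
  have cont: "continuous_map euclidean (rs_topology riemann_sphere) Some"
    "continuous_map euclidean (rs_topology riemann_sphere) j"
  proof -
    have "open {z. Some z \<in> V}" if "openin (rs_topology riemann_sphere) V" for V
    proof -
      have "open (the ` (V \<inter> range Some))" using that c(1) by (auto simp: openin_rs[OF A])
      moreover have "z \<in> the ` (V \<inter> range Some)" if "Some z \<in> V" for z
        by (rule image_eqI[of _ _ "Some z"]) (use that in auto)
      then have "the ` (V \<inter> range Some) = {z. Some z \<in> V}" by auto
      ultimately show ?thesis by simp
    qed
    then show "continuous_map euclidean (rs_topology riemann_sphere) Some"
      by (auto simp: continuous_map_def A)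
    have "open {z. j z \<in> V}" if "openin (rs_topology riemann_sphere) V" for V
    proof -
      have "open (case_option 0 inverse ` (V \<inter> - {Some 0}))"
        using that c(2) by (auto simp: openin_rs[OF A])
      moreover have "case_option 0 inverse ` (V \<inter> - {Some 0}) = {z. j z \<in> V}"
      proof (intro subset_antisym subsetI)
        fix z assume "z \<in> case_option 0 inverse ` (V \<inter> - {Some 0})"
        then obtain q where "q \<in> V" "q \<noteq> Some 0" "z = case_option 0 inverse q" by auto
        then show "z \<in> {z. j z \<in> V}" by (cases q) (auto simp: j_def)
      next
        fix z assume "z \<in> {z. j z \<in> V}"
        then show "z \<in> case_option 0 inverse ` (V \<inter> - {Some 0})"
          by (intro image_eqI[of _ _ "j z"]) (auto simp: j_def split: if_splits)
      qed
      ultimately show ?thesis by simp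
    qed
    then show "continuous_map euclidean (rs_topology riemann_sphere) j"
      by (auto simp: continuous_map_def A)
  qed
  have cover: "UNIV = range Some \<union> range j"
  proof -
    have "x \<in> range Some \<union> range j" for x :: "complex option"
      by (cases x) (auto simp: j_def intro!: image_eqI[of None j 0])
    then show ?thesis by blast
  qed
  have ball: "{u. norm u \<le> 1} = cball (0 :: complex) 1" by auto
  have "Hausdorff_space (rs_topology riemann_sphere) \<and> compact_space (rs_topology riemann_sphere) \<and>
      connected_space (rs_topology riemann_sphere)"
  proof (intro conjI)
    have ov: "Some u \<in> range j" if "u \<noteq> 0" for u
      using that by (intro image_eqI[of _ _ "inverse u"]) (auto simp: j_def)
    have ov2: "j u \<in> range Some" if "u \<noteq> 0" for u using that by (auto simp: j_def)
    have ov1: "u * v = 1" if "Some u = j v" for u v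
      using that by (auto simp: j_def split: if_splits)
    note glue = glued_space[of UNIV "rs_topology riemann_sphere" Some UNIV j "\<lambda>z. z",
        unfolded subtopology_UNIV, OF cont]
    note facts = o1 o2 inj2 cover ov ov1 ov2 A
    show "Hausdorff_space (rs_topology riemann_sphere)"
      by (rule glue(1)) (use facts in \<open>auto simp: ball intro: exI[of _ 1]\<close>)
    show "compact_space (rs_topology riemann_sphere)"
      by (rule glue(2)) (use facts in \<open>auto simp: ball intro: exI[of _ 1]\<close>)
    show "connected_space (rs_topology riemann_sphere)"
      by (rule glue(3)) (use facts in \<open>auto simp: ball intro: exI[of _ 1]\<close>)
  qed
  then show ?thesis using A by (auto simp: compact_riemann_surface_def)
qed

lemma map_order_sphere_finite:
  assumes F: "local_order A f p k"
    and ev: "\<forall>\<^sub>F q in near A p. F q = Some (f q)" and A: "holomorphic_atlas A"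
    and p: "p \<in> rs_points A"
  shows "map_order A riemann_sphere F p k"
proof -
  have "local_order A (\<lambda>q. the (F q)) p k"
    by (rule local_order_cong[OF A _ F]) (use ev in \<open>auto elim: eventually_mono\<close>)
  moreover have "F p = Some (f p)"
    using eventually_nhdsin_self[OF _ ev] p A by simp
  moreover have "\<forall>\<^sub>F q in near A p. F q \<in> range Some"
    using ev by eventually_elim auto
  ultimately show ?thesis
    unfolding map_order_def riemann_sphere_def
    by (intro exI[of _ "range Some"] exI[of _ the]) auto
qed

text \<open>Here f is the reciprocal of the map, that is, its coordinate at infinity; where f
  vanishes, the order of the zero is the order of the pole.\<close>

lemma map_order_sphere_infinite:
  assumes F: "local_order A f p k"
    and ev: "\<forall>\<^sub>F q in near A p. F q = (if f q = 0 then None else Some (1 / f q))"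
    and A: "holomorphic_atlas A" and p: "p \<in> rs_points A"
  shows "map_order A riemann_sphere F p k"
proof -
  have "\<forall>\<^sub>F q in near A p. f q = case_option 0 inverse (F q)"
    using ev by eventually_elim (auto simp: inverse_eq_divide)
  from local_order_cong[OF A this F] have "local_order A (\<lambda>q. case_option 0 inverse (F q)) p k" .
  moreover have ev2: "\<forall>\<^sub>F q in near A p. F q \<in> - {Some 0}"
    using ev by eventually_elim auto
  moreover have "F p \<in> - {Some 0}"
    using eventually_nhdsin_self[OF _ ev2] p A by simp
  ultimately show ?thesis
    unfolding map_order_def riemann_sphere_def
    by (intro exI[of _ "- {Some 0}"] exI[of _ "case_option 0 inverse"]) auto
qed

section \<open>Local branches and charts of the affine curve\<close>

lemma rsquarefree_nonzero: "rsquarefree p \<Longrightarrow> p \<noteq> 0"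
  by (simp add: rsquarefree_def)

lemma card_roots_rsquarefree:
  fixes p :: "complex poly"
  assumes "rsquarefree p"
  shows "card {z. poly p z = 0} = degree p"
proof -
  have "degree p = degree (smult (lead_coeff p) (\<Prod>z|poly p z = 0. [:-z, 1:]))"
    by (simp only: complex_poly_decompose_rsquarefree[OF assms])
  also have "\<dots> = card {z. poly p z = 0}"
    using rsquarefree_nonzero[OF assms] by (simp add: degree_prod_eq_sum_degree)
  finally show ?thesis by simp
qed

lemma analytic_on_poly: "f analytic_on S \<Longrightarrow> (\<lambda>z. poly p (f z :: complex)) analytic_on S"
  by (induction p) (auto intro!: analytic_intros)

text \<open>Dividing by b^2 puts the radicand at 1, away from the cut of \<open>csqrt\<close>, so s
  is analytic at a; the equation for s^2 holds everywhere, also across the cut.\<close>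

lemma sqrt_section:
  assumes "b\<^sup>2 = poly p a" "b \<noteq> 0"
  obtains s where "s analytic_on {a}" "s a = b" "\<forall>X. (s X)\<^sup>2 = poly p X"
proof
  let ?s = "\<lambda>X. b * csqrt (poly p X / b\<^sup>2)"
  have "poly p a / b\<^sup>2 = 1" using assms by (metis divide_self power_not_zero)
  then show "?s analytic_on {a}" "?s a = b"
    using assms(2) by (auto intro!: analytic_intros analytic_on_poly simp: complex_nonpos_Reals_iff)
  show "\<forall>X. (?s X)\<^sup>2 = poly p X" using assms(2) by (simp add: power_mult_distrib)
qed

lemma poly_deriv: "deriv (poly p) a = poly (pderiv p) a"
  by (rule DERIV_imp_deriv) (rule poly_DERIV)

text \<open>The branch is the local inverse of p at a, applied to Y^2.\<close>

lemma root_section: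
  fixes a b :: complex
  assumes "b\<^sup>2 = poly p a" "poly (pderiv p) a \<noteq> 0"
  obtains s where "s analytic_on {b}" "s b = a" "\<forall>\<^sub>F Y in nhds b. poly p (s Y) = Y\<^sup>2"
proof -
  have hol: "poly p holomorphic_on S" for S :: "complex set"
    using analytic_on_poly[of "\<lambda>z. z" S p] analytic_imp_holomorphic by (simp add: analytic_on_ident)
  obtain r where r: "r > 0" "open (poly p ` ball a r)" "inj_on (poly p) (ball a r)"
    by (rule has_complex_derivative_locally_invertible[OF hol[of UNIV], of a])
      (use assms(2) in \<open>auto simp: poly_deriv\<close>)
  obtain g where g: "g holomorphic_on (poly p ` ball a r)" "\<And>z. z \<in> ball a r \<Longrightarrow> g (poly p z) = z"
    using holomorphic_has_inverse[OF hol open_ball r(3)] by metis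
  show thesis
  proof
    have "g analytic_on {b\<^sup>2}"
      using g(1) r assms(1) by (auto simp: analytic_at intro!: exI[of _ "poly p ` ball a r"])
    then have "(g \<circ> (\<lambda>Y. Y\<^sup>2)) analytic_on {b}"
      by (intro analytic_on_compose analytic_intros) auto
    then show "(\<lambda>Y. g (Y\<^sup>2)) analytic_on {b}" by (simp add: o_def)
    show "g (b\<^sup>2) = a" using g(2)[of a] r(1) assms(1) by simp
    have "open ((\<lambda>Y. Y\<^sup>2) -` (poly p ` ball a r))"
      by (intro continuous_open_vimage continuous_intros r)
    then have "\<forall>\<^sub>F Y in nhds b. Y \<in> (\<lambda>Y. Y\<^sup>2) -` (poly p ` ball a r)"
      by (rule eventually_nhds_in_open) (use r(1) assms(1) in auto)
    then show "\<forall>\<^sub>F Y in nhds b. poly p (g (Y\<^sup>2)) = Y\<^sup>2"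
      by eventually_elim (use g(2) in auto)
  qed
qed

lemma affine_chart_cases:
  assumes "(S, \<phi>) \<in> affine_charts p"
  obtains "\<phi> = fst" "openin (top_of_set (affine_curve p)) S" "inj_on fst S"
      "\<And>u. u \<in> S \<Longrightarrow> snd u \<noteq> 0"
  | "\<phi> = snd" "openin (top_of_set (affine_curve p)) S" "inj_on snd S"
      "\<And>u. u \<in> S \<Longrightarrow> poly (pderiv p) (fst u) \<noteq> 0"
proof -
  from assms consider
    "\<phi> = fst \<and> openin (top_of_set (affine_curve p)) S \<and> inj_on fst S \<and> (\<forall>(X, Y)\<in>S. Y \<noteq> 0)"
  | "\<phi> = snd \<and> openin (top_of_set (affine_curve p)) S \<and> inj_on snd S \<and>
      (\<forall>(X, Y)\<in>S. poly (pderiv p) X \<noteq> 0)"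
    unfolding affine_charts_def by blast
  then show thesis
  proof cases
    case 1 show thesis by (rule that(1)) (use 1 in auto)
  next
    case 2 show thesis by (rule that(2)) (use 2 in auto)
  qed
qed

lemma affine_chart_openin: "(S, \<phi>) \<in> affine_charts p \<Longrightarrow> openin (top_of_set (affine_curve p)) S"
  by (auto elim: affine_chart_cases)

lemma affine_chart_inj: "(S, \<phi>) \<in> affine_charts p \<Longrightarrow> inj_on \<phi> S"
  by (auto elim: affine_chart_cases)

lemma affine_chart_subset: "(S, \<phi>) \<in> affine_charts p \<Longrightarrow> S \<subseteq> affine_curve p"
  by (meson affine_chart_openin openin_imp_subset)

lemma affine_chart_restrict:
  assumes "(S, \<phi>) \<in> affine_charts p" "openin (top_of_set (affine_curve p)) T" "T \<subseteq> S"
  shows "(T, \<phi>) \<in> affine_charts p"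
  using assms(1)
proof (cases rule: affine_chart_cases)
  case 1
  then show ?thesis using assms(2,3) inj_on_subset[OF 1(3) assms(3)]
    unfolding affine_charts_def by fastforce
next
  case 2
  then show ?thesis using assms(2,3) inj_on_subset[OF 2(3) assms(3)]
    unfolding affine_charts_def by fastforce
qed

lemma affine_curve_iff: "u \<in> affine_curve p \<longleftrightarrow> (snd u)\<^sup>2 = poly p (fst u)"
  by (auto simp: affine_curve_def)

lemma eventually_in_openin_curve:
  assumes S: "openin (top_of_set C) S" and g: "(g \<longlongrightarrow> u) F" and "u \<in> S"
    and C: "\<forall>\<^sub>F z in F. g z \<in> C"
  shows "\<forall>\<^sub>F z in F. g z \<in> S"
proof -
  obtain T where T: "open T" "S = C \<inter> T" using S openin_open by metis
  have "\<forall>\<^sub>F z in F. g z \<in> T" by (rule topological_tendstoD[OF g T(1)]) (use T assms in auto)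
  with C show ?thesis by eventually_elim (use T in auto)
qed

lemma isCont_nhds: "isCont f a \<Longrightarrow> (f \<longlongrightarrow> f a) (nhds a)" for f :: "complex \<Rightarrow> complex"
  by (simp add: isCont_def tendsto_nhds_iff)

lemma analytic_tendsto: "f analytic_on {a} \<Longrightarrow> (f \<longlongrightarrow> f a) (nhds a)"
  by (intro isCont_nhds analytic_at_imp_isCont)

text \<open>Near u the inverse of a chart is X -> (X, s X) or Y -> (s Y, Y) with an analytic branch
  s of the preceding kind.\<close>

lemma affine_chart_parametrization:
  assumes c: "(S, \<phi>) \<in> affine_charts p" and u: "u \<in> S"
  obtains \<alpha> \<beta> where "\<alpha> analytic_on {\<phi> u}" "\<beta> analytic_on {\<phi> u}"
    "\<forall>\<^sub>F z in nhds (\<phi> u). z \<in> \<phi> ` S \<and> inv_into S \<phi> z = (\<alpha> z, \<beta> z)"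
proof -
  have uc: "(snd u)\<^sup>2 = poly p (fst u)"
    using affine_chart_subset[OF c] u by (auto simp: affine_curve_iff)
  show ?thesis using c
  proof (cases rule: affine_chart_cases)
    case 1
    obtain s where s: "s analytic_on {fst u}" "s (fst u) = snd u" "\<forall>X. (s X)\<^sup>2 = poly p X"
      by (rule sqrt_section[OF uc 1(4)[OF u]])
    have "((\<lambda>X. (X, s X)) \<longlongrightarrow> (fst u, s (fst u))) (nhds (fst u))"
      by (intro tendsto_intros analytic_tendsto s filterlim_ident)
    then have "\<forall>\<^sub>F X in nhds (fst u). (X, s X) \<in> S"
      by (intro eventually_in_openin_curve[OF 1(2)]) (use u s in \<open>auto simp: affine_curve_iff\<close>)
    then have "\<forall>\<^sub>F X in nhds (fst u). X \<in> fst ` S \<and> inv_into S fst X = (X, s X)"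
    proof eventually_elim
      case (elim X)
      then show ?case using inv_into_f_f[OF 1(3) elim] by force
    qed
    then show ?thesis using that[of "\<lambda>z. z" s] s 1(1) by (auto intro: analytic_intros)
  next
    case 2
    obtain s where s: "s analytic_on {snd u}" "s (snd u) = fst u"
        "\<forall>\<^sub>F Y in nhds (snd u). poly p (s Y) = Y\<^sup>2"
      by (rule root_section[OF uc 2(4)[OF u]])
    have "((\<lambda>Y. (s Y, Y)) \<longlongrightarrow> (s (snd u), snd u)) (nhds (snd u))"
      by (intro tendsto_intros analytic_tendsto s filterlim_ident)
    then have "\<forall>\<^sub>F Y in nhds (snd u). (s Y, Y) \<in> S"
      by (intro eventually_in_openin_curve[OF 2(2)]) (use u s in \<open>auto simp: affine_curve_iff elim: eventually_mono\<close>)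
    then have "\<forall>\<^sub>F Y in nhds (snd u). Y \<in> snd ` S \<and> inv_into S snd Y = (s Y, Y)"
    proof eventually_elim
      case (elim Y)
      then show ?case using inv_into_f_f[OF 2(3) elim] by force
    qed
    then show ?thesis using that[of s "\<lambda>z. z"] s 2(1) by (auto intro: analytic_intros)
  qed
qed

lemma affine_chart_image_open:
  assumes c: "(S, \<phi>) \<in> affine_charts p"
  shows "open (\<phi> ` S)"
proof (subst open_subopen, clarify)
  fix a b assume "(a, b) \<in> S"
  from affine_chart_parametrization[OF c this] have "\<forall>\<^sub>F z in nhds (\<phi> (a, b)). z \<in> \<phi> ` S"
    by (metis (mono_tags, lifting) eventually_mono)
  then show "\<exists>T. open T \<and> \<phi> (a, b) \<in> T \<and> T \<subseteq> \<phi> ` S"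
    unfolding eventually_nhds by blast
qed

lemma affine_chart_fst:
  assumes u: "u \<in> affine_curve p" "snd u \<noteq> 0"
  obtains S where "(S, fst) \<in> affine_charts p" "u \<in> S"
proof
  let ?b = "snd u"
  \<comment> \<open>The disc of radius |b| about b contains neither 0 nor a pair Y, -Y: such a pair
    would give |2 b| < 2 |b|.\<close>
  define S where "S = affine_curve p \<inter> {v. norm (snd v - ?b) < norm ?b}"
  show "u \<in> S" using u by (simp add: S_def)
  have "open {v :: complex \<times> complex. norm (snd v - ?b) < norm ?b}"
    by (intro open_Collect_less continuous_intros)
  then have "openin (top_of_set (affine_curve p)) S" unfolding S_def by (rule openin_open_Int)
  moreover have "inj_on fst S"
  proof (rule inj_onI)
    fix v w assume vw: "v \<in> S" "w \<in> S" "fst v = fst w"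
    then have "(snd v)\<^sup>2 = (snd w)\<^sup>2" by (auto simp: S_def affine_curve_iff)
    then have "snd v = snd w \<or> snd v = - snd w" by (simp add: power2_eq_iff)
    moreover have False if "snd v = - snd w"
    proof -
      have "norm (2 * ?b) = norm ((snd v - ?b) + (snd w - ?b))" using that norm_minus_cancel[of "2 * ?b"] by simp
      also have "\<dots> \<le> norm (snd v - ?b) + norm (snd w - ?b)" by (rule norm_triangle_ineq)
      finally show False using vw by (simp add: S_def norm_mult)
    qed
    ultimately show "v = w" using vw(3) prod_eqI by blast
  qed
  moreover have "\<forall>(X, Y)\<in>S. Y \<noteq> 0" by (auto simp: S_def)
  ultimately show "(S, fst) \<in> affine_charts p" unfolding affine_charts_def by blast
qed

lemma affine_chart_snd:
  assumes u: "u \<in> affine_curve p" "poly (pderiv p) (fst u) \<noteq> 0"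
  obtains S where "(S, snd) \<in> affine_charts p" "u \<in> S"
proof -
  let ?a = "fst u"
  have hol: "poly p holomorphic_on UNIV"
    using analytic_on_poly[of "\<lambda>z. z" UNIV p] analytic_imp_holomorphic by (simp add: analytic_on_ident)
  obtain r where r: "r > 0" "inj_on (poly p) (ball ?a r)"
    by (rule has_complex_derivative_locally_injective[OF hol, of ?a])
      (use u(2) in \<open>auto simp: poly_deriv\<close>)
  define S where "S = affine_curve p \<inter> ({v. dist ?a (fst v) < r} \<inter> {v. poly (pderiv p) (fst v) \<noteq> 0})"
  have "open ({v :: complex \<times> complex. dist ?a (fst v) < r} \<inter> {v. poly (pderiv p) (fst v) \<noteq> 0})"
    by (intro open_Int open_Collect_less open_Collect_neq continuous_intros)
  then have "openin (top_of_set (affine_curve p)) S" unfolding S_def by (rule openin_open_Int)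
  moreover have "inj_on snd S"
  proof (rule inj_onI)
    fix v w assume vw: "v \<in> S" "w \<in> S" "snd v = snd w"
    then have "poly p (fst v) = poly p (fst w)" by (auto simp: S_def affine_curve_iff)
    then have "fst v = fst w" using vw r(2) by (auto simp: S_def inj_on_def)
    then show "v = w" using vw(3) prod_eqI by blast
  qed
  moreover have "\<forall>(X, Y)\<in>S. poly (pderiv p) X \<noteq> 0" by (auto simp: S_def)
  ultimately have "(S, snd) \<in> affine_charts p" unfolding affine_charts_def by blast
  then show thesis using that u r(1) by (auto simp: S_def)
qed

text \<open>Simple roots give smoothness: where Y = 0 the derivative of p does not vanish, and
  elsewhere X is a coordinate.\<close>

lemma affine_chart_exists:
  assumes "rsquarefree p" "u \<in> affine_curve p"
  obtains S \<phi> where "(S, \<phi>) \<in> affine_charts p" "u \<in> S"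
proof (cases "snd u = 0")
  case True
  then have "poly (pderiv p) (fst u) \<noteq> 0"
    using assms by (auto simp: rsquarefree_roots affine_curve_iff)
  from affine_chart_snd[OF assms(2) this] that show ?thesis by blast
next
  case False
  from affine_chart_fst[OF assms(2) this] that show ?thesis by blast
qed

lemma affine_curve_closed: "closed (affine_curve p)"
proof -
  have "closed {u :: complex \<times> complex. (snd u)\<^sup>2 = poly p (fst u)}"
    by (intro closed_Collect_eq continuous_intros)
  then show ?thesis by (simp add: affine_curve_iff set_eq_iff Collect_mem_eq flip: affine_curve_iff)
qed

lemma affine_curve_compact: "compact {u \<in> affine_curve p. norm (fst u) \<le> 1}"
proof -
  have "compact (poly p ` cball 0 1)"
    by (intro compact_continuous_image continuous_intros) auto
  then obtain M where M: "\<And>x. norm x \<le> 1 \<Longrightarrow> norm (poly p x) \<le> M"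
    unfolding bounded_iff by (metis (no_types, lifting) bounded_iff compact_imp_bounded imageI mem_cball_0)
  have "norm u \<le> 1 + (1 + M)" if "u \<in> affine_curve p" "norm (fst u) \<le> 1" for u
  proof -
    have "(norm (snd u))\<^sup>2 \<le> M"
      using M[OF that(2)] that(1) by (simp add: affine_curve_iff flip: norm_power)
    \<comment> \<open>Comparing |Y| with its square avoids a square root of M.\<close>
    moreover have "norm (snd u) \<le> 1 + (norm (snd u))\<^sup>2"
    proof -
      have "0 \<le> (norm (snd u) - 1)\<^sup>2" "0 \<le> (norm (snd u))\<^sup>2" by (rule zero_le_power2)+
      then show ?thesis unfolding power2_diff one_power2 mult_1_right by linarith
    qed
    moreover have "norm u \<le> norm (fst u) + norm (snd u)"
      using norm_triangle_ineq[of "(fst u, 0)" "(0, snd u)"] by (simp add: norm_Pair)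
    ultimately show ?thesis using that(2) by linarith
  qed
  then have "bounded {u \<in> affine_curve p. norm (fst u) \<le> 1}" unfolding bounded_iff by blast
  moreover have "closed (affine_curve p \<inter> {u. norm (fst u) \<le> 1})"
    by (intro closed_Int affine_curve_closed closed_Collect_le continuous_intros)
  ultimately show ?thesis by (simp add: compact_eq_bounded_closed Int_def)
qed

section \<open>Functions on the affine curve\<close>

text \<open>The branch cut of the square root plays no role: both functions are invariant under
  \<open>Y \<mapsto> -Y\<close>.\<close>

definition even_part :: "complex poly \<Rightarrow> (complex \<times> complex \<Rightarrow> complex) \<Rightarrow> complex \<Rightarrow> complex" where
  "even_part p h X = h (X, csqrt (poly p X)) + h (X, - csqrt (poly p X))"

definition odd_part :: "complex poly \<Rightarrow> (complex \<times> complex \<Rightarrow> complex) \<Rightarrow> complex \<Rightarrow> complex" where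
  "odd_part p h X = csqrt (poly p X) * (h (X, csqrt (poly p X)) - h (X, - csqrt (poly p X)))"

lemma csqrt_cases: "Y\<^sup>2 = z \<Longrightarrow> Y = csqrt z \<or> Y = - csqrt z"
  by (metis power2_csqrt power2_eq_iff)

lemma even_part_eq: "Y\<^sup>2 = poly p X \<Longrightarrow> even_part p h X = h (X, Y) + h (X, - Y)"
  unfolding even_part_def using csqrt_cases by fastforce

lemma odd_part_eq: "Y\<^sup>2 = poly p X \<Longrightarrow> odd_part p h X = Y * (h (X, Y) - h (X, - Y))"
  unfolding odd_part_def using csqrt_cases[of Y "poly p X"] by (auto simp: algebra_simps)

text \<open>Analyticity is asked only along branches with Y \<noteq> 0, and mere continuity where Y
  = 0; this suffices because the finitely many exceptional X are removable singularities.\<close>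

definition curve_holo :: "complex poly \<Rightarrow> (complex \<times> complex \<Rightarrow> complex) \<Rightarrow> bool" where
  "curve_holo p h \<longleftrightarrow> continuous_on (affine_curve p) h \<and>
     (\<forall>s a. s analytic_on {a} \<and> s a \<noteq> 0 \<and> (\<forall>X. (s X)\<^sup>2 = poly p X) \<longrightarrow>
        (\<lambda>X. h (X, s X)) analytic_on {a})"

lemma isCont_csqrt_0: "isCont csqrt 0"
proof -
  have "((\<lambda>z :: complex. sqrt (norm z)) \<longlongrightarrow> sqrt (norm (0 :: complex))) (at 0)" by (intro tendsto_intros)
  then have "((\<lambda>z. norm (csqrt z)) \<longlongrightarrow> 0) (at 0)" by simp
  then have "(csqrt \<longlongrightarrow> 0) (at 0)" by (rule tendsto_norm_zero_cancel)
  then show ?thesis by (simp add: isCont_def)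
qed

text \<open>Away from the roots of p an analytic branch may replace \<open>csqrt\<close>, since
  neither function sees the sign of Y. At a root a, both points over X tend to (a, 0), so continuity
  of h makes the singularity removable.\<close>

lemma curve_parts_holomorphic:
  assumes p: "p \<noteq> 0" and h: "curve_holo p h"
  shows "even_part p h holomorphic_on UNIV" and "odd_part p h holomorphic_on UNIV"
proof -
  let ?K = "{a. poly p a = 0}"
  have fin: "finite ?K" using p by (rule poly_roots_finite)
  have nonroot: "even_part p h analytic_on {a} \<and> odd_part p h analytic_on {a}" if a: "poly p a \<noteq> 0" for a
  proof -
    obtain s where s: "s analytic_on {a}" "s a = csqrt (poly p a)" "\<forall>X. (s X)\<^sup>2 = poly p X"
      using sqrt_section[of "csqrt (poly p a)" p a] a by auto
    then have nz: "s a \<noteq> 0" using a by simp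
    have an1: "(\<lambda>X. h (X, s X)) analytic_on {a}"
      using h s nz unfolding curve_holo_def by blast
    have "(\<lambda>X. - s X) analytic_on {a}" by (intro analytic_intros s)
    then have an2: "(\<lambda>X. h (X, - s X)) analytic_on {a}"
      using h s nz unfolding curve_holo_def
      by (elim conjE allE[of _ "\<lambda>X. - s X"]) auto
    have "even_part p h = (\<lambda>X. h (X, s X) + h (X, - s X))"
      "odd_part p h = (\<lambda>X. s X * (h (X, s X) - h (X, - s X)))"
      using even_part_eq odd_part_eq s(3) by blast+
    then show ?thesis using an1 an2 s by (auto intro!: analytic_intros)
  qed
  have lim: "((\<lambda>X. h (X, c * csqrt (poly p X))) \<longlongrightarrow> h (a, 0)) (at a)"
    if a: "poly p a = 0" and c: "c\<^sup>2 = 1" for a c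
  proof (rule continuous_on_tendsto_compose[of "affine_curve p" h])
    show "continuous_on (affine_curve p) h" using h by (simp add: curve_holo_def)
    have "((\<lambda>X. csqrt (poly p X)) \<longlongrightarrow> csqrt (poly p a)) (at a)"
      by (rule isCont_tendsto_compose[of _ csqrt]) (use isCont_csqrt_0 a poly_isCont[of a p] in \<open>simp_all add: isCont_def\<close>)
    then have "((\<lambda>X. (X, c * csqrt (poly p X))) \<longlongrightarrow> (a, c * csqrt (poly p a))) (at a)"
      by (intro tendsto_intros)
    then show "((\<lambda>X. (X, c * csqrt (poly p X))) \<longlongrightarrow> (a, 0)) (at a)" using a by simp
    show "(a, 0) \<in> affine_curve p" using a by (simp add: affine_curve_iff)
    show "\<forall>\<^sub>F X in at a. (X, c * csqrt (poly p X)) \<in> affine_curve p"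
      by (simp add: affine_curve_iff power_mult_distrib c)
  qed
  have root_even: "(even_part p h \<longlongrightarrow> even_part p h a) (at a within UNIV)" if a: "a \<in> ?K" for a
    unfolding even_part_def using a tendsto_add[OF lim[of a 1] lim[of a "-1"]] by simp
  have root_odd: "(odd_part p h \<longlongrightarrow> odd_part p h a) (at a within UNIV)" if a: "a \<in> ?K" for a
  proof -
    have "((\<lambda>X. csqrt (poly p X)) \<longlongrightarrow> csqrt (poly p a)) (at a)"
      by (rule isCont_tendsto_compose[of _ csqrt]) (use isCont_csqrt_0 a poly_isCont[of a p] in \<open>simp_all add: isCont_def\<close>)
    from tendsto_mult[OF this tendsto_diff[OF lim[of a 1] lim[of a "-1"]]] a
    show ?thesis unfolding odd_part_def by simp
  qed
  have hol: "even_part p h holomorphic_on UNIV - ?K" "odd_part p h holomorphic_on UNIV - ?K"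
    using nonroot by (auto intro!: analytic_imp_holomorphic simp: analytic_on_analytic_at[of _ "UNIV - ?K"])
  show "even_part p h holomorphic_on UNIV"
    by (rule no_isolated_singularity'[OF root_even hol(1) open_UNIV fin])
  show "odd_part p h holomorphic_on UNIV"
    by (rule no_isolated_singularity'[OF root_odd hol(2) open_UNIV fin])
qed

text \<open>For h the indicator of a clopen set, \<open>even_part p h\<close> is entire with values
  0, 1, 2, hence constant. Over a root of p the two points coincide, so the constant is 0 or 2:
  either both points over every X lie in T, or none does.\<close>

lemma affine_curve_connected:
  assumes p: "degree p > 0"
  shows "connected (affine_curve p)"
  unfolding connected_clopen
proof (intro allI impI)
  fix T assume T: "openin (top_of_set (affine_curve p)) T \<and> closedin (top_of_set (affine_curve p)) T"
  let ?C = "affine_curve p"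
  define h :: "complex \<times> complex \<Rightarrow> complex" where "h u = (if u \<in> T then 1 else 0)" for u
  have TC: "T \<subseteq> ?C" using T openin_imp_subset by blast
  then have un: "T \<union> (?C - T) = ?C" by blast
  have oT: "openin (top_of_set ?C) (?C - T)" "closedin (top_of_set ?C) (?C - T)"
    using T by (auto intro: openin_diff closedin_diff)
  have cont: "continuous_on ?C h" unfolding h_def
    by (rule continuous_on_cases_local[of T "?C - T", unfolded un]) (use T oT in auto)
  have "(\<lambda>X. h (X, s X)) analytic_on {a}"
    if s: "s analytic_on {a}" "\<forall>X. (s X)\<^sup>2 = poly p X" for s a
  proof -
    have lim: "((\<lambda>X. (X, s X)) \<longlongrightarrow> (a, s a)) (nhds a)"
      by (intro tendsto_intros analytic_tendsto s filterlim_ident)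
    have inC: "\<forall>\<^sub>F X in nhds a. (X, s X) \<in> ?C" using s by (simp add: affine_curve_iff)
    have "\<forall>\<^sub>F X in nhds a. h (X, s X) = h (a, s a)"
    proof (cases "(a, s a) \<in> T")
      case True
      have "\<forall>\<^sub>F X in nhds a. (X, s X) \<in> T"
        by (rule eventually_in_openin_curve[OF _ lim True inC]) (use T in blast)
      then show ?thesis by eventually_elim (use True in \<open>simp add: h_def\<close>)
    next
      case False
      have "\<forall>\<^sub>F X in nhds a. (X, s X) \<in> ?C - T"
        by (rule eventually_in_openin_curve[OF oT(1) lim _ inC]) (use False s in \<open>auto simp: affine_curve_iff\<close>)
      then show ?thesis by eventually_elim (use False in \<open>simp add: h_def\<close>)
    qed
    from analytic_at_cong[OF this refl] show ?thesis by (simp add: analytic_on_const)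
  qed
  then have "curve_holo p h" using cont unfolding curve_holo_def by blast
  then have hol: "even_part p h holomorphic_on UNIV"
    using p by (intro curve_parts_holomorphic) auto
  have vals: "even_part p h X \<in> {0, 1, 2}" for X by (auto simp: even_part_def h_def)
  then have "bounded (range (even_part p h))"
    by (intro finite_imp_bounded[OF finite_subset[of _ "{0, 1, 2}"]] image_subsetI) auto
  from Liouville_theorem[OF hol this] obtain c where c: "\<And>X. even_part p h X = c"
    unfolding constant_on_def by blast
  obtain a where a: "poly p a = 0"
    using fundamental_theorem_of_algebra[of p] p by (auto simp: constant_degree)
  have "c = 2 * h (a, 0)" using even_part_eq[of 0 p a h] a c by simp
  then have c': "c = (if (a, 0) \<in> T then 2 else 0)" by (auto simp: h_def)
  have "u \<in> T \<longleftrightarrow> (a, 0) \<in> T" if "u \<in> ?C" for u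
  proof -
    have "c = h (fst u, snd u) + h (fst u, - snd u)"
      using even_part_eq[of "snd u" p "fst u" h] that c by (simp add: affine_curve_iff)
    then show ?thesis using c' by (auto simp: h_def split: if_splits)
  qed
  then show "T = {} \<or> T = ?C" using TC by blast
qed

text \<open>How orders are computed below: t is a local parameter at p, and F - F p is a unit times
  a power of it.\<close>

lemma local_order_factor:
  assumes A: "holomorphic_atlas A" and t: "local_order A t p 1"
    and g: "local_holo A g p" "g p \<noteq> 0"
    and ev: "\<forall>\<^sub>F q in near A p. F q - F p = g q * (t q - t p) ^ k"
  shows "local_order A F p k"
proof -
  obtain U \<phi> where c: "(U, \<phi>) \<in> A" "p \<in> U" "order_at (\<lambda>z. t (inv_into U \<phi> z) - t p) (\<phi> p) 1"
    using t unfolding local_order_def by blast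
  have inv: "inv_into U \<phi> (\<phi> p) = p" using chart_inj[OF A c(1)] c(2) by simp
  obtain f where f: "f analytic_on {\<phi> p}" "f (\<phi> p) \<noteq> 0"
      "\<forall>\<^sub>F z in nhds (\<phi> p). t (inv_into U \<phi> z) - t p = f z * (z - \<phi> p) ^ 1"
    using c(3) unfolding order_at_def by blast
  have ga: "(\<lambda>z. g (inv_into U \<phi> z)) analytic_on {\<phi> p}"
    using g(1) by (simp only: local_holo_chart[OF A c(1,2)])
  have "\<forall>\<^sub>F z in nhds (\<phi> p). F (inv_into U \<phi> z) - F p =
      g (inv_into U \<phi> z) * (t (inv_into U \<phi> z) - t p) ^ k"
    using ev by (simp only: eventually_rs[OF A c(1,2)])
  with f(3) have "\<forall>\<^sub>F z in nhds (\<phi> p). F (inv_into U \<phi> z) - F p =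
      (g (inv_into U \<phi> z) * f z ^ k) * (z - \<phi> p) ^ k"
    by eventually_elim (simp add: power_mult_distrib)
  moreover have "(\<lambda>z. g (inv_into U \<phi> z) * f z ^ k) analytic_on {\<phi> p}"
    by (intro analytic_intros ga f)
  ultimately have "order_at (\<lambda>z. F (inv_into U \<phi> z) - F p) (\<phi> p) k"
    unfolding order_at_def using f(2) g(2) inv
    by (intro exI[of _ "\<lambda>z. g (inv_into U \<phi> z) * f z ^ k"]) simp
  then show ?thesis using c unfolding local_order_def by blast
qed

section \<open>The two affine pieces of the projective curve\<close>

text \<open>One predicate for both pieces, so that statements about charts, coordinates and forms
  are proved once for an arbitrary piece.\<close>

definition curve_piece ::
    "complex poly \<Rightarrow> (complex \<times> complex \<Rightarrow> curve_point) \<Rightarrow> complex poly \<Rightarrow> bool" where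
  "curve_piece f \<iota> p \<longleftrightarrow>
     \<iota> = affine_incl \<and> p = f \<or> \<iota> = infinite_incl (half_degree f) \<and> p = poly_at_infinity f"

text \<open>The change of coordinates between the pieces. It is its own inverse where the first
  coordinate is nonzero, so the same formula serves in both directions.\<close>

definition flip_piece :: "nat \<Rightarrow> complex \<times> complex \<Rightarrow> complex \<times> complex" where
  "flip_piece n u = (1 / fst u, snd u / fst u ^ n)"

lemma curve_piece_affine: "curve_piece f affine_incl f"
  and curve_piece_infinite: "curve_piece f (infinite_incl (half_degree f)) (poly_at_infinity f)"
  by (simp_all add: curve_piece_def)

lemma inj_affine_incl: "inj affine_incl"
  by (auto simp: inj_on_def affine_incl_def)

lemma inj_infinite_incl: "inj (infinite_incl n)"
  by (auto simp: inj_on_def infinite_incl_def split: if_splits)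

lemma curve_piece_inj: "curve_piece f \<iota> p \<Longrightarrow> inj \<iota>"
  using inj_affine_incl inj_infinite_incl by (auto simp: curve_piece_def)

lemma affine_eq_infinite_incl:
  "affine_incl u = infinite_incl n v \<longleftrightarrow> fst u \<noteq> 0 \<and> v = flip_piece n u"
  "infinite_incl n v = affine_incl u \<longleftrightarrow> fst v \<noteq> 0 \<and> u = flip_piece n v"
proof -
  have 1: "affine_incl u = infinite_incl n v \<longleftrightarrow> fst v \<noteq> 0 \<and> u = flip_piece n v" for u v
    by (cases u; cases v) (auto simp: affine_incl_def infinite_incl_def flip_piece_def)
  have "flip_piece n (flip_piece n w) = w" if "fst w \<noteq> 0" for w
    using that by (cases w) (simp add: flip_piece_def power_divide)
  then have 2: "fst v \<noteq> 0 \<and> u = flip_piece n v \<longleftrightarrow> fst u \<noteq> 0 \<and> v = flip_piece n u"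
    by (metis (no_types, lifting) divide_eq_0_iff flip_piece_def fst_conv zero_neq_one)
  show "affine_incl u = infinite_incl n v \<longleftrightarrow> fst u \<noteq> 0 \<and> v = flip_piece n u"
    using 1 2 by blast
  show "infinite_incl n v = affine_incl u \<longleftrightarrow> fst v \<noteq> 0 \<and> u = flip_piece n v"
    using 1 by metis
qed

lemma degree_le_half_degree: "degree f \<le> 2 * half_degree f"
  by (simp add: half_degree_def)

lemma poly_at_infinity_nz:
  assumes "U \<noteq> 0"
  shows "poly (poly_at_infinity f) U = U ^ (2 * half_degree f) * poly f (1 / U)"
proof -
  have "U ^ (2 * half_degree f - degree f) * U ^ degree f = U ^ (2 * half_degree f)"
    using degree_le_half_degree[of f] by (simp flip: power_add)
  then show ?thesis
    using assms by (simp add: poly_at_infinity_def poly_monom poly_reflect_poly_nz inverse_eq_divide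
        mult.assoc [symmetric])
qed

lemma flip_piece_curve:
  assumes "fst u \<noteq> 0"
  shows "u \<in> affine_curve f \<Longrightarrow> flip_piece (half_degree f) u \<in> affine_curve (poly_at_infinity f)"
    and "u \<in> affine_curve (poly_at_infinity f) \<Longrightarrow> flip_piece (half_degree f) u \<in> affine_curve f"
  using assms
  by (auto simp: affine_curve_iff flip_piece_def poly_at_infinity_nz power_divide power_even_eq)

text \<open>By the symmetry of the flip, the two orders of distinct pieces share one description,
  and overlap arguments need a single nontrivial case.\<close>

lemma curve_piece_cases:
  assumes "curve_piece f \<iota> p" "curve_piece f \<kappa> q"
  obtains "\<kappa> = \<iota>" "q = p"
  | "\<And>u v. \<iota> u = \<kappa> v \<longleftrightarrow> fst u \<noteq> 0 \<and> v = flip_piece (half_degree f) u"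
    "\<And>u. u \<in> affine_curve p \<Longrightarrow> fst u \<noteq> 0 \<Longrightarrow> flip_piece (half_degree f) u \<in> affine_curve q"
proof -
  consider "\<kappa> = \<iota> \<and> q = p"
    | "\<iota> = affine_incl" "p = f" "\<kappa> = infinite_incl (half_degree f)" "q = poly_at_infinity f"
    | "\<kappa> = affine_incl" "q = f" "\<iota> = infinite_incl (half_degree f)" "p = poly_at_infinity f"
    using assms unfolding curve_piece_def by blast
  then show thesis
  proof cases
    case 1 then show thesis using that(1) by blast
  next
    case 2
    show thesis by (rule that(2)) (use 2 affine_eq_infinite_incl flip_piece_curve in auto)
  next
    case 3
    show thesis by (rule that(2)) (use 3 affine_eq_infinite_incl flip_piece_curve in auto)
  qed
qed

lemma projective_curve_chart:
  "curve_piece f \<iota> p \<Longrightarrow> (S, \<phi>) \<in> affine_charts p \<Longrightarrow> (\<iota> ` S, \<phi> \<circ> inv \<iota>) \<in> projective_curve f"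
  unfolding curve_piece_def projective_curve_def transport_charts_def by blast

lemma projective_curve_chart_cases:
  assumes "(U, \<theta>) \<in> projective_curve f"
  obtains \<iota> p S \<phi> where "curve_piece f \<iota> p" "(S, \<phi>) \<in> affine_charts p" "U = \<iota> ` S" "\<theta> = \<phi> \<circ> inv \<iota>"
  using assms unfolding curve_piece_def projective_curve_def transport_charts_def by blast

lemma inv_into_transport:
  assumes "inj \<iota>" "inj_on \<phi> S" "z \<in> \<phi> ` S"
  shows "inv_into (\<iota> ` S) (\<phi> \<circ> inv \<iota>) z = \<iota> (inv_into S \<phi> z)"
proof (rule inv_into_f_eq)
  show "inj_on (\<phi> \<circ> inv \<iota>) (\<iota> ` S)" using assms(1,2) by (auto simp: inj_on_def)
  show "\<iota> (inv_into S \<phi> z) \<in> \<iota> ` S" using assms(3) by (auto intro: inv_into_into)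
  show "(\<phi> \<circ> inv \<iota>) (\<iota> (inv_into S \<phi> z)) = z" using assms(1,3) by (simp add: f_inv_into_f)
qed

lemma piece_overlap_openin:
  assumes \<iota>: "curve_piece f \<iota> p" and \<kappa>: "curve_piece f \<kappa> q"
    and S: "openin (top_of_set (affine_curve p)) S" and T: "openin (top_of_set (affine_curve q)) T"
  shows "openin (top_of_set (affine_curve p)) {u \<in> S. \<iota> u \<in> \<kappa> ` T}"
  using \<iota> \<kappa>
proof (cases rule: curve_piece_cases)
  case 1
  then have "{u \<in> S. \<iota> u \<in> \<kappa> ` T} = S \<inter> T"
    using curve_piece_inj[OF \<iota>] by (auto simp: inj_on_def)
  then show ?thesis using S T 1 by auto
next
  case 2
  let ?n = "half_degree f"
  obtain R where R: "open R" "T = affine_curve q \<inter> R" using T openin_open by metis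
  have "continuous_on {u. fst u \<noteq> 0} (flip_piece ?n)"
    unfolding flip_piece_def by (intro continuous_intros) auto
  moreover have "open {u :: complex \<times> complex. fst u \<noteq> 0}"
    by (intro open_Collect_neq continuous_intros)
  ultimately have "open ({u. fst u \<noteq> 0} \<inter> flip_piece ?n -` R)"
    using R(1) by (intro continuous_open_preimage)
  then have "openin (top_of_set (affine_curve p)) (S \<inter> ({u. fst u \<noteq> 0} \<inter> flip_piece ?n -` R))"
    using S by (rule openin_Int_open[rotated])
  also have "S \<inter> ({u. fst u \<noteq> 0} \<inter> flip_piece ?n -` R) = {u \<in> S. \<iota> u \<in> \<kappa> ` T}"
  proof -
    have "\<iota> u \<in> \<kappa> ` T \<longleftrightarrow> fst u \<noteq> 0 \<and> flip_piece ?n u \<in> R" if "u \<in> S" for u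
      unfolding image_iff 2(1) R(2) using 2(2)[of u] that openin_imp_subset[OF S] by blast
    then show ?thesis by blast
  qed
  finally show ?thesis .
qed

text \<open>The coordinates of the same piece are analytic by the parametrization of the chart;
  those of the other piece are 1 / X and Y / X^n, with X \<noteq> 0 on the overlap.\<close>

lemma piece_coordinates_analytic:
  assumes \<iota>: "curve_piece f \<iota> p" and \<kappa>: "curve_piece f \<kappa> q"
    and c: "(S, \<phi>) \<in> affine_charts p" and u: "u \<in> S" "\<iota> u \<in> \<kappa> ` affine_curve q"
  shows "(\<lambda>z. fst (inv \<kappa> (\<iota> (inv_into S \<phi> z)))) analytic_on {\<phi> u}"
    and "(\<lambda>z. snd (inv \<kappa> (\<iota> (inv_into S \<phi> z)))) analytic_on {\<phi> u}"
proof -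
  obtain \<alpha> \<beta> where ab: "\<alpha> analytic_on {\<phi> u}" "\<beta> analytic_on {\<phi> u}"
    "\<forall>\<^sub>F z in nhds (\<phi> u). z \<in> \<phi> ` S \<and> inv_into S \<phi> z = (\<alpha> z, \<beta> z)"
    by (rule affine_chart_parametrization[OF c u(1)])
  have "(\<lambda>z. fst (inv \<kappa> (\<iota> (inv_into S \<phi> z)))) analytic_on {\<phi> u} \<and>
      (\<lambda>z. snd (inv \<kappa> (\<iota> (inv_into S \<phi> z)))) analytic_on {\<phi> u}"
    using \<iota> \<kappa>
  proof (cases rule: curve_piece_cases)
    case 1
    have "\<forall>\<^sub>F z in nhds (\<phi> u). fst (inv \<kappa> (\<iota> (inv_into S \<phi> z))) = \<alpha> z"
      "\<forall>\<^sub>F z in nhds (\<phi> u). snd (inv \<kappa> (\<iota> (inv_into S \<phi> z))) = \<beta> z"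
      using ab(3) by (eventually_elim, use 1 curve_piece_inj[OF \<iota>] in simp)+
    from this[THEN analytic_at_cong[OF _ refl]] show ?thesis using ab(1,2) by blast
  next
    case 2
    let ?n = "half_degree f"
    have "(\<alpha> (\<phi> u), \<beta> (\<phi> u)) = u"
      using eventually_nhds_x_imp_x[OF ab(3)] inv_into_f_f[OF affine_chart_inj[OF c] u(1)] by simp
    moreover have "fst u \<noteq> 0" using 2(1) u(2) by blast
    ultimately have nz: "\<alpha> (\<phi> u) \<noteq> 0" by (metis fst_conv)
    have "\<forall>\<^sub>F z in nhds (\<phi> u). \<alpha> z \<noteq> 0"
      using eventually_compose_filterlim[OF t1_space_nhds[OF nz] analytic_tendsto[OF ab(1)]] .
    with ab(3) have ev: "\<forall>\<^sub>F z in nhds (\<phi> u). inv \<kappa> (\<iota> (inv_into S \<phi> z)) = flip_piece ?n (\<alpha> z, \<beta> z)"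
    proof eventually_elim
      case (elim z)
      then have "\<iota> (inv_into S \<phi> z) = \<kappa> (flip_piece ?n (\<alpha> z, \<beta> z))" using 2(1) by simp
      then show ?case using curve_piece_inj[OF \<kappa>] by simp
    qed
    have "\<forall>\<^sub>F z in nhds (\<phi> u). fst (inv \<kappa> (\<iota> (inv_into S \<phi> z))) = 1 / \<alpha> z"
      "\<forall>\<^sub>F z in nhds (\<phi> u). snd (inv \<kappa> (\<iota> (inv_into S \<phi> z))) = \<beta> z / \<alpha> z ^ ?n"
      using ev by (eventually_elim, simp add: flip_piece_def)+
    from this[THEN analytic_at_cong[OF _ refl]] show ?thesis
      using ab(1,2) nz by (auto intro!: analytic_intros)
  qed
  then show "(\<lambda>z. fst (inv \<kappa> (\<iota> (inv_into S \<phi> z)))) analytic_on {\<phi> u}"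
    "(\<lambda>z. snd (inv \<kappa> (\<iota> (inv_into S \<phi> z)))) analytic_on {\<phi> u}" by blast+
qed

text \<open>Every chart is a coordinate of one of the pieces, so each transition map is a coordinate
  of one piece written in a chart of the same or the other piece.\<close>

lemma holomorphic_atlas_projective_curve: "holomorphic_atlas (projective_curve f)"
proof -
  have 1: "inj_on \<theta> U \<and> open (\<theta> ` U)" if "(U, \<theta>) \<in> projective_curve f" for U \<theta>
    using that
  proof (cases rule: projective_curve_chart_cases)
    case (1 \<iota> p S \<phi>)
    have "\<theta> ` U = \<phi> ` S" using 1 curve_piece_inj[OF 1(1)] by (simp add: image_image)
    moreover have "inj_on \<theta> U"
      using 1 curve_piece_inj[OF 1(1)] affine_chart_inj[OF 1(2)] by (auto simp: inj_on_def)
    ultimately show ?thesis using affine_chart_image_open[OF 1(2)] by simp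
  qed
  have 2: "open (\<theta> ` (U \<inter> W)) \<and> (\<eta> \<circ> inv_into U \<theta>) holomorphic_on \<theta> ` (U \<inter> W)"
    if c: "(U, \<theta>) \<in> projective_curve f" and d: "(W, \<eta>) \<in> projective_curve f" for U \<theta> W \<eta>
    using c
  proof (cases rule: projective_curve_chart_cases)
    case (1 \<iota> p S \<phi>)
    from d show ?thesis
    proof (cases rule: projective_curve_chart_cases)
      case d: (1 \<kappa> q T \<psi>)
      note inj = curve_piece_inj[OF 1(1)]
      define R where "R = {u \<in> S. \<iota> u \<in> \<kappa> ` T}"
      have R: "(R, \<phi>) \<in> affine_charts p"
        by (rule affine_chart_restrict[OF 1(2)])
          (use piece_overlap_openin[OF 1(1) d(1) affine_chart_openin[OF 1(2)] affine_chart_openin[OF d(2)]]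
            in \<open>auto simp: R_def\<close>)
      have "U \<inter> W = \<iota> ` R" unfolding 1(3) d(3) R_def by blast
      then have im: "\<theta> ` (U \<inter> W) = \<phi> ` R"
        using inj by (simp add: 1(4) image_image)
      have "(\<eta> \<circ> inv_into U \<theta>) analytic_on \<phi> ` R"
      proof (subst analytic_on_analytic_at, clarify)
        fix a b assume u: "(a, b) \<in> R"
        then have uS: "(a, b) \<in> S" and uT: "\<iota> (a, b) \<in> \<kappa> ` affine_curve q"
          using affine_chart_subset[OF d(2)] by (auto simp: R_def)
        have an: "(\<lambda>z. \<psi> (inv \<kappa> (\<iota> (inv_into S \<phi> z)))) analytic_on {\<phi> (a, b)}"
          using d(2)
        proof (cases rule: affine_chart_cases)
          case c1: 1
          show ?thesis unfolding c1(1)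
            by (rule piece_coordinates_analytic(1)[OF 1(1) d(1) 1(2) uS uT])
        next
          case c2: 2
          show ?thesis unfolding c2(1)
            by (rule piece_coordinates_analytic(2)[OF 1(1) d(1) 1(2) uS uT])
        qed
        have "\<forall>\<^sub>F z in nhds (\<phi> (a, b)). z \<in> \<phi> ` S"
          using affine_chart_image_open[OF 1(2)] uS by (intro eventually_nhds_in_open) auto
        then have "\<forall>\<^sub>F z in nhds (\<phi> (a, b)). (\<eta> \<circ> inv_into U \<theta>) z = \<psi> (inv \<kappa> (\<iota> (inv_into S \<phi> z)))"
          by eventually_elim
            (use 1 d inv_into_transport[OF inj affine_chart_inj[OF 1(2)]] in simp)
        from analytic_at_cong[OF this refl] an
        show "(\<eta> \<circ> inv_into U \<theta>) analytic_on {\<phi> (a, b)}" by blast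
      qed
      then show ?thesis
        unfolding im using affine_chart_image_open[OF R] analytic_imp_holomorphic by blast
    qed
  qed
  show ?thesis unfolding holomorphic_atlas_def using 1 2 by blast
qed

text \<open>The polynomial vanishes at U = 0 only for odd degree, and then it is U times a
  polynomial whose constant term is the leading coefficient of f. A double root U \<noteq> 0 would
  give the double root 1 / U of f.\<close>

lemma poly_at_infinity_rsquarefree:
  assumes f: "rsquarefree f"
  shows "rsquarefree (poly_at_infinity f)"
  unfolding rsquarefree_roots
proof (intro allI notI, elim conjE)
  fix U assume 0: "poly (poly_at_infinity f) U = 0" and d0: "poly (pderiv (poly_at_infinity f)) U = 0"
  let ?n = "half_degree f"
  show False
  proof (cases "U = 0")
    case True
    have lc: "lead_coeff f \<noteq> 0" using rsquarefree_nonzero[OF f] by simp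
    define k where "k = 2 * half_degree f - degree f"
    have "k \<noteq> 0" using 0 True lc by (cases "k = 0") (auto simp: poly_at_infinity_def k_def)
    then have "k = 1" unfolding k_def half_degree_def by linarith
    then have "poly_at_infinity f = [:0, 1:] * reflect_poly f"
      by (simp add: poly_at_infinity_def k_def monom_altdef)
    then show False using d0 True lc by (simp add: pderiv_mult pderiv_pCons)
  next
    case False
    have root: "poly f (1 / U) = 0" using 0 False by (simp add: poly_at_infinity_nz)
    \<comment> \<open>The term of the product rule that contains the value of f at 1 / U is zero at
      a root.\<close>
    have "((\<lambda>U. U ^ (2 * ?n) * poly f (1 / U)) has_field_derivative
        - (U ^ (2 * ?n) * poly (pderiv f) (1 / U) / U\<^sup>2)) (at U)"
      using False root
      by (auto intro!: derivative_eq_intros DERIV_chain2[OF poly_DERIV] simp: power2_eq_square)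
    moreover have "\<forall>\<^sub>F W in nhds U. W ^ (2 * ?n) * poly f (1 / W) = poly (poly_at_infinity f) W"
      using t1_space_nhds[OF False] by eventually_elim (simp add: poly_at_infinity_nz)
    ultimately have "(poly (poly_at_infinity f) has_field_derivative
        - (U ^ (2 * ?n) * poly (pderiv f) (1 / U) / U\<^sup>2)) (at U)"
      by (rule DERIV_cong_ev[OF refl _ refl, THEN iffD1, rotated])
    from DERIV_unique[OF this poly_DERIV] d0 False have "poly (pderiv f) (1 / U) = 0" by simp
    with root f show False by (auto simp: rsquarefree_roots)
  qed
qed

lemma curve_piece_rsquarefree: "curve_piece f \<iota> p \<Longrightarrow> rsquarefree f \<Longrightarrow> rsquarefree p"
  using poly_at_infinity_rsquarefree by (auto simp: curve_piece_def)

lemma rs_points_projective_curve: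
  assumes "rsquarefree f"
  shows "rs_points (projective_curve f) =
    affine_incl ` affine_curve f \<union> infinite_incl (half_degree f) ` affine_curve (poly_at_infinity f)"
proof -
  have "(\<Union>(U, \<theta>)\<in>projective_curve f. U) = (\<Union>(\<iota>, p)\<in>{(\<iota>, p). curve_piece f \<iota> p}. \<iota> ` affine_curve p)"
  proof (intro subset_antisym subsetI)
    fix P assume "P \<in> (\<Union>(U, \<theta>)\<in>projective_curve f. U)"
    then obtain U \<theta> where c: "(U, \<theta>) \<in> projective_curve f" "P \<in> U" by blast
    from c(1) show "P \<in> (\<Union>(\<iota>, p)\<in>{(\<iota>, p). curve_piece f \<iota> p}. \<iota> ` affine_curve p)"
      by (cases rule: projective_curve_chart_cases) (use c(2) affine_chart_subset in blast)
  next
    fix P assume "P \<in> (\<Union>(\<iota>, p)\<in>{(\<iota>, p). curve_piece f \<iota> p}. \<iota> ` affine_curve p)"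
    then obtain \<iota> p u where u: "curve_piece f \<iota> p" "u \<in> affine_curve p" "P = \<iota> u" by blast
    obtain S \<phi> where "(S, \<phi>) \<in> affine_charts p" "u \<in> S"
      by (rule affine_chart_exists[OF curve_piece_rsquarefree[OF u(1) assms] u(2)])
    then show "P \<in> (\<Union>(U, \<theta>)\<in>projective_curve f. U)"
      using projective_curve_chart[OF u(1)] u(3) by blast
  qed
  then show ?thesis unfolding rs_points_def by (auto simp: curve_piece_def)
qed

lemma curve_piece_points:
  "rsquarefree f \<Longrightarrow> curve_piece f \<iota> p \<Longrightarrow> u \<in> affine_curve p \<Longrightarrow> \<iota> u \<in> rs_points (projective_curve f)"
  by (auto simp: rs_points_projective_curve curve_piece_def)

lemma Affine_in_projective_curve:
  assumes "rsquarefree f"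
  shows "Affine X Y \<in> rs_points (projective_curve f) \<longleftrightarrow> Y\<^sup>2 = poly f X"
proof -
  have "Affine X Y = affine_incl (X, Y)" by (simp add: affine_incl_def)
  moreover have "(X, Y) \<in> affine_curve f" if "affine_incl (X, Y) = infinite_incl (half_degree f) u"
      "u \<in> affine_curve (poly_at_infinity f)" for u
    using that affine_eq_infinite_incl(2)[of "half_degree f" u "(X, Y)"] flip_piece_curve(2)[of u f] by auto
  ultimately show ?thesis
    using inj_affine_incl
    by (auto simp: rs_points_projective_curve[OF assms] inj_image_mem_iff affine_curve_def)
qed

lemma Infinite_in_projective_curve:
  assumes "rsquarefree f"
  shows "Infinite V \<in> rs_points (projective_curve f) \<longleftrightarrow> V\<^sup>2 = poly (poly_at_infinity f) 0"
proof -
  have "Infinite V = infinite_incl n (0, V)" for n by (simp add: infinite_incl_def)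
  then have "Infinite V \<in> infinite_incl n ` S \<longleftrightarrow> (0, V) \<in> S" for n S
    using inj_image_mem_iff[OF inj_infinite_incl] by metis
  moreover have "Infinite V \<notin> affine_incl ` S" for S by (auto simp: affine_incl_def)
  ultimately show ?thesis
    by (simp add: rs_points_projective_curve[OF assms] affine_curve_iff)
qed

lemma piece_chart:
  assumes \<iota>: "curve_piece f \<iota> p" and u: "u \<in> affine_curve p" and f: "rsquarefree f"
  obtains S \<phi> where "(S, \<phi>) \<in> affine_charts p" "u \<in> S"
  by (rule affine_chart_exists[OF curve_piece_rsquarefree[OF \<iota> f] u])

lemma piece_coordinates_holo:
  assumes \<iota>: "curve_piece f \<iota> p" and u: "u \<in> affine_curve p" and f: "rsquarefree f"
  shows "local_holo (projective_curve f) (\<lambda>P. fst (inv \<iota> P)) (\<iota> u)"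
    and "local_holo (projective_curve f) (\<lambda>P. snd (inv \<iota> P)) (\<iota> u)"
proof -
  obtain S \<phi> where c: "(S, \<phi>) \<in> affine_charts p" "u \<in> S" by (rule piece_chart[OF \<iota> u f])
  note inj = curve_piece_inj[OF \<iota>]
  have "\<forall>\<^sub>F z in nhds (\<phi> u). z \<in> \<phi> ` S"
    using affine_chart_image_open[OF c(1)] c(2) by (intro eventually_nhds_in_open) auto
  then have ev: "\<forall>\<^sub>F z in nhds (\<phi> u). \<iota> (inv_into S \<phi> z) = inv_into (\<iota> ` S) (\<phi> \<circ> inv \<iota>) z"
    by eventually_elim (use inv_into_transport[OF inj affine_chart_inj[OF c(1)]] in simp)
  have ev1: "\<forall>\<^sub>F z in nhds (\<phi> u). fst (inv \<iota> (\<iota> (inv_into S \<phi> z))) =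
      fst (inv \<iota> (inv_into (\<iota> ` S) (\<phi> \<circ> inv \<iota>) z))"
    and ev2: "\<forall>\<^sub>F z in nhds (\<phi> u). snd (inv \<iota> (\<iota> (inv_into S \<phi> z))) =
      snd (inv \<iota> (inv_into (\<iota> ` S) (\<phi> \<circ> inv \<iota>) z))"
    using ev by (eventually_elim, simp only:)+
  have uin: "\<iota> u \<in> \<iota> ` affine_curve p" using u by blast
  have pt: "(\<phi> \<circ> inv \<iota>) (\<iota> u) = \<phi> u" using inj by simp
  show "local_holo (projective_curve f) (\<lambda>P. fst (inv \<iota> P)) (\<iota> u)"
    unfolding local_holo_def
    using projective_curve_chart[OF \<iota> c(1)] c(2) analytic_at_cong[OF ev1 refl]
      piece_coordinates_analytic(1)[OF \<iota> \<iota> c uin]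
    by (intro exI[of _ "\<iota> ` S"] exI[of _ "\<phi> \<circ> inv \<iota>"] conjI) (simp_all only: pt, blast+)
  show "local_holo (projective_curve f) (\<lambda>P. snd (inv \<iota> P)) (\<iota> u)"
    unfolding local_holo_def
    using projective_curve_chart[OF \<iota> c(1)] c(2) analytic_at_cong[OF ev2 refl]
      piece_coordinates_analytic(2)[OF \<iota> \<iota> c uin]
    by (intro exI[of _ "\<iota> ` S"] exI[of _ "\<phi> \<circ> inv \<iota>"] conjI) (simp_all only: pt, blast+)
qed

lemma local_order_coord:
  assumes A: "holomorphic_atlas A" and c: "(U, \<phi>) \<in> A" and p: "p \<in> U"
  shows "local_order A \<phi> p 1"
  using order_at_transition[OF A c c p p] c p unfolding local_order_def by blast

lemma piece_fst_order:
  assumes \<iota>: "curve_piece f \<iota> p" and u: "u \<in> affine_curve p" "snd u \<noteq> 0"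
  shows "local_order (projective_curve f) (\<lambda>P. fst (inv \<iota> P)) (\<iota> u) 1"
proof -
  obtain S where c: "(S, fst) \<in> affine_charts p" "u \<in> S" by (rule affine_chart_fst[OF u])
  show ?thesis
    using local_order_coord[OF holomorphic_atlas_projective_curve projective_curve_chart[OF \<iota> c(1)]] c(2)
    by (simp add: o_def)
qed

lemma piece_snd_order:
  assumes \<iota>: "curve_piece f \<iota> p" and u: "u \<in> affine_curve p" "poly (pderiv p) (fst u) \<noteq> 0"
  shows "local_order (projective_curve f) (\<lambda>P. snd (inv \<iota> P)) (\<iota> u) 1"
proof -
  obtain S where c: "(S, snd) \<in> affine_charts p" "u \<in> S" by (rule affine_chart_snd[OF u])
  show ?thesis
    using local_order_coord[OF holomorphic_atlas_projective_curve projective_curve_chart[OF \<iota> c(1)]] c(2)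
    by (simp add: o_def)
qed

lemma piece_openin:
  assumes \<iota>: "curve_piece f \<iota> p" and f: "rsquarefree f" and V: "openin (top_of_set (affine_curve p)) V"
  shows "openin (rs_topology (projective_curve f)) (\<iota> ` V)"
proof (subst openin_subopen, clarify)
  fix a b assume u: "(a, b) \<in> V"
  have uc: "(a, b) \<in> affine_curve p" using openin_imp_subset[OF V] u by blast
  obtain S \<phi> where c: "(S, \<phi>) \<in> affine_charts p" "(a, b) \<in> S" by (rule piece_chart[OF \<iota> uc f])
  have "(S \<inter> V, \<phi>) \<in> affine_charts p"
    using affine_chart_openin[OF c(1)] V by (intro affine_chart_restrict[OF c(1)]) auto
  from chart_open[OF holomorphic_atlas_projective_curve projective_curve_chart[OF \<iota> this]] c(2) u
  show "\<exists>T. openin (rs_topology (projective_curve f)) T \<and> \<iota> (a, b) \<in> T \<and> T \<subseteq> \<iota> ` V"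
    by (intro exI[of _ "\<iota> ` (S \<inter> V)"]) auto
qed

lemma piece_eventually:
  assumes \<iota>: "curve_piece f \<iota> p" and f: "rsquarefree f" and u: "u \<in> affine_curve p"
  shows "\<forall>\<^sub>F P in near (projective_curve f) (\<iota> u). P \<in> \<iota> ` affine_curve p"
  using piece_openin[OF \<iota> f openin_subtopology_self] u unfolding eventually_nhdsin by blast

lemma piece_continuous:
  assumes \<iota>: "curve_piece f \<iota> p" and f: "rsquarefree f"
  shows "continuous_map (top_of_set (affine_curve p)) (rs_topology (projective_curve f)) \<iota>"
  unfolding continuous_map_def
proof (intro conjI allI impI)
  note A = holomorphic_atlas_projective_curve[of f]
  show "\<iota> \<in> topspace (top_of_set (affine_curve p)) \<rightarrow> topspace (rs_topology (projective_curve f))"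
    using curve_piece_points[OF f \<iota>] A by auto
  fix V assume V: "openin (rs_topology (projective_curve f)) V"
  show "openin (top_of_set (affine_curve p)) {u \<in> topspace (top_of_set (affine_curve p)). \<iota> u \<in> V}"
  proof (subst openin_subopen, clarify)
    fix a b assume u: "(a, b) \<in> topspace (top_of_set (affine_curve p))" "\<iota> (a, b) \<in> V"
    then have uc: "(a, b) \<in> affine_curve p" by simp
    obtain S \<phi> where c: "(S, \<phi>) \<in> affine_charts p" "(a, b) \<in> S" by (rule piece_chart[OF \<iota> uc f])
    define W where "W = (\<phi> \<circ> inv \<iota>) ` (V \<inter> \<iota> ` S)"
    have "open W" using V projective_curve_chart[OF \<iota> c(1)] unfolding W_def openin_rs[OF A] by fast
    moreover have "continuous_on S \<phi>"
      using c(1) by (cases rule: affine_chart_cases) (auto intro!: continuous_intros)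
    ultimately have "openin (top_of_set S) (S \<inter> \<phi> -` W)" by (rule continuous_openin_preimage_gen[rotated])
    then have "openin (top_of_set (affine_curve p)) (S \<inter> \<phi> -` W)"
      using affine_chart_openin[OF c(1)] openin_trans by blast
    moreover have "S \<inter> \<phi> -` W \<subseteq> {u \<in> topspace (top_of_set (affine_curve p)). \<iota> u \<in> V}"
    proof
      fix u assume u: "u \<in> S \<inter> \<phi> -` W"
      then obtain u' where u': "\<phi> u = (\<phi> \<circ> inv \<iota>) (\<iota> u')" "\<iota> u' \<in> V" "u' \<in> S"
        unfolding W_def by auto
      then have "\<phi> u = \<phi> u'" using curve_piece_inj[OF \<iota>] by simp
      then have "u = u'" using u u'(3) inj_onD[OF affine_chart_inj[OF c(1)]] by blast
      then show "u \<in> {u \<in> topspace (top_of_set (affine_curve p)). \<iota> u \<in> V}"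
        using u' affine_chart_subset[OF c(1)] by auto
    qed
    moreover have "(a, b) \<in> S \<inter> \<phi> -` W"
      using c(2) u(2) curve_piece_inj[OF \<iota>] unfolding W_def
      by (auto intro!: image_eqI[of _ _ "\<iota> (a, b)"])
    ultimately show "\<exists>T. openin (top_of_set (affine_curve p)) T \<and> (a, b) \<in> T \<and>
        T \<subseteq> {u \<in> topspace (top_of_set (affine_curve p)). \<iota> u \<in> V}" by blast
  qed
qed

section \<open>Maps into the curve given by coordinates, and compactness of the curve\<close>

lemma map_into_curve:
  assumes \<iota>: "curve_piece f \<iota> p" and A: "holomorphic_atlas A" and x: "x \<in> rs_points A"
    and c: "(S, \<phi>) \<in> affine_charts p" "(\<alpha> x, \<beta> x) \<in> S"
    and ab: "local_holo A \<alpha> x" "local_holo A \<beta> x"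
    and ev: "\<forall>\<^sub>F y in near A x. F y = \<iota> (\<alpha> y, \<beta> y) \<and> (\<alpha> y, \<beta> y) \<in> affine_curve p"
  shows "F x \<in> \<iota> ` S" and "\<forall>\<^sub>F y in near A x. F y \<in> \<iota> ` S"
    and "\<forall>\<^sub>F y in near A x. \<phi> (\<alpha> y, \<beta> y) = (\<phi> \<circ> inv \<iota>) (F y)"
proof -
  have lim: "((\<lambda>y. (\<alpha> y, \<beta> y)) \<longlongrightarrow> (\<alpha> x, \<beta> x)) (near A x)"
    by (intro tendsto_Pair local_holo_continuous A ab)
  have "\<forall>\<^sub>F y in near A x. (\<alpha> y, \<beta> y) \<in> affine_curve p"
    using ev by eventually_elim blast
  from eventually_in_openin_curve[OF affine_chart_openin[OF c(1)] lim c(2) this] ev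
  show ev': "\<forall>\<^sub>F y in near A x. F y \<in> \<iota> ` S"
    by eventually_elim auto
  then show "F x \<in> \<iota> ` S" using eventually_nhdsin_self[OF _ ev'] x A by simp
  show "\<forall>\<^sub>F y in near A x. \<phi> (\<alpha> y, \<beta> y) = (\<phi> \<circ> inv \<iota>) (F y)"
    using ev by eventually_elim (use curve_piece_inj[OF \<iota>] in simp)
qed

lemma map_order_into_curve:
  assumes \<iota>: "curve_piece f \<iota> p" and A: "holomorphic_atlas A" and x: "x \<in> rs_points A"
    and c: "(S, \<phi>) \<in> affine_charts p" "(\<alpha> x, \<beta> x) \<in> S"
    and ab: "local_holo A \<alpha> x" "local_holo A \<beta> x"
    and ev: "\<forall>\<^sub>F y in near A x. F y = \<iota> (\<alpha> y, \<beta> y) \<and> (\<alpha> y, \<beta> y) \<in> affine_curve p"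
    and o: "local_order A (\<lambda>y. \<phi> (\<alpha> y, \<beta> y)) x k"
  shows "map_order A (projective_curve f) F x k"
proof -
  note m = map_into_curve[OF \<iota> A x c ab ev]
  show ?thesis unfolding map_order_def
    using projective_curve_chart[OF \<iota> c(1)] m(1,2) local_order_cong[OF A m(3) o]
    by (intro exI[of _ "\<iota> ` S"] exI[of _ "\<phi> \<circ> inv \<iota>"]) simp
qed

text \<open>Where the second coordinate of the image is nonzero, the first one is a chart of the
  target, so its order is the order of the map.\<close>

lemma map_order_into_curve_fst:
  assumes \<iota>: "curve_piece f \<iota> p" and A: "holomorphic_atlas A" and x: "x \<in> rs_points A"
    and nz: "\<beta> x \<noteq> 0" and b: "local_holo A \<beta> x"
    and ev: "\<forall>\<^sub>F y in near A x. F y = \<iota> (\<alpha> y, \<beta> y) \<and> (\<alpha> y, \<beta> y) \<in> affine_curve p"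
    and o: "local_order A \<alpha> x k"
  shows "map_order A (projective_curve f) F x k"
proof -
  have "(\<alpha> x, \<beta> x) \<in> affine_curve p" using eventually_nhdsin_self[OF _ ev] x A by simp
  then obtain S where S: "(S, fst) \<in> affine_charts p" "(\<alpha> x, \<beta> x) \<in> S"
    using nz by (metis affine_chart_fst snd_conv)
  show ?thesis
    by (rule map_order_into_curve[OF \<iota> A x S local_order_imp_holo[OF o] b ev]) (simp add: o)
qed

lemma map_order_into_curve_snd:
  assumes \<iota>: "curve_piece f \<iota> p" and A: "holomorphic_atlas A" and x: "x \<in> rs_points A"
    and nz: "poly (pderiv p) (\<alpha> x) \<noteq> 0" and a: "local_holo A \<alpha> x"
    and ev: "\<forall>\<^sub>F y in near A x. F y = \<iota> (\<alpha> y, \<beta> y) \<and> (\<alpha> y, \<beta> y) \<in> affine_curve p"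
    and o: "local_order A \<beta> x k"
  shows "map_order A (projective_curve f) F x k"
proof -
  have "(\<alpha> x, \<beta> x) \<in> affine_curve p" using eventually_nhdsin_self[OF _ ev] x A by simp
  then obtain S where S: "(S, snd) \<in> affine_charts p" "(\<alpha> x, \<beta> x) \<in> S"
    using nz by (metis affine_chart_snd fst_conv)
  show ?thesis
    by (rule map_order_into_curve[OF \<iota> A x S a local_order_imp_holo[OF o] ev]) (simp add: o)
qed

lemma map_holo_into_curve:
  assumes \<iota>: "curve_piece f \<iota> p" and f: "rsquarefree f"
    and A: "holomorphic_atlas A" and x: "x \<in> rs_points A"
    and ab: "local_holo A \<alpha> x" "local_holo A \<beta> x"
    and ev: "\<forall>\<^sub>F y in near A x. F y = \<iota> (\<alpha> y, \<beta> y) \<and> (\<alpha> y, \<beta> y) \<in> affine_curve p"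
  shows "map_holo A (projective_curve f) F x"
proof -
  have "(\<alpha> x, \<beta> x) \<in> affine_curve p" using eventually_nhdsin_self[OF _ ev] x A by simp
  then obtain S \<phi> where c: "(S, \<phi>) \<in> affine_charts p" "(\<alpha> x, \<beta> x) \<in> S"
    using piece_chart[OF \<iota> _ f] by metis
  note m = map_into_curve[OF \<iota> A x c ab ev]
  have "local_holo A (\<lambda>y. \<phi> (\<alpha> y, \<beta> y)) x"
    using c(1) by (cases rule: affine_chart_cases) (use ab in simp_all)
  from local_holo_cong[OF A m(3) this] show ?thesis
    unfolding map_holo_def using projective_curve_chart[OF \<iota> c(1)] m(1,2)
    by (intro exI[of _ "\<iota> ` S"] exI[of _ "\<phi> \<circ> inv \<iota>"]) simp
qed

lemma compact_riemann_surface_projective_curve: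
  assumes f: "rsquarefree f" and deg: "degree f \<ge> 2"
  shows "compact_riemann_surface (projective_curve f)"
proof -
  let ?n = "half_degree f"
  note A = holomorphic_atlas_projective_curve[of f]
  note 0 = curve_piece_affine[of f] and 1 = curve_piece_infinite[of f]
  \<comment> \<open>At least two distinct roots cannot all be 0. A nonzero root a makes 1 / a a root
    of \<open>poly_at_infinity f\<close>, which is therefore nonconstant, so that the second piece
    is connected too; moreover (a, 0) lies in the overlap.\<close>
  have "\<not> {z. poly f z = 0} \<subseteq> {0}"
    using card_roots_rsquarefree[OF f] deg card_mono[of "{0}" "{z. poly f z = 0}"] by auto
  then obtain a where a: "poly f a = 0" "a \<noteq> 0" by auto
  have "degree (poly_at_infinity f) \<noteq> 0"
  proof
    assume "degree (poly_at_infinity f) = 0"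
    then obtain c where "poly_at_infinity f = [:c:]" by (rule degree_eq_zeroE)
    moreover have "poly (poly_at_infinity f) (1 / a) = 0" using a by (simp add: poly_at_infinity_nz)
    ultimately have "poly_at_infinity f = 0" by simp
    then show False using rsquarefree_nonzero[OF poly_at_infinity_rsquarefree[OF f]] by blast
  qed
  then have conn: "connected (affine_curve f)" "connected (affine_curve (poly_at_infinity f))"
    using deg by (auto intro: affine_curve_connected)
  have a0: "(a, 0) \<in> affine_curve f" using a by (simp add: affine_curve_iff)
  have cover: "topspace (rs_topology (projective_curve f)) =
      affine_incl ` affine_curve f \<union> infinite_incl ?n ` affine_curve (poly_at_infinity f)"
    using A rs_points_projective_curve[OF f] by simp
  have ov1: "fst u * fst v = 1" if "affine_incl u = infinite_incl ?n v" for u v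
    using that by (auto simp: affine_eq_infinite_incl flip_piece_def)
  have ov2: "affine_incl u \<in> infinite_incl ?n ` affine_curve (poly_at_infinity f)"
    if "u \<in> affine_curve f" "fst u \<noteq> 0" for u
    using affine_eq_infinite_incl(1)[of u ?n "flip_piece ?n u"] flip_piece_curve(1)[of u f] that by blast
  have ov3: "infinite_incl ?n u \<in> affine_incl ` affine_curve f"
    if "u \<in> affine_curve (poly_at_infinity f)" "fst u \<noteq> 0" for u
    using affine_eq_infinite_incl(2)[of ?n u "flip_piece ?n u"] flip_piece_curve(2)[of u f] that by blast
  have ne: "\<exists>u\<in>affine_curve f. fst u \<noteq> 0" using a a0 by force
  note glue = glued_space[OF piece_continuous[OF 0 f] piece_continuous[OF 1 f]
      piece_openin[OF 0 f] piece_openin[OF 1 f] inj_on_subset[OF inj_affine_incl subset_UNIV]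
      inj_on_subset[OF inj_infinite_incl subset_UNIV] cover continuous_on_fst[OF continuous_on_id]
      continuous_on_fst[OF continuous_on_id] affine_curve_compact affine_curve_compact conn
      ov1 ov2 ov3 ne]
  show ?thesis
    unfolding compact_riemann_surface_def
    using A glue curve_piece_points[OF f 0 a0] by blast
qed

section \<open>Holomorphic forms on the projective curve\<close>

text \<open>The coefficient of the differential dF in the chart c, as a function of the point
  instead of the coordinate.\<close>

definition cderiv :: "'a chart \<Rightarrow> ('a \<Rightarrow> complex) \<Rightarrow> 'a \<Rightarrow> complex" where
  "cderiv c F P = deriv (\<lambda>w. F (inv_into (fst c) (snd c) w)) (snd c P)"

lemma cderiv_transition:
  assumes "holomorphic_atlas A" "(U, \<phi>) \<in> A" "(W, \<psi>) \<in> A" "P \<in> U" "P \<in> W" "local_holo A F P"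
  shows "cderiv (U, \<phi>) F P = cderiv (W, \<psi>) F P * cderiv (U, \<phi>) \<psi> P"
  unfolding cderiv_def using deriv_transition[OF assms] by simp

lemma cderiv_self:
  assumes "holomorphic_atlas A" "(U, \<phi>) \<in> A" "P \<in> U"
  shows "cderiv (U, \<phi>) \<phi> P = 1"
  unfolding cderiv_def using deriv_self_chart[OF assms] by simp

lemma cderiv_analytic:
  assumes A: "holomorphic_atlas A" and c: "(U, \<phi>) \<in> A" and P: "P \<in> U" and F: "local_holo A F P"
  shows "(\<lambda>z. cderiv (U, \<phi>) F (inv_into U \<phi> z)) analytic_on {\<phi> P}"
proof -
  have "(\<lambda>w. F (inv_into U \<phi> w)) analytic_on {\<phi> P}" using F by (simp only: local_holo_chart[OF A c P])
  then have an: "deriv (\<lambda>w. F (inv_into U \<phi> w)) analytic_on {\<phi> P}" by (rule analytic_deriv)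
  have "\<forall>\<^sub>F z in nhds (\<phi> P). deriv (\<lambda>w. F (inv_into U \<phi> w)) z = cderiv (U, \<phi>) F (inv_into U \<phi> z)"
    using eventually_in_chart[OF A c P] by eventually_elim (simp add: cderiv_def f_inv_into_f)
  from analytic_at_cong[OF this refl] an show ?thesis by blast
qed

abbreviation piece_x :: "(complex \<times> complex \<Rightarrow> curve_point) \<Rightarrow> curve_point \<Rightarrow> complex" where
  "piece_x \<iota> P \<equiv> fst (inv \<iota> P)"

abbreviation piece_y :: "(complex \<times> complex \<Rightarrow> curve_point) \<Rightarrow> curve_point \<Rightarrow> complex" where
  "piece_y \<iota> P \<equiv> snd (inv \<iota> P)"

context
  fixes f :: "complex poly"
  assumes f: "rsquarefree f"
begin

text \<open>The equation Y^2 = p(X), differentiated in a chart.\<close>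

lemma cderiv_curve_equation:
  assumes \<iota>: "curve_piece f \<iota> p" and u: "u \<in> affine_curve p"
    and c: "(U, \<phi>) \<in> projective_curve f" "\<iota> u \<in> U"
  shows "poly (pderiv p) (fst u) * cderiv (U, \<phi>) (piece_x \<iota>) (\<iota> u) =
    2 * snd u * cderiv (U, \<phi>) (piece_y \<iota>) (\<iota> u)"
proof -
  note A = holomorphic_atlas_projective_curve[of f]
  let ?x = "\<lambda>z. piece_x \<iota> (inv_into U \<phi> z)" and ?y = "\<lambda>z. piece_y \<iota> (inv_into U \<phi> z)"
  let ?z = "\<phi> (\<iota> u)"
  have inv: "inv \<iota> (inv_into U \<phi> ?z) = u"
    using curve_piece_inj[OF \<iota>] chart_inj[OF A c(1)] c(2) by simp
  have "?x analytic_on {?z}" "?y analytic_on {?z}"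
    using piece_coordinates_holo[OF \<iota> u f] by (simp_all only: local_holo_chart[OF A c])
  then have d: "(?x has_field_derivative deriv ?x ?z) (at ?z)" "(?y has_field_derivative deriv ?y ?z) (at ?z)"
    by (auto simp: DERIV_deriv_iff_field_differentiable analytic_on_imp_differentiable_at)
  have "\<forall>\<^sub>F z in nhds ?z. inv_into U \<phi> z \<in> \<iota> ` affine_curve p"
    using piece_eventually[OF \<iota> f u] by (simp only: eventually_rs[OF A c])
  then have ev: "\<forall>\<^sub>F z in nhds ?z. (?y z)\<^sup>2 = poly p (?x z)"
    by eventually_elim (use curve_piece_inj[OF \<iota>] in \<open>auto simp: affine_curve_iff\<close>)
  have "((\<lambda>z. poly p (?x z)) has_field_derivative poly (pderiv p) (fst u) * deriv ?x ?z) (at ?z)"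
    using DERIV_chain2[OF poly_DERIV d(1)] inv by simp
  moreover have "((\<lambda>z. (?y z)\<^sup>2) has_field_derivative 2 * snd u * deriv ?y ?z) (at ?z)"
    using DERIV_power[OF d(2), of 2] inv by (simp add: mult_ac)
  ultimately have "poly (pderiv p) (fst u) * deriv ?x ?z = 2 * snd u * deriv ?y ?z"
    using DERIV_cong_ev[OF refl ev refl] DERIV_unique by blast
  then show ?thesis by (simp add: cderiv_def)
qed

text \<open>The form \<open>m(X) dX / Y\<close>, which is \<open>2 m(X) dY / p'(X)\<close> because of \<open>2 Y dY = p'(X) dX\<close>.\<close>

definition piece_form :: "(complex \<times> complex \<Rightarrow> curve_point) \<Rightarrow> complex poly \<Rightarrow> (complex \<Rightarrow> complex) \<Rightarrow>
    curve_point chart \<Rightarrow> curve_point \<Rightarrow> complex" where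
  "piece_form \<iota> p m c P =
     (if piece_y \<iota> P \<noteq> 0 then m (piece_x \<iota> P) / piece_y \<iota> P * cderiv c (piece_x \<iota>) P
      else 2 * m (piece_x \<iota> P) / poly (pderiv p) (piece_x \<iota> P) * cderiv c (piece_y \<iota>) P)"

text \<open>Extends the second formula from Y = 0 to points where the definition uses the first one,
  so that a single expression is available around a branch point.\<close>

lemma piece_form_y:
  assumes \<iota>: "curve_piece f \<iota> p" and u: "u \<in> affine_curve p" "poly (pderiv p) (fst u) \<noteq> 0"
    and c: "(U, \<phi>) \<in> projective_curve f" "\<iota> u \<in> U"
  shows "piece_form \<iota> p m (U, \<phi>) (\<iota> u) =
    2 * m (fst u) / poly (pderiv p) (fst u) * cderiv (U, \<phi>) (piece_y \<iota>) (\<iota> u)"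
  using cderiv_curve_equation[OF \<iota> u(1) c] u(2) curve_piece_inj[OF \<iota>]
  by (auto simp: piece_form_def field_simps)

lemma piece_form_transition:
  assumes \<iota>: "curve_piece f \<iota> p" and u: "u \<in> affine_curve p"
    and c: "(U, \<phi>) \<in> projective_curve f" "\<iota> u \<in> U"
    and d: "(W, \<psi>) \<in> projective_curve f" "\<iota> u \<in> W"
  shows "piece_form \<iota> p m (U, \<phi>) (\<iota> u) =
    piece_form \<iota> p m (W, \<psi>) (\<iota> u) * cderiv (U, \<phi>) \<psi> (\<iota> u)"
  unfolding piece_form_def
  using cderiv_transition[OF holomorphic_atlas_projective_curve c(1) d(1) c(2) d(2)]
    piece_coordinates_holo[OF \<iota> u f] by simp

text \<open>The expression with denominator Y works near points with Y \<noteq> 0, and the one with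
  the derivative of p as denominator near Y = 0, where simple roots keep that derivative
  nonzero.\<close>

lemma piece_form_analytic:
  assumes \<iota>: "curve_piece f \<iota> p" and u: "u \<in> affine_curve p"
    and c: "(U, \<phi>) \<in> projective_curve f" "\<iota> u \<in> U" and m: "\<And>a. m analytic_on {a}"
  shows "(\<lambda>z. piece_form \<iota> p m (U, \<phi>) (inv_into U \<phi> z)) analytic_on {\<phi> (\<iota> u)}"
proof -
  note A = holomorphic_atlas_projective_curve[of f]
  let ?z = "\<phi> (\<iota> u)"
  have inv: "inv \<iota> (inv_into U \<phi> ?z) = u"
    using curve_piece_inj[OF \<iota>] chart_inj[OF A c(1)] c(2) by simp
  note hx = piece_coordinates_holo(1)[OF \<iota> u f] and hy = piece_coordinates_holo(2)[OF \<iota> u f]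
  have x: "(\<lambda>z. piece_x \<iota> (inv_into U \<phi> z)) analytic_on {?z}"
    using hx by (simp only: local_holo_chart[OF A c])
  have y: "(\<lambda>z. piece_y \<iota> (inv_into U \<phi> z)) analytic_on {?z}"
    using hy by (simp only: local_holo_chart[OF A c])
  have "(m \<circ> (\<lambda>z. piece_x \<iota> (inv_into U \<phi> z))) analytic_on {?z}"
    by (intro analytic_on_compose x) (use m in simp)
  then have mx: "(\<lambda>z. m (piece_x \<iota> (inv_into U \<phi> z))) analytic_on {?z}" by (simp add: o_def)
  note dx = cderiv_analytic[OF A c hx] and dy = cderiv_analytic[OF A c hy]
  have evp: "\<forall>\<^sub>F z in nhds ?z. inv_into U \<phi> z \<in> U \<inter> \<iota> ` affine_curve p"
  proof -
    have "\<forall>\<^sub>F z in nhds ?z. inv_into U \<phi> z \<in> \<iota> ` affine_curve p"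
      using piece_eventually[OF \<iota> f u] by (simp only: eventually_rs[OF A c])
    with eventually_in_chart[OF A c] show ?thesis by eventually_elim (auto intro: inv_into_into)
  qed
  show ?thesis
  proof (cases "snd u = 0")
    case False
    have "\<forall>\<^sub>F z in nhds ?z. piece_y \<iota> (inv_into U \<phi> z) \<noteq> 0"
      using eventually_compose_filterlim[OF t1_space_nhds[of _ 0] analytic_tendsto[OF y]] False inv by simp
    then have "\<forall>\<^sub>F z in nhds ?z. m (piece_x \<iota> (inv_into U \<phi> z)) / piece_y \<iota> (inv_into U \<phi> z) *
        cderiv (U, \<phi>) (piece_x \<iota>) (inv_into U \<phi> z) = piece_form \<iota> p m (U, \<phi>) (inv_into U \<phi> z)"
      by eventually_elim (simp add: piece_form_def)
    moreover have "(\<lambda>z. m (piece_x \<iota> (inv_into U \<phi> z)) / piece_y \<iota> (inv_into U \<phi> z) *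
        cderiv (U, \<phi>) (piece_x \<iota>) (inv_into U \<phi> z)) analytic_on {?z}"
      by (intro analytic_on_mult analytic_on_divide mx y dx) (use False inv in simp)
    ultimately show ?thesis by - (rule analytic_at_cong[OF _ refl, THEN iffD1], assumption+)
  next
    case True
    let ?d = "\<lambda>z. poly (pderiv p) (piece_x \<iota> (inv_into U \<phi> z))"
    have dz: "?d ?z \<noteq> 0"
      using True u curve_piece_rsquarefree[OF \<iota> f] inv by (auto simp: rsquarefree_roots affine_curve_iff)
    have da: "?d analytic_on {?z}" by (rule analytic_on_poly[OF x])
    have "\<forall>\<^sub>F z in nhds ?z. ?d z \<noteq> 0"
      using eventually_compose_filterlim[OF t1_space_nhds[OF dz] analytic_tendsto[OF da]] .
    with evp have "\<forall>\<^sub>F z in nhds ?z. 2 * m (piece_x \<iota> (inv_into U \<phi> z)) / ?d z *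
        cderiv (U, \<phi>) (piece_y \<iota>) (inv_into U \<phi> z) = piece_form \<iota> p m (U, \<phi>) (inv_into U \<phi> z)"
    proof eventually_elim
      case (elim z)
      then obtain v where v: "v \<in> affine_curve p" "inv_into U \<phi> z = \<iota> v" by auto
      then show ?case
        using piece_form_y[OF \<iota> v(1) _ c(1)] elim curve_piece_inj[OF \<iota>] by simp
    qed
    moreover have "(\<lambda>z. 2 * m (piece_x \<iota> (inv_into U \<phi> z)) / ?d z *
        cderiv (U, \<phi>) (piece_y \<iota>) (inv_into U \<phi> z)) analytic_on {?z}"
      by (intro analytic_on_mult analytic_on_divide analytic_on_const mx da dy) (use dz in simp)
    ultimately show ?thesis by - (rule analytic_at_cong[OF _ refl, THEN iffD1], assumption+)
  qed
qed

abbreviation "infinite_piece \<equiv> infinite_incl (half_degree f)"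

lemma overlap_eq:
  assumes "fst u \<noteq> 0"
  shows "affine_incl u = infinite_piece (flip_piece (half_degree f) u)"
  using assms by (simp add: affine_eq_infinite_incl)

text \<open>From U = 1 / X follows dU = - dX / X^2.\<close>

lemma cderiv_infinite_x:
  assumes u: "u \<in> affine_curve f" "fst u \<noteq> 0"
    and c: "(U, \<phi>) \<in> projective_curve f" "affine_incl u \<in> U"
  shows "cderiv (U, \<phi>) (piece_x infinite_piece) (affine_incl u) =
    - cderiv (U, \<phi>) (piece_x affine_incl) (affine_incl u) / (fst u)\<^sup>2"
proof -
  note A = holomorphic_atlas_projective_curve[of f] and \<iota> = curve_piece_affine[of f]
  let ?x = "\<lambda>z. piece_x affine_incl (inv_into U \<phi> z)" and ?z = "\<phi> (affine_incl u)"
  have inv: "inv affine_incl (inv_into U \<phi> ?z) = u"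
    using curve_piece_inj[OF \<iota>] chart_inj[OF A c(1)] c(2) by simp
  have x: "?x analytic_on {?z}"
    using piece_coordinates_holo(1)[OF \<iota> u(1) f] by (simp only: local_holo_chart[OF A c])
  then have d: "(?x has_field_derivative deriv ?x ?z) (at ?z)"
    by (auto simp: DERIV_deriv_iff_field_differentiable analytic_on_imp_differentiable_at)
  have "\<forall>\<^sub>F z in nhds ?z. inv_into U \<phi> z \<in> affine_incl ` affine_curve f"
    using piece_eventually[OF \<iota> f u(1)] by (simp only: eventually_rs[OF A c])
  moreover have "\<forall>\<^sub>F z in nhds ?z. ?x z \<noteq> 0"
    using eventually_compose_filterlim[OF t1_space_nhds[of _ 0] analytic_tendsto[OF x]] u(2) inv by simp
  ultimately have ev: "\<forall>\<^sub>F z in nhds ?z. piece_x infinite_piece (inv_into U \<phi> z) = 1 / ?x z"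
  proof eventually_elim
    case (elim z)
    then obtain v where v: "inv_into U \<phi> z = affine_incl v" by blast
    then have "fst v \<noteq> 0" using elim(2) inj_affine_incl by simp
    from overlap_eq[OF this] v show ?case
      using inj_affine_incl inj_infinite_incl by (metis flip_piece_def fst_conv inv_f_f)
  qed
  have "((\<lambda>z. 1 / ?x z) has_field_derivative (- deriv ?x ?z / (fst u)\<^sup>2)) (at ?z)"
    using d u(2) inv by (auto intro!: derivative_eq_intros simp: power2_eq_square)
  then show ?thesis
    unfolding cderiv_def using deriv_cong_ev[OF ev refl] by (simp add: DERIV_imp_deriv)
qed

text \<open>The form X^i dX / Y. Inserting X = 1 / U and Y = V / U^n turns it into - U^(n - 2 - i)
  dU / V, which explains the sign and the exponent at infinity.\<close>

definition basis_form :: "nat \<Rightarrow> curve_point chart \<Rightarrow> complex \<Rightarrow> complex" where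
  "basis_form i c z =
     (if c \<in> projective_curve f \<and> z \<in> snd c ` fst c then
        (case inv_into (fst c) (snd c) z of
           Affine X Y \<Rightarrow> piece_form affine_incl f (\<lambda>X. X ^ i) c (Affine X Y)
         | Infinite V \<Rightarrow> piece_form infinite_piece (poly_at_infinity f)
             (\<lambda>U. - (U ^ (half_degree f - 2 - i))) c (Infinite V))
      else 0)"

text \<open>The bound on i keeps the natural subtraction n - 2 - i from being cut off at 0; here
  regularity at infinity limits the exponent.\<close>

lemma piece_form_overlap:
  assumes u: "u \<in> affine_curve f" "fst u \<noteq> 0" "snd u \<noteq> 0"
    and c: "(U, \<phi>) \<in> projective_curve f" "affine_incl u \<in> U" and i: "i + 2 \<le> half_degree f"
  shows "piece_form infinite_piece (poly_at_infinity f) (\<lambda>U. - (U ^ (half_degree f - 2 - i))) (U, \<phi>) (affine_incl u)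
    = piece_form affine_incl f (\<lambda>X. X ^ i) (U, \<phi>) (affine_incl u)"
proof -
  have inv: "inv infinite_piece (affine_incl u) = flip_piece (half_degree f) u"
    unfolding overlap_eq[OF u(2)] by (rule inv_f_f[OF inj_infinite_incl])
  have "half_degree f = (half_degree f - 2 - i) + i + 2" using i by simp
  then have "fst u ^ half_degree f = fst u ^ (half_degree f - 2 - i) * fst u ^ i * (fst u)\<^sup>2"
    by (metis power_add)
  then show ?thesis
    using u inj_affine_incl
    by (simp add: piece_form_def inv cderiv_infinite_x[OF u(1,2) c] flip_piece_def power_divide field_simps)
qed

lemma point_cases:
  assumes "P \<in> rs_points (projective_curve f)"
  obtains X Y where "P = Affine X Y" "(X, Y) \<in> affine_curve f" "P = affine_incl (X, Y)"
  | V where "P = Infinite V" "(0, V) \<in> affine_curve (poly_at_infinity f)" "P = infinite_piece (0, V)"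
proof (cases P)
  case (Affine X Y)
  then show ?thesis using that(1) assms Affine_in_projective_curve[OF f]
    by (auto simp: affine_curve_iff affine_incl_def)
next
  case (Infinite V)
  then show ?thesis using that(2) assms Infinite_in_projective_curve[OF f]
    by (auto simp: affine_curve_iff infinite_incl_def)
qed

lemma basis_form_holomorphic_form:
  assumes i: "i + 2 \<le> half_degree f"
  shows "basis_form i \<in> holomorphic_forms (projective_curve f)"
proof -
  note A = holomorphic_atlas_projective_curve[of f]
  note 0 = curve_piece_affine[of f] and 1 = curve_piece_infinite[of f]
  let ?m = "\<lambda>U :: complex. - (U ^ (half_degree f - 2 - i))"
  have m0: "(\<lambda>X :: complex. X ^ i) analytic_on {a}" for a by (intro analytic_intros)
  have m1: "?m analytic_on {a}" for a by (intro analytic_intros)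
  have val: "basis_form i (U, \<phi>) (\<phi> P) = (case P of
           Affine X Y \<Rightarrow> piece_form affine_incl f (\<lambda>X. X ^ i) (U, \<phi>) P
         | Infinite V \<Rightarrow> piece_form infinite_piece (poly_at_infinity f) ?m (U, \<phi>) P)"
    if "(U, \<phi>) \<in> projective_curve f" "P \<in> U" for U \<phi> P
    using that chart_inj[OF A that(1)] by (auto simp: basis_form_def split: curve_point.split)
  have hol: "basis_form i (U, \<phi>) holomorphic_on \<phi> ` U" if c: "(U, \<phi>) \<in> projective_curve f" for U \<phi>
  proof -
    have "basis_form i (U, \<phi>) analytic_on \<phi> ` U"
    proof (subst analytic_on_analytic_at, clarify)
      fix P assume P: "P \<in> U"
      then have "P \<in> rs_points (projective_curve f)" using chart_subset_points[OF c] by blast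
      then show "basis_form i (U, \<phi>) analytic_on {\<phi> P}"
      proof (cases rule: point_cases)
        case (1 X Y)
        have "\<forall>\<^sub>F z in nhds (\<phi> P). inv_into U \<phi> z \<in> affine_incl ` affine_curve f"
          using piece_eventually[OF 0 f 1(2)] unfolding 1(3) [symmetric] by (simp only: eventually_rs[OF A c P])
        with eventually_in_chart[OF A c P]
        have "\<forall>\<^sub>F z in nhds (\<phi> P). piece_form affine_incl f (\<lambda>X. X ^ i) (U, \<phi>) (inv_into U \<phi> z) =
            basis_form i (U, \<phi>) z"
          by eventually_elim (use c in \<open>auto simp: basis_form_def affine_incl_def split: curve_point.split\<close>)
        from analytic_at_cong[OF this refl] show ?thesis
          using piece_form_analytic[OF 0 1(2) c _ m0] P unfolding 1(3) by blast
      next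
        case (2 V)
        let ?g = "poly_at_infinity f"
        have ev: "\<forall>\<^sub>F z in nhds (\<phi> P). inv_into U \<phi> z \<in> infinite_piece ` affine_curve ?g"
          using piece_eventually[OF 1 f 2(2)] unfolding 2(3) [symmetric] by (simp only: eventually_rs[OF A c P])
        \<comment> \<open>Leaving out the nonzero roots of \<open>?g\<close> gives V \<noteq> 0 at
          all nearby points with U \<noteq> 0, as the comparison of the two expressions on the
          overlap requires.\<close>
        have fin: "finite ({a. poly ?g a = 0} - {0})"
          using rsquarefree_nonzero[OF poly_at_infinity_rsquarefree[OF f]] by (intro finite_Diff poly_roots_finite)
        have holx: "local_holo (projective_curve f) (piece_x infinite_piece) P"
          using piece_coordinates_holo(1)[OF 1 2(2) f] unfolding 2(3) .
        have "piece_x infinite_piece P = 0" unfolding 2(3) by (simp add: inj_infinite_incl)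
        then have "\<forall>\<^sub>F a in nhds (piece_x infinite_piece P). a \<in> - ({a. poly ?g a = 0} - {0})"
          by (intro eventually_nhds_in_open[OF open_Compl[OF finite_imp_closed[OF fin]]]) simp
        from eventually_compose_filterlim[OF this local_holo_continuous[OF A holx]]
        have ev2: "\<forall>\<^sub>F z in nhds (\<phi> P). piece_x infinite_piece (inv_into U \<phi> z) \<in> - ({a. poly ?g a = 0} - {0})"
          by (simp only: eventually_rs[OF A c P])
        from ev ev2 eventually_in_chart[OF A c P]
        have "\<forall>\<^sub>F z in nhds (\<phi> P). piece_form infinite_piece ?g ?m (U, \<phi>) (inv_into U \<phi> z) =
            basis_form i (U, \<phi>) z"
        proof eventually_elim
          case (elim z)
          then obtain v where v: "v \<in> affine_curve ?g" "inv_into U \<phi> z = infinite_piece v" by blast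
          have inU: "inv_into U \<phi> z \<in> U" using elim(3) by (rule inv_into_into)
          show ?case
          proof (cases "fst v = 0")
            case True
            then have "inv_into U \<phi> z = Infinite (snd v)"
              unfolding v(2) by (cases v) (simp add: infinite_incl_def)
            then show ?thesis using c elim(3) by (simp add: basis_form_def)
          next
            case False
            \<comment> \<open>A nearby point with U \<noteq> 0 is an \<open>Affine\<close> point,
              where \<open>basis_form\<close> evaluates the affine expression; u are its coordinates
              there.\<close>
            define u where "u = flip_piece (half_degree f) v"
            have u: "infinite_piece v = affine_incl u" "fst u \<noteq> 0" "u \<in> affine_curve f"
              using False v(1) flip_piece_curve(2)[OF False v(1)] affine_eq_infinite_incl(2)[of _ v u]
              by (auto simp: u_def flip_piece_def)
            have "poly ?g (fst v) \<noteq> 0"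
              using elim(2) False inj_infinite_incl unfolding v(2) by simp
            then have "snd v \<noteq> 0" using v(1) by (auto simp: affine_curve_iff)
            then have "snd u \<noteq> 0" using False by (simp add: u_def flip_piece_def)
            from piece_form_overlap[OF u(3,2) this c _ i] inU
            have "piece_form infinite_piece ?g ?m (U, \<phi>) (inv_into U \<phi> z) =
                piece_form affine_incl f (\<lambda>X. X ^ i) (U, \<phi>) (inv_into U \<phi> z)"
              unfolding v(2) u(1) by blast
            then show ?thesis using c elim(3) unfolding basis_form_def v(2) u(1)
              by (simp add: affine_incl_def v(2) u(1) split: prod.split)
          qed
        qed
        from analytic_at_cong[OF this refl] show ?thesis
          using piece_form_analytic[OF 1 2(2) c _ m1] P unfolding 2(3) by blast
      qed
    qed
    then show ?thesis by (rule analytic_imp_holomorphic)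
  qed
  have trans: "basis_form i (U, \<phi>) (\<phi> P) = basis_form i (W, \<psi>) (\<psi> P) * deriv (\<psi> \<circ> inv_into U \<phi>) (\<phi> P)"
    if c: "(U, \<phi>) \<in> projective_curve f" and d: "(W, \<psi>) \<in> projective_curve f" and P: "P \<in> U" "P \<in> W"
    for U \<phi> W \<psi> P
  proof -
    have "P \<in> rs_points (projective_curve f)" using chart_subset_points[OF c] P by blast
    then have "basis_form i (U, \<phi>) (\<phi> P) = basis_form i (W, \<psi>) (\<psi> P) * cderiv (U, \<phi>) \<psi> P"
    proof (cases rule: point_cases)
      case (1 X Y)
      show ?thesis
        using piece_form_transition[OF 0 1(2) c _ d, folded 1(3), OF P]
        unfolding val[OF c P(1)] val[OF d P(2)] by (simp add: 1(1))
    next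
      case (2 V)
      show ?thesis
        using piece_form_transition[OF 1 2(2) c _ d, folded 2(3), OF P]
        unfolding val[OF c P(1)] val[OF d P(2)] by (simp add: 2(1))
    qed
    then show ?thesis by (simp add: cderiv_def o_def)
  qed
  have zero: "basis_form i (U, \<phi>) z = 0" if "(U, \<phi>) \<notin> projective_curve f \<or> z \<notin> \<phi> ` U" for U \<phi> z
    using that by (auto simp: basis_form_def)
  show ?thesis
    unfolding holomorphic_forms_def using hol trans zero by blast
qed

end

section \<open>The quotient of a form by dX / Y, and the genus\<close>

lemma holomorphic_forms_combination:
  assumes "\<And>i. i < g \<Longrightarrow> b i \<in> holomorphic_forms A"
  shows "(\<lambda>u z. \<Sum>i<g. c i * b i u z) \<in> holomorphic_forms A"
  unfolding holomorphic_forms_def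
proof (intro CollectI conjI allI impI ballI, safe)
  have b: "(U, \<phi>) \<notin> A \<or> z \<notin> \<phi> ` U \<Longrightarrow> b i (U, \<phi>) z = 0"
    "(U, \<phi>) \<in> A \<Longrightarrow> b i (U, \<phi>) holomorphic_on \<phi> ` U"
    "(U, \<phi>) \<in> A \<Longrightarrow> (W, \<psi>) \<in> A \<Longrightarrow> p \<in> U \<Longrightarrow> p \<in> W \<Longrightarrow>
      b i (U, \<phi>) (\<phi> p) = b i (W, \<psi>) (\<psi> p) * deriv (\<psi> \<circ> inv_into U \<phi>) (\<phi> p)"
    if "i < g" for i U \<phi> W \<psi> z p
    using assms[OF that] unfolding holomorphic_forms_def by blast+
  fix U \<phi>
  show "(\<Sum>i<g. c i * b i (U, \<phi>) z) = 0" if "(U, \<phi>) \<notin> A" for z using b(1) that by simp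
  show "(\<Sum>i<g. c i * b i (U, \<phi>) z) = 0" if "z \<notin> \<phi> ` U" for z using b(1) that by simp
  assume c: "(U, \<phi>) \<in> A"
  show "(\<lambda>z. \<Sum>i<g. c i * b i (U, \<phi>) z) holomorphic_on \<phi> ` U"
    by (intro holomorphic_intros b(2) c) auto
  fix W \<psi> p assume d: "(W, \<psi>) \<in> A" "p \<in> U" "p \<in> W"
  show "(\<Sum>i<g. c i * b i (U, \<phi>) (\<phi> p)) =
      (\<Sum>i<g. c i * b i (W, \<psi>) (\<psi> p)) * deriv (\<psi> \<circ> inv_into U \<phi>) (\<phi> p)"
    unfolding sum_distrib_right by (rule sum.cong) (use b(3)[OF _ c d] in auto)
qed

text \<open>The function h for which the form is h dX / Y. In a chart by X it is the coefficient
  times Y; at Y = 0, where dX / Y is 2 dY over the derivative of p, a chart by Y is used instead.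
  Independence of the chosen chart is the content of \<open>form_quotient_x\<close> and
  \<open>form_quotient_y\<close>.\<close>

definition form_quotient :: "(curve_point chart \<Rightarrow> complex \<Rightarrow> complex) \<Rightarrow>
    (complex \<times> complex \<Rightarrow> curve_point) \<Rightarrow> complex poly \<Rightarrow> complex \<times> complex \<Rightarrow> complex" where
  "form_quotient \<omega> \<iota> p u =
     (if snd u \<noteq> 0 then
        \<omega> (\<iota> ` (SOME S. (S, fst) \<in> affine_charts p \<and> u \<in> S), fst \<circ> inv \<iota>) (fst u) * snd u
      else
        \<omega> (\<iota> ` (SOME S. (S, snd) \<in> affine_charts p \<and> u \<in> S), snd \<circ> inv \<iota>) (snd u) *
          poly (pderiv p) (fst u) / 2)"

lemma holomorphic_forms_transition:
  assumes "\<omega> \<in> holomorphic_forms A" "(U, \<phi>) \<in> A" "(W, \<psi>) \<in> A" "P \<in> U" "P \<in> W"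
  shows "\<omega> (U, \<phi>) (\<phi> P) = \<omega> (W, \<psi>) (\<psi> P) * cderiv (U, \<phi>) \<psi> P"
proof -
  have "\<omega> (U, \<phi>) (\<phi> P) = \<omega> (W, \<psi>) (\<psi> P) * deriv (\<psi> \<circ> inv_into U \<phi>) (\<phi> P)"
    using assms unfolding holomorphic_forms_def by blast
  then show ?thesis by (simp add: cderiv_def o_def)
qed

lemma holomorphic_forms_holomorphic:
  "\<omega> \<in> holomorphic_forms A \<Longrightarrow> (U, \<phi>) \<in> A \<Longrightarrow> \<omega> (U, \<phi>) holomorphic_on \<phi> ` U"
  unfolding holomorphic_forms_def by blast

lemma holomorphic_forms_outside:
  "\<omega> \<in> holomorphic_forms A \<Longrightarrow> (U, \<phi>) \<notin> A \<or> z \<notin> \<phi> ` U \<Longrightarrow> \<omega> (U, \<phi>) z = 0"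
  unfolding holomorphic_forms_def by blast

lemma continuous_on_local:
  fixes h :: "complex \<times> complex \<Rightarrow> complex"
  assumes "\<And>u. u \<in> C \<Longrightarrow> \<exists>S. openin (top_of_set C) S \<and> u \<in> S \<and> continuous_on S h"
  shows "continuous_on C h"
  unfolding continuous_on_eq_continuous_within
proof
  fix u assume "u \<in> C"
  then obtain S where S: "openin (top_of_set C) S" "u \<in> S" "continuous_on S h" using assms by blast
  obtain T where T: "open T" "S = C \<inter> T" using S(1) openin_open by metis
  have "at u within C = at u within S"
    by (rule at_within_nhd[OF _ T(1)]) (use S T in auto)
  then show "continuous (at u within C) h"
    using S by (simp add: continuous_on_eq_continuous_within)
qed

lemma continuous_eq_off_finite:
  fixes g h :: "complex \<Rightarrow> complex"
  assumes S: "open S" and K: "finite K" and gh: "continuous_on S g" "continuous_on S h"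
    and eq: "\<And>z. z \<in> S - K \<Longrightarrow> g z = h z" and z: "z \<in> S"
  shows "g z = h z"
proof -
  have "\<forall>\<^sub>F w in at z. w \<in> S - (K - {z}) - {z}"
    using S K z by (intro eventually_at_in_open open_Diff finite_imp_closed) auto
  then have ev: "\<forall>\<^sub>F w in at z. g w = h w" by eventually_elim (use eq in auto)
  have "(g \<longlongrightarrow> g z) (at z)" "(h \<longlongrightarrow> h z) (at z)"
    using gh S z by (auto simp: continuous_on_eq_continuous_at isCont_def)
  with tendsto_cong[OF ev] have "(h \<longlongrightarrow> g z) (at z)" by simp
  with \<open>(h \<longlongrightarrow> h z) (at z)\<close> show ?thesis using LIM_unique by blast
qed

context
  fixes f :: "complex poly" and \<omega> :: "curve_point chart \<Rightarrow> complex \<Rightarrow> complex"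
  assumes f: "rsquarefree f" and \<omega>: "\<omega> \<in> holomorphic_forms (projective_curve f)"
begin

text \<open>The transition rule of the form carries the defining relation from the chosen chart to
  an arbitrary one.\<close>

lemma form_quotient_x:
  assumes \<iota>: "curve_piece f \<iota> p" and u: "u \<in> affine_curve p" "snd u \<noteq> 0"
    and c: "(U, \<phi>) \<in> projective_curve f" "\<iota> u \<in> U"
  shows "form_quotient \<omega> \<iota> p u * cderiv (U, \<phi>) (piece_x \<iota>) (\<iota> u) = \<omega> (U, \<phi>) (\<phi> (\<iota> u)) * snd u"
proof -
  define S where "S = (SOME S. (S, fst) \<in> affine_charts p \<and> u \<in> S)"
  have "\<exists>S. (S, fst) \<in> affine_charts p \<and> u \<in> S" by (meson affine_chart_fst[OF u])
  from someI_ex[OF this] have S: "(S, fst) \<in> affine_charts p" "u \<in> S" by (auto simp: S_def)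
  have "\<omega> (U, \<phi>) (\<phi> (\<iota> u)) =
      \<omega> (\<iota> ` S, fst \<circ> inv \<iota>) ((fst \<circ> inv \<iota>) (\<iota> u)) * cderiv (U, \<phi>) (fst \<circ> inv \<iota>) (\<iota> u)"
    by (rule holomorphic_forms_transition[OF \<omega> c(1) projective_curve_chart[OF \<iota> S(1)] c(2)]) (use S in simp)
  then show ?thesis
    using u(2) curve_piece_inj[OF \<iota>] by (simp add: form_quotient_def S_def o_def)
qed

text \<open>For Y \<noteq> 0 this is the relation for dX, multiplied by Y and combined with the
  differentiated curve equation, before Y is cancelled again.\<close>

lemma form_quotient_y:
  assumes \<iota>: "curve_piece f \<iota> p" and u: "u \<in> affine_curve p" "poly (pderiv p) (fst u) \<noteq> 0"
    and c: "(U, \<phi>) \<in> projective_curve f" "\<iota> u \<in> U"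
  shows "2 * form_quotient \<omega> \<iota> p u * cderiv (U, \<phi>) (piece_y \<iota>) (\<iota> u) =
    \<omega> (U, \<phi>) (\<phi> (\<iota> u)) * poly (pderiv p) (fst u)"
proof (cases "snd u = 0")
  case True
  define S where "S = (SOME S. (S, snd) \<in> affine_charts p \<and> u \<in> S)"
  have "\<exists>S. (S, snd) \<in> affine_charts p \<and> u \<in> S" by (meson affine_chart_snd[OF u])
  from someI_ex[OF this] have S: "(S, snd) \<in> affine_charts p" "u \<in> S" by (auto simp: S_def)
  have "\<omega> (U, \<phi>) (\<phi> (\<iota> u)) =
      \<omega> (\<iota> ` S, snd \<circ> inv \<iota>) ((snd \<circ> inv \<iota>) (\<iota> u)) * cderiv (U, \<phi>) (snd \<circ> inv \<iota>) (\<iota> u)"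
    by (rule holomorphic_forms_transition[OF \<omega> c(1) projective_curve_chart[OF \<iota> S(1)] c(2)]) (use S in simp)
  then show ?thesis
    using True curve_piece_inj[OF \<iota>] by (simp add: form_quotient_def S_def o_def)
next
  case False
  have "snd u * (2 * form_quotient \<omega> \<iota> p u * cderiv (U, \<phi>) (piece_y \<iota>) (\<iota> u)) =
      form_quotient \<omega> \<iota> p u * (2 * snd u * cderiv (U, \<phi>) (piece_y \<iota>) (\<iota> u))" by (simp add: mult_ac)
  also have "\<dots> = poly (pderiv p) (fst u) *
      (form_quotient \<omega> \<iota> p u * cderiv (U, \<phi>) (piece_x \<iota>) (\<iota> u))"
    unfolding cderiv_curve_equation[OF f \<iota> u(1) c, symmetric] by (simp add: mult_ac)
  also have "\<dots> = snd u * (\<omega> (U, \<phi>) (\<phi> (\<iota> u)) * poly (pderiv p) (fst u))"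
    unfolding form_quotient_x[OF \<iota> u(1) False c] by (simp add: mult_ac)
  finally show ?thesis using False by (metis mult_cancel_left)
qed

lemma form_quotient_fst_chart:
  assumes \<iota>: "curve_piece f \<iota> p" and S: "(S, fst) \<in> affine_charts p" and u: "u \<in> S"
  shows "form_quotient \<omega> \<iota> p u = \<omega> (\<iota> ` S, fst \<circ> inv \<iota>) (fst u) * snd u"
proof -
  have "snd u \<noteq> 0" using S u by (cases rule: affine_chart_cases) (auto simp: fun_eq_iff)
  moreover have "cderiv (\<iota> ` S, fst \<circ> inv \<iota>) (piece_x \<iota>) (\<iota> u) = 1"
    using cderiv_self[OF holomorphic_atlas_projective_curve projective_curve_chart[OF \<iota> S]] u
    by (simp add: o_def)
  ultimately show ?thesis
    using form_quotient_x[OF \<iota> subsetD[OF affine_chart_subset[OF S] u] _ projective_curve_chart[OF \<iota> S]] u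
      curve_piece_inj[OF \<iota>] by (simp add: mult.commute)
qed

lemma form_quotient_snd_chart:
  assumes \<iota>: "curve_piece f \<iota> p" and S: "(S, snd) \<in> affine_charts p" and u: "u \<in> S"
  shows "form_quotient \<omega> \<iota> p u = \<omega> (\<iota> ` S, snd \<circ> inv \<iota>) (snd u) * poly (pderiv p) (fst u) / 2"
proof -
  have "poly (pderiv p) (fst u) \<noteq> 0"
    using S u by (cases rule: affine_chart_cases) (auto simp: fun_eq_iff)
  moreover have "cderiv (\<iota> ` S, snd \<circ> inv \<iota>) (piece_y \<iota>) (\<iota> u) = 1"
    using cderiv_self[OF holomorphic_atlas_projective_curve projective_curve_chart[OF \<iota> S]] u
    by (simp add: o_def)
  ultimately show ?thesis
    using form_quotient_y[OF \<iota> subsetD[OF affine_chart_subset[OF S] u] _ projective_curve_chart[OF \<iota> S]] u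
      curve_piece_inj[OF \<iota>] by (simp add: mult.commute)
qed

text \<open>On a whole chart domain h is the coefficient of the form at one coordinate, times an
  explicit function. Charts by Y serve only for continuity at points with Y = 0.\<close>

lemma form_quotient_holo:
  assumes \<iota>: "curve_piece f \<iota> p"
  shows "curve_holo p (form_quotient \<omega> \<iota> p)"
  unfolding curve_holo_def
proof (intro conjI allI impI)
  have im: "(\<phi> \<circ> inv \<iota>) ` \<iota> ` S = \<phi> ` S" for \<phi> :: "complex \<times> complex \<Rightarrow> complex" and S
    using curve_piece_inj[OF \<iota>] by (simp add: image_image)
  show "continuous_on (affine_curve p) (form_quotient \<omega> \<iota> p)"
  proof (rule continuous_on_local)
    fix u assume u: "u \<in> affine_curve p"
    show "\<exists>S. openin (top_of_set (affine_curve p)) S \<and> u \<in> S \<and> continuous_on S (form_quotient \<omega> \<iota> p)"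
    proof (cases "snd u = 0")
      case False
      obtain S where S: "(S, fst) \<in> affine_charts p" "u \<in> S" by (rule affine_chart_fst[OF u False])
      have "continuous_on (fst ` S) (\<omega> (\<iota> ` S, fst \<circ> inv \<iota>))"
        using holomorphic_forms_holomorphic[OF \<omega> projective_curve_chart[OF \<iota> S(1)]]
        unfolding im by (rule holomorphic_on_imp_continuous_on)
      then have "continuous_on S (\<lambda>u. \<omega> (\<iota> ` S, fst \<circ> inv \<iota>) (fst u))"
        by (rule continuous_on_compose2[of "fst ` S" _ S fst]) (auto intro: continuous_intros)
      then have "continuous_on S (\<lambda>u. \<omega> (\<iota> ` S, fst \<circ> inv \<iota>) (fst u) * snd u)"
        by (intro continuous_intros) simp_all
      then have "continuous_on S (form_quotient \<omega> \<iota> p)"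
        by (rule continuous_on_eq) (rule form_quotient_fst_chart[OF \<iota> S(1), symmetric])
      then show ?thesis using affine_chart_openin[OF S(1)] S(2) by blast
    next
      case True
      then have "poly (pderiv p) (fst u) \<noteq> 0"
        using u curve_piece_rsquarefree[OF \<iota> f] by (auto simp: rsquarefree_roots affine_curve_iff)
      then obtain S where S: "(S, snd) \<in> affine_charts p" "u \<in> S" by (meson affine_chart_snd[OF u])
      have "continuous_on (snd ` S) (\<omega> (\<iota> ` S, snd \<circ> inv \<iota>))"
        using holomorphic_forms_holomorphic[OF \<omega> projective_curve_chart[OF \<iota> S(1)]]
        unfolding im by (rule holomorphic_on_imp_continuous_on)
      then have "continuous_on S (\<lambda>u. \<omega> (\<iota> ` S, snd \<circ> inv \<iota>) (snd u))"
        by (rule continuous_on_compose2[of "snd ` S" _ S snd]) (auto intro: continuous_intros)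
      then have "continuous_on S (\<lambda>u. \<omega> (\<iota> ` S, snd \<circ> inv \<iota>) (snd u) * poly (pderiv p) (fst u) / 2)"
        by (intro continuous_intros) simp_all
      then have "continuous_on S (form_quotient \<omega> \<iota> p)"
        by (rule continuous_on_eq) (rule form_quotient_snd_chart[OF \<iota> S(1), symmetric])
      then show ?thesis using affine_chart_openin[OF S(1)] S(2) by blast
    qed
  qed
  fix s a assume "s analytic_on {a} \<and> s a \<noteq> 0 \<and> (\<forall>X. (s X)\<^sup>2 = poly p X)"
  then have s: "s analytic_on {a}" "s a \<noteq> 0" "\<And>X. (X, s X) \<in> affine_curve p"
    by (auto simp: affine_curve_iff)
  obtain S where S: "(S, fst) \<in> affine_charts p" "(a, s a) \<in> S"
    using affine_chart_fst[OF s(3)] s(2) by (metis snd_conv)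
  have "((\<lambda>X. (X, s X)) \<longlongrightarrow> (a, s a)) (nhds a)"
    by (intro tendsto_intros analytic_tendsto s filterlim_ident)
  then have "\<forall>\<^sub>F X in nhds a. (X, s X) \<in> S"
    by (intro eventually_in_openin_curve[OF affine_chart_openin[OF S(1)]]) (use S s in auto)
  then have ev: "\<forall>\<^sub>F X in nhds a. \<omega> (\<iota> ` S, fst \<circ> inv \<iota>) X * s X = form_quotient \<omega> \<iota> p (X, s X)"
    by eventually_elim (simp add: form_quotient_fst_chart[OF \<iota> S(1)])
  have "a \<in> fst ` S" using S(2) by force
  moreover have "\<omega> (\<iota> ` S, fst \<circ> inv \<iota>) holomorphic_on fst ` S"
    using holomorphic_forms_holomorphic[OF \<omega> projective_curve_chart[OF \<iota> S(1)]] unfolding im .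
  ultimately have "\<omega> (\<iota> ` S, fst \<circ> inv \<iota>) analytic_on {a}"
    using affine_chart_image_open[OF S(1)] by (auto simp: analytic_at)
  then have "(\<lambda>X. \<omega> (\<iota> ` S, fst \<circ> inv \<iota>) X * s X) analytic_on {a}" by (intro analytic_intros s)
  then show "(\<lambda>X. form_quotient \<omega> \<iota> p (X, s X)) analytic_on {a}"
    by - (rule analytic_at_cong[OF ev refl, THEN iffD1])
qed

text \<open>Since dU / V = - X^(n - 2) dX / Y, the quotients on the two pieces differ by this
  factor.\<close>

lemma form_quotient_flip:
  assumes u: "u \<in> affine_curve f" "fst u \<noteq> 0" "snd u \<noteq> 0" and n: "half_degree f \<ge> 2"
  shows "form_quotient \<omega> affine_incl f u = - (form_quotient \<omega> (infinite_incl (half_degree f)) (poly_at_infinity f)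
    (flip_piece (half_degree f) u) * fst u ^ (half_degree f - 2))"
proof -
  let ?n = "half_degree f" and ?v = "flip_piece (half_degree f) u"
  note A = holomorphic_atlas_projective_curve[of f]
  note 0 = curve_piece_affine[of f] and 1 = curve_piece_infinite[of f]
  obtain S where S: "(S, fst) \<in> affine_charts f" "u \<in> S" by (rule affine_chart_fst[OF u(1,3)])
  let ?U = "affine_incl ` S" and ?\<phi> = "fst \<circ> inv affine_incl"
  have c: "(?U, ?\<phi>) \<in> projective_curve f" "affine_incl u \<in> ?U"
    using projective_curve_chart[OF 0 S(1)] S(2) by auto
  have v: "?v \<in> affine_curve (poly_at_infinity f)" "snd ?v \<noteq> 0"
    using flip_piece_curve(1)[OF u(2,1)] u(2,3) by (auto simp: flip_piece_def)
  have eq: "affine_incl u = infinite_incl ?n ?v" using u(2) by (simp add: affine_eq_infinite_incl)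
  have "cderiv (?U, ?\<phi>) (piece_x affine_incl) (affine_incl u) = 1"
    using cderiv_self[OF A c] by (simp add: o_def)
  then have "cderiv (?U, ?\<phi>) (piece_x (infinite_incl ?n)) (affine_incl u) = - 1 / (fst u)\<^sup>2"
    using cderiv_infinite_x[OF f u(1,2) c] by simp
  moreover have "form_quotient \<omega> (infinite_incl ?n) (poly_at_infinity f) ?v *
      cderiv (?U, ?\<phi>) (piece_x (infinite_incl ?n)) (affine_incl u) =
      \<omega> (?U, ?\<phi>) (?\<phi> (affine_incl u)) * snd ?v"
    using form_quotient_x[OF 1 v c(1)] c(2) unfolding eq [symmetric] by simp
  moreover have "form_quotient \<omega> affine_incl f u = \<omega> (?U, ?\<phi>) (?\<phi> (affine_incl u)) * snd u"
    using form_quotient_fst_chart[OF 0 S] inj_affine_incl by simp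
  ultimately have *: "- (form_quotient \<omega> (infinite_incl ?n) (poly_at_infinity f) ?v / (fst u)\<^sup>2) =
      form_quotient \<omega> affine_incl f u / fst u ^ ?n"
    by (simp add: flip_piece_def)
  have "?n = (?n - 2) + 2" using n by simp
  then have "fst u ^ ?n = fst u ^ (?n - 2) * (fst u)\<^sup>2" by (metis power_add)
  with * show ?thesis using u(2) by (simp add: field_simps)
qed

text \<open>The quotient on the piece at infinity is bounded on the compact set |U| <= 1, and
  \<open>form_quotient_flip\<close> converts this bound into growth.\<close>

lemma form_quotient_growth:
  assumes n: "half_degree f \<ge> 2"
  obtains R M where "R \<ge> 1" "M \<ge> 0"
    "\<And>X Y. norm X \<ge> R \<Longrightarrow> Y\<^sup>2 = poly f X \<Longrightarrow>
      Y \<noteq> 0 \<and> norm (form_quotient \<omega> affine_incl f (X, Y)) \<le> M * norm X ^ (half_degree f - 2)"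
proof -
  let ?h = "form_quotient \<omega> (infinite_incl (half_degree f)) (poly_at_infinity f)"
  let ?K = "{u \<in> affine_curve (poly_at_infinity f). norm (fst u) \<le> 1}"
  have "continuous_on ?K ?h"
    by (rule continuous_on_subset[of "affine_curve (poly_at_infinity f)"])
      (use form_quotient_holo[OF curve_piece_infinite] in \<open>auto simp: curve_holo_def\<close>)
  then have "bounded (?h ` ?K)" by (intro compact_imp_bounded compact_continuous_image affine_curve_compact)
  then obtain M where M: "\<forall>u\<in>?K. norm (?h u) \<le> M" unfolding bounded_iff by blast
  \<comment> \<open>Beyond all roots of f the coordinate Y does not vanish.\<close>
  have "bounded {a. poly f a = 0}"
    using rsquarefree_nonzero[OF f] by (intro finite_imp_bounded poly_roots_finite)
  then obtain B where B: "\<And>a. poly f a = 0 \<Longrightarrow> norm a \<le> B" unfolding bounded_iff by blast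
  show thesis
  proof
    show "max 1 (B + 1) \<ge> 1" "max 0 M \<ge> 0" by simp_all
    fix X Y :: complex assume X: "max 1 (B + 1) \<le> norm X" and Y: "Y\<^sup>2 = poly f X"
    have X0: "X \<noteq> 0" using X by auto
    have "poly f X \<noteq> 0" using B[of X] X by auto
    then have Y0: "Y \<noteq> 0" using Y by auto
    have uc: "(X, Y) \<in> affine_curve f" using Y by (simp add: affine_curve_iff)
    have "norm (fst (flip_piece (half_degree f) (X, Y))) \<le> 1"
      using X X0 by (simp add: flip_piece_def norm_divide)
    then have "flip_piece (half_degree f) (X, Y) \<in> ?K"
      using flip_piece_curve(1)[of "(X, Y)" f] uc X0 by simp
    then have "norm (?h (flip_piece (half_degree f) (X, Y))) \<le> M" using M by blast
    then have "norm (?h (flip_piece (half_degree f) (X, Y))) * norm X ^ (half_degree f - 2)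
        \<le> max 0 M * norm X ^ (half_degree f - 2)"
      by (intro mult_right_mono) auto
    then show "Y \<noteq> 0 \<and> norm (form_quotient \<omega> affine_incl f (X, Y)) \<le> max 0 M * norm X ^ (half_degree f - 2)"
      using form_quotient_flip[OF uc _ _ n] X0 Y0 by (simp add: norm_mult norm_power)
  qed
qed

lemma form_quotient_polynomial:
  assumes n: "half_degree f \<ge> 2"
  obtains e where "\<And>X Y. Y\<^sup>2 = poly f X \<Longrightarrow> Y \<noteq> 0 \<Longrightarrow>
    form_quotient \<omega> affine_incl f (X, Y) = (\<Sum>i<half_degree f - 1. e i * X ^ i)"
proof -
  let ?n = "half_degree f" and ?h = "form_quotient \<omega> affine_incl f"
  obtain R M where R: "R \<ge> 1" "M \<ge> 0" and
    M: "\<And>X Y. norm X \<ge> R \<Longrightarrow> Y\<^sup>2 = poly f X \<Longrightarrow> Y \<noteq> 0 \<and> norm (?h (X, Y)) \<le> M * norm X ^ (?n - 2)"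
    by (rule form_quotient_growth[OF n]) blast
  note hol = curve_parts_holomorphic[OF rsquarefree_nonzero[OF f]
      form_quotient_holo[OF curve_piece_affine]]
  have "compact (poly (poly_at_infinity f) ` cball 0 1)"
    by (intro compact_continuous_image continuous_intros) auto
  then have "bounded (poly (poly_at_infinity f) ` cball 0 1)" by (rule compact_imp_bounded)
  then obtain K where "\<forall>w\<in>poly (poly_at_infinity f) ` cball 0 1. norm w \<le> K"
    unfolding bounded_iff by blast
  then have K: "norm (poly (poly_at_infinity f) U) \<le> K" if "norm U \<le> 1" for U using that by simp
  have K0: "K \<ge> 0" using order_trans[OF norm_ge_zero K[of 0]] by simp
  \<comment> \<open>Growth of Y: f(X) is X^(2 n) times the value at 1 / X of a polynomial that is
    bounded on the unit disc.\<close>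
  have root: "norm (csqrt (poly f X)) \<le> sqrt K * norm X ^ ?n" if "norm X \<ge> 1" for X
  proof -
    have X0: "X \<noteq> 0" using that by auto
    have "poly f X = X ^ (2 * ?n) * poly (poly_at_infinity f) (1 / X)"
      using X0 poly_at_infinity_nz[of "1 / X" f] by (simp add: power_divide)
    moreover have "norm (poly (poly_at_infinity f) (1 / X)) \<le> K"
      using that X0 by (intro K) (simp add: norm_divide)
    ultimately have "norm (poly f X) \<le> K * (norm X ^ ?n)\<^sup>2"
      using mult_right_mono[of _ K "(norm X ^ ?n)\<^sup>2"]
      by (simp add: norm_mult norm_power power_even_eq mult.commute[of "(norm X ^ ?n)\<^sup>2"])
    then have "sqrt (norm (poly f X)) \<le> sqrt (K * (norm X ^ ?n)\<^sup>2)" by simp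
    then show ?thesis by (simp add: real_sqrt_mult)
  qed
  have even: "norm (even_part f ?h X) \<le> (2 * M) * norm X ^ (?n - 2)" if X: "norm X \<ge> R" for X
    using norm_triangle_ineq[of "?h (X, csqrt (poly f X))" "?h (X, - csqrt (poly f X))"]
      M[OF X, of "csqrt (poly f X)"] M[OF X, of "- csqrt (poly f X)"]
    by (simp add: even_part_def)
  have odd: "norm (odd_part f ?h X) \<le> (sqrt K * (2 * M)) * norm X ^ (2 * ?n - 2)" if X: "norm X \<ge> R" for X
  proof -
    have "norm (odd_part f ?h X) =
        norm (csqrt (poly f X)) * norm (?h (X, csqrt (poly f X)) - ?h (X, - csqrt (poly f X)))"
      by (simp add: odd_part_def norm_mult)
    also have "\<dots> \<le> (sqrt K * norm X ^ ?n) * ((2 * M) * norm X ^ (?n - 2))"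
    proof (rule mult_mono)
      show "norm (csqrt (poly f X)) \<le> sqrt K * norm X ^ ?n" using X R(1) by (intro root) simp
      show "norm (?h (X, csqrt (poly f X)) - ?h (X, - csqrt (poly f X))) \<le> (2 * M) * norm X ^ (?n - 2)"
        using norm_triangle_ineq4[of "?h (X, csqrt (poly f X))" "?h (X, - csqrt (poly f X))"]
          M[OF X, of "csqrt (poly f X)"] M[OF X, of "- csqrt (poly f X)"] by simp
    qed (use K0 in auto)
    also have "\<dots> = (sqrt K * (2 * M)) * norm X ^ (?n + (?n - 2))" by (simp add: power_add mult_ac)
    also have "?n + (?n - 2) = 2 * ?n - 2" using n by simp
    finally show ?thesis .
  qed
  define q where "q = (\<Sum>k\<le>2 * ?n - 2. monom ((deriv ^^ k) (odd_part f ?h) 0 / fact k) k)"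
  have q: "odd_part f ?h X = poly q X" for X
    using Liouville_polynomial[OF hol(2) odd, where \<xi> = X] by (simp add: q_def poly_sum poly_monom)
  have "degree q \<le> 2 * ?n - 2"
    unfolding q_def by (intro degree_sum_le) (auto intro: order_trans[OF degree_monom_le])
  \<comment> \<open>Rounding up in n gives deg f >= 2 n - 1, so the simple roots of f are too many
    for a nonzero q.\<close>
  also have "\<dots> < degree f" using n by (simp add: half_degree_def)
  finally have "degree q < card {a. poly f a = 0}" by (simp add: card_roots_rsquarefree[OF f])
  moreover have "poly q a = 0" if "poly f a = 0" for a
    using that unfolding q [symmetric] by (simp add: odd_part_def)
  then have "{a. poly f a = 0} \<subseteq> {a. poly q a = 0}" by blast
  ultimately have "q = 0"
    using card_poly_roots_bound[of q] card_mono[OF poly_roots_finite, of q "{a. poly f a = 0}"] by linarith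
  then have odd0: "odd_part f ?h X = 0" for X using q by simp
  \<comment> \<open>As the odd part vanishes, h agrees at Y and -Y and is half the even part; this
    is the final division by 2.\<close>
  let ?e = "\<lambda>k. (deriv ^^ k) (even_part f ?h) 0 / fact k / 2"
  show thesis
  proof
    fix X Y assume Y: "Y\<^sup>2 = poly f X" "Y \<noteq> 0"
    have "?h (X, - Y) = ?h (X, Y)" using odd_part_eq[OF Y(1), of ?h] odd0 Y(2) by simp
    then have "?h (X, Y) = even_part f ?h X / 2" using even_part_eq[OF Y(1), of ?h] by simp
    also have "\<dots> = (\<Sum>k\<le>?n - 2. ?e k * X ^ k)"
      using Liouville_polynomial[OF hol(1) even, where \<xi> = X] by (simp add: sum_divide_distrib)
    also have "{..?n - 2} = {..<?n - 1}" using n by auto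
    finally show "?h (X, Y) = (\<Sum>k<?n - 1. ?e k * X ^ k)" .
  qed
qed

text \<open>Both forms have the same quotient by dX / Y, which settles all points except those with
  Y = 0 and those at infinity. These finitely many values are filled in by continuity.\<close>

lemma form_is_combination:
  assumes n: "half_degree f \<ge> 2"
  obtains e where "\<omega> = (\<lambda>u z. \<Sum>i<half_degree f - 1. e i * basis_form f i u z)"
proof -
  let ?n = "half_degree f"
  note A = holomorphic_atlas_projective_curve[of f] and 0 = curve_piece_affine[of f]
  obtain e where e: "\<And>X Y. Y\<^sup>2 = poly f X \<Longrightarrow> Y \<noteq> 0 \<Longrightarrow>
      form_quotient \<omega> affine_incl f (X, Y) = (\<Sum>i<?n - 1. e i * X ^ i)"
    by (rule form_quotient_polynomial[OF n]) blast
  define \<eta> where "\<eta> = (\<lambda>u z. \<Sum>i<?n - 1. e i * basis_form f i u z)"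
  have \<eta>: "\<eta> \<in> holomorphic_forms (projective_curve f)"
    unfolding \<eta>_def using n by (intro holomorphic_forms_combination basis_form_holomorphic_form f) auto
  define K where "K = (\<lambda>a. Affine a 0) ` {a. poly f a = 0} \<union>
      Infinite ` {V. V\<^sup>2 = poly (poly_at_infinity f) 0}"
  have "finite {V. V\<^sup>2 = c}" for c :: complex
    by (rule finite_subset[of _ "{csqrt c, - csqrt c}"]) (use csqrt_cases in auto)
  then have K: "finite K"
    unfolding K_def using rsquarefree_nonzero[OF f] poly_roots_finite by blast
  have "\<omega> (U, \<phi>) z = \<eta> (U, \<phi>) z" for U \<phi> z
  proof (cases "(U, \<phi>) \<in> projective_curve f \<and> z \<in> \<phi> ` U")
    case False
    then show ?thesis using holomorphic_forms_outside[OF \<omega>] holomorphic_forms_outside[OF \<eta>] by metis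
  next
    case True
    then have c: "(U, \<phi>) \<in> projective_curve f" and z: "z \<in> \<phi> ` U" by auto
    show ?thesis
    proof (rule continuous_eq_off_finite[OF chart_open_image[OF A c] finite_imageI[OF K, of \<phi>] _ _ _ z])
      show "continuous_on (\<phi> ` U) (\<omega> (U, \<phi>))" "continuous_on (\<phi> ` U) (\<eta> (U, \<phi>))"
        using holomorphic_forms_holomorphic[OF \<omega> c] holomorphic_forms_holomorphic[OF \<eta> c]
        by (auto intro: holomorphic_on_imp_continuous_on)
      fix w assume "w \<in> \<phi> ` U - \<phi> ` K"
      then obtain P where P: "P \<in> U" "w = \<phi> P" "P \<notin> K" by blast
      have "P \<in> rs_points (projective_curve f)" using chart_subset_points[OF c] P(1) by blast
      then show "\<omega> (U, \<phi>) w = \<eta> (U, \<phi>) w"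
      proof (cases rule: point_cases[OF f, consumes 1])
        case (2 V)
        then show ?thesis using P(3) by (auto simp: K_def affine_curve_iff)
      next
        case (1 X Y)
        have Y0: "Y \<noteq> 0" using 1 P(3) by (auto simp: K_def affine_curve_iff)
        have Y: "Y\<^sup>2 = poly f X" using 1(2) by (simp add: affine_curve_iff)
        have inv: "inv_into U \<phi> (\<phi> (Affine X Y)) = Affine X Y"
          using chart_inj[OF A c] P(1) unfolding 1(1) by simp
        have inva: "inv affine_incl (Affine X Y) = (X, Y)"
          using inv_f_f[OF inj_affine_incl, of "(X, Y)"] by (simp add: affine_incl_def)
        let ?D = "cderiv (U, \<phi>) (piece_x affine_incl) P"
        have b: "basis_form f i (U, \<phi>) w = X ^ i / Y * ?D" for i
          using c P(1,2) Y0 by (simp add: basis_form_def[OF f] inv piece_form_def[OF f] inva 1(1))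
        have "form_quotient \<omega> affine_incl f (X, Y) * ?D = \<omega> (U, \<phi>) w * Y"
          using form_quotient_x[OF 0 1(2) _ c] Y0 P(1,2) 1(3) by simp
        then have "\<omega> (U, \<phi>) w = (\<Sum>i<?n - 1. e i * X ^ i) / Y * ?D"
          using e[OF Y Y0] Y0 by (simp add: field_simps)
        also have "\<dots> = \<eta> (U, \<phi>) w"
          by (simp add: \<eta>_def b sum_divide_distrib sum_distrib_right mult.assoc)
        finally show ?thesis .
      qed
    qed
  qed
  then have "\<omega> = \<eta>" by (intro ext) (metis surj_pair)
  then show thesis using that unfolding \<eta>_def by blast
qed

end

text \<open>In a chart by X the coefficient is X^i / Y, so equal combinations give a polynomial that
  vanishes off the roots of f; its product with f vanishes everywhere.\<close>

lemma basis_form_independent: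
  assumes f: "rsquarefree f"
    and eq: "(\<lambda>u z. \<Sum>i<g. c i * basis_form f i u z) = (\<lambda>u z. \<Sum>i<g. d i * basis_form f i u z)"
    and i: "i < g"
  shows "c i = d i"
proof -
  note A = holomorphic_atlas_projective_curve[of f] and 0 = curve_piece_affine[of f]
  define q where "q = (\<Sum>i<g. monom (c i - d i) i)"
  have "poly q X = 0" if X: "poly f X \<noteq> 0" for X
  proof -
    define Y where "Y = csqrt (poly f X)"
    have Y: "Y \<noteq> 0" "(X, Y) \<in> affine_curve f" using X by (auto simp: Y_def affine_curve_iff)
    then obtain S where S: "(S, fst) \<in> affine_charts f" "(X, Y) \<in> S" by (metis affine_chart_fst snd_conv)
    let ?c = "(affine_incl ` S, fst \<circ> inv affine_incl)"
    note ch = projective_curve_chart[OF 0 S(1)]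
    have P: "Affine X Y \<in> affine_incl ` S" using S(2) by (force simp: affine_incl_def)
    have inva: "inv affine_incl (Affine X Y) = (X, Y)"
      using inv_f_f[OF inj_affine_incl, of "(X, Y)"] by (simp add: affine_incl_def)
    have inv: "inv_into (affine_incl ` S) (fst \<circ> inv affine_incl) X = Affine X Y"
      using inv_into_f_f[OF chart_inj[OF A ch] P] by (simp add: inva)
    have "X \<in> (fst \<circ> inv affine_incl) ` affine_incl ` S"
      using P by (intro image_eqI[of _ _ "Affine X Y"]) (auto simp: inva)
    moreover have "cderiv ?c (piece_x affine_incl) (Affine X Y) = 1"
      using cderiv_self[OF A ch P] by (simp add: o_def)
    ultimately have b: "basis_form f i ?c X = X ^ i / Y" for i
      using ch Y(1) by (simp add: basis_form_def[OF f] inv piece_form_def[OF f] inva)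
    have "(\<Sum>i<g. c i * basis_form f i ?c X) = (\<Sum>i<g. d i * basis_form f i ?c X)"
      using eq by meson
    then have "(\<Sum>i<g. (c i - d i) * X ^ i) / Y = 0"
      by (simp add: b sum_divide_distrib algebra_simps sum_subtractf diff_divide_distrib)
    then show ?thesis using Y(1) by (simp add: q_def poly_sum poly_monom)
  qed
  then have "poly (q * f) X = 0" for X by (cases "poly f X = 0") auto
  then have "q * f = 0" by (metis poly_all_0_iff_0)
  then have "q = 0" using rsquarefree_nonzero[OF f] by simp
  moreover have "coeff q i = c i - d i" using i by (simp add: q_def coeff_sum)
  ultimately show ?thesis by simp
qed

theorem has_genus_projective_curve:
  assumes f: "rsquarefree f" and deg: "degree f \<ge> 3"
  shows "has_genus (projective_curve f) (half_degree f - 1)"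
  unfolding has_genus_def
proof (intro conjI exI[of _ "basis_form f"] allI ballI)
  have n: "half_degree f \<ge> 2" using deg by (simp add: half_degree_def)
  show "compact_riemann_surface (projective_curve f)"
    using f deg by (intro compact_riemann_surface_projective_curve) auto
  let ?g = "half_degree f - 1"
  show "(\<lambda>u z. \<Sum>i<?g. c i * basis_form f i u z) \<in> holomorphic_forms (projective_curve f)" for c
    using n by (intro holomorphic_forms_combination basis_form_holomorphic_form f) auto
  fix \<omega> assume \<omega>: "\<omega> \<in> holomorphic_forms (projective_curve f)"
  obtain e where e: "\<omega> = (\<lambda>u z. \<Sum>i<?g. e i * basis_form f i u z)"
    by (rule form_is_combination[OF f \<omega> n])
  show "\<exists>!c. (\<forall>i\<ge>?g. c i = 0) \<and> \<omega> = (\<lambda>u z. \<Sum>i<?g. c i * basis_form f i u z)"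
  \<comment> \<open>The coefficients from \<open>?g\<close> on are set to 0, because uniqueness is
    asked of functions on all natural numbers.\<close>
  proof (rule ex1I[of _ "\<lambda>i. if i < ?g then e i else 0"])
    show "(\<forall>i\<ge>?g. (if i < ?g then e i else 0) = 0) \<and>
        \<omega> = (\<lambda>u z. \<Sum>i<?g. (if i < ?g then e i else 0) * basis_form f i u z)"
      unfolding e by (auto intro!: ext sum.cong)
    fix c assume c: "(\<forall>i\<ge>?g. c i = 0) \<and> \<omega> = (\<lambda>u z. \<Sum>i<?g. c i * basis_form f i u z)"
    show "c = (\<lambda>i. if i < ?g then e i else 0)"
    proof
      fix i
      show "c i = (if i < ?g then e i else 0)"
        using basis_form_independent[OF f, where g = ?g and c = c and d = e and i = i] c e by auto
    qed
  qed
qed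

section \<open>Local parameters at the points of the curve\<close>

lemma piece_mem_points:
  assumes f: "rsquarefree f" and \<iota>: "curve_piece f \<iota> p"
  shows "\<iota> u \<in> rs_points (projective_curve f) \<longleftrightarrow> u \<in> affine_curve p"
proof
  assume "\<iota> u \<in> rs_points (projective_curve f)"
  then obtain \<kappa> q v where v: "curve_piece f \<kappa> q" "v \<in> affine_curve q" "\<iota> u = \<kappa> v"
    unfolding rs_points_projective_curve[OF f] using curve_piece_affine curve_piece_infinite by blast
  from v(1) \<iota> show "u \<in> affine_curve p"
  proof (cases rule: curve_piece_cases)
    case 1
    then have "u = v" using v(3) curve_piece_inj[OF \<iota>] by (simp add: inj_eq)
    then show ?thesis using v(2) 1 by simp
  next
    case 2
    then show ?thesis using v(2) v(3)[symmetric] by metis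
  qed
qed (rule curve_piece_points[OF f \<iota>])

lemma inv_affine_incl [simp]: "inv affine_incl (Affine X Y) = (X, Y)"
  using inv_f_f[OF inj_affine_incl, of "(X, Y)"] by (simp add: affine_incl_def)

lemma inv_infinite_incl [simp]: "inv (infinite_incl n) (Infinite V) = (0, V)"
  using inv_f_f[OF inj_infinite_incl, of n "(0, V)"] by (simp add: infinite_incl_def)

lemma affine_incl_Pair: "affine_incl (X, Y) = Affine X Y"
  by (simp add: affine_incl_def)

lemma infinite_incl_Pair:
  "infinite_incl n (U, V) = (if U = 0 then Infinite V else Affine (1 / U) (V / U ^ n))"
  by (simp add: infinite_incl_def)

lemma affine_coordinates:
  assumes f: "rsquarefree f" and P: "Affine X Y \<in> rs_points (projective_curve f)"
  shows "local_holo (projective_curve f) (piece_x affine_incl) (Affine X Y)"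
    and "local_holo (projective_curve f) (piece_y affine_incl) (Affine X Y)"
    and "Y \<noteq> 0 \<Longrightarrow> local_order (projective_curve f) (piece_x affine_incl) (Affine X Y) 1"
    and "poly (pderiv f) X \<noteq> 0 \<Longrightarrow> local_order (projective_curve f) (piece_y affine_incl) (Affine X Y) 1"
    and "\<forall>\<^sub>F Q in near (projective_curve f) (Affine X Y).
      \<exists>X Y. Q = Affine X Y \<and> Y\<^sup>2 = poly f X"
proof -
  note 0 = curve_piece_affine[of f]
  have u: "(X, Y) \<in> affine_curve f" and eq: "Affine X Y = affine_incl (X, Y)"
    using P Affine_in_projective_curve[OF f] by (auto simp: affine_curve_iff affine_incl_Pair)
  show "local_holo (projective_curve f) (piece_x affine_incl) (Affine X Y)"
    "local_holo (projective_curve f) (piece_y affine_incl) (Affine X Y)"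
    using piece_coordinates_holo[OF 0 u f] by (simp_all add: eq)
  show "Y \<noteq> 0 \<Longrightarrow> local_order (projective_curve f) (piece_x affine_incl) (Affine X Y) 1"
    using piece_fst_order[OF 0 u] by (simp add: eq)
  show "poly (pderiv f) X \<noteq> 0 \<Longrightarrow> local_order (projective_curve f) (piece_y affine_incl) (Affine X Y) 1"
    using piece_snd_order[OF 0 u] by (simp add: eq)
  have "\<forall>\<^sub>F Q in near (projective_curve f) (Affine X Y). Q \<in> affine_incl ` affine_curve f"
    using piece_eventually[OF 0 f u] by (simp add: eq)
  then show "\<forall>\<^sub>F Q in near (projective_curve f) (Affine X Y).
      \<exists>X Y. Q = Affine X Y \<and> Y\<^sup>2 = poly f X"
    by eventually_elim (auto simp: affine_incl_Pair affine_curve_iff)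
qed

lemma infinite_coordinates:
  assumes f: "rsquarefree f" and P: "Infinite V \<in> rs_points (projective_curve f)"
  defines "\<kappa> \<equiv> infinite_incl (half_degree f)" and "p \<equiv> poly_at_infinity f"
  shows "local_holo (projective_curve f) (piece_x \<kappa>) (Infinite V)"
    and "local_holo (projective_curve f) (piece_y \<kappa>) (Infinite V)"
    and "V \<noteq> 0 \<Longrightarrow> local_order (projective_curve f) (piece_x \<kappa>) (Infinite V) 1"
    and "poly (pderiv p) 0 \<noteq> 0 \<Longrightarrow> local_order (projective_curve f) (piece_y \<kappa>) (Infinite V) 1"
    and "\<forall>\<^sub>F Q in near (projective_curve f) (Infinite V).
      \<exists>U V. Q = \<kappa> (U, V) \<and> V\<^sup>2 = poly p U"
proof -
  have 1: "curve_piece f \<kappa> p" unfolding \<kappa>_def p_def by (rule curve_piece_infinite)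
  have u: "(0, V) \<in> affine_curve p" and eq: "Infinite V = \<kappa> (0, V)"
    using P Infinite_in_projective_curve[OF f] by (auto simp: affine_curve_iff infinite_incl_Pair \<kappa>_def p_def)
  show "local_holo (projective_curve f) (piece_x \<kappa>) (Infinite V)"
    "local_holo (projective_curve f) (piece_y \<kappa>) (Infinite V)"
    using piece_coordinates_holo[OF 1 u f] by (simp_all add: eq)
  show "V \<noteq> 0 \<Longrightarrow> local_order (projective_curve f) (piece_x \<kappa>) (Infinite V) 1"
    using piece_fst_order[OF 1 u] by (simp add: eq)
  show "poly (pderiv p) 0 \<noteq> 0 \<Longrightarrow> local_order (projective_curve f) (piece_y \<kappa>) (Infinite V) 1"
    using piece_snd_order[OF 1 u] by (simp add: eq)
  have "\<forall>\<^sub>F Q in near (projective_curve f) (Infinite V). Q \<in> \<kappa> ` affine_curve p"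
    using piece_eventually[OF 1 f u] by (simp add: eq)
  then show "\<forall>\<^sub>F Q in near (projective_curve f) (Infinite V).
      \<exists>U V. Q = \<kappa> (U, V) \<and> V\<^sup>2 = poly p U"
  proof eventually_elim
    case (elim Q)
    then obtain u where "Q = \<kappa> u" "u \<in> affine_curve p" by blast
    then show ?case by (intro exI[of _ "fst u"] exI[of _ "snd u"]) (simp add: affine_curve_iff)
  qed
qed

section \<open>The elliptic curve\<close>

lemma poly_E: "poly E_poly X = X ^ 3 + 1"
  by (simp add: E_poly_def power3_eq_cube)

lemma poly_pderiv_E: "poly (pderiv E_poly) X = 3 * X\<^sup>2"
  by (simp add: E_poly_def pderiv_pCons power2_eq_square)

lemma rsquarefree_E: "rsquarefree E_poly"
  by (auto simp: rsquarefree_roots poly_E poly_pderiv_E)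

lemma degree_E: "degree E_poly = 3" and half_degree_E [simp]: "half_degree E_poly = 2"
  by (simp_all add: E_poly_def half_degree_def)

text \<open>The piece at infinity is V^2 = U + U^4: a single point (0, 0) has U = 0, and V is a
  local parameter there.\<close>

lemma poly_at_infinity_E: "poly_at_infinity E_poly = [:0, 1, 0, 0, 1:]"
proof -
  have "poly (poly_at_infinity E_poly) U = poly [:0, 1, 0, 0, 1:] U" for U
  proof (cases "U = 0")
    case True
    then show ?thesis by (simp add: poly_at_infinity_def degree_E poly_monom)
  next
    case False
    then show ?thesis
      by (simp add: poly_at_infinity_nz poly_E field_simps eval_nat_numeral)
  qed
  then show ?thesis by (simp add: poly_eq_poly_eq_iff [symmetric] fun_eq_iff)
qed

lemma E_curve_atlas: "holomorphic_atlas E_curve"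
  unfolding E_curve_def by (rule holomorphic_atlas_projective_curve)

lemma compact_E_curve: "compact_riemann_surface E_curve"
  unfolding E_curve_def
  by (rule compact_riemann_surface_projective_curve[OF rsquarefree_E]) (simp add: degree_E)

lemma Affine_in_E: "Affine X Y \<in> rs_points E_curve \<longleftrightarrow> Y\<^sup>2 = X ^ 3 + 1"
  unfolding E_curve_def by (simp add: Affine_in_projective_curve[OF rsquarefree_E] poly_E)

lemma Infinite_in_E: "Infinite V \<in> rs_points E_curve \<longleftrightarrow> V = 0"
  unfolding E_curve_def by (simp add: Infinite_in_projective_curve[OF rsquarefree_E] poly_at_infinity_E)

lemma E_point_cases:
  assumes "P \<in> rs_points E_curve"
  obtains X Y where "P = Affine X Y" "Y\<^sup>2 = X ^ 3 + 1" | "P = Infinite 0"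
  using assms by (cases P) (auto simp: Affine_in_E Infinite_in_E)

lemmas E_affine_coordinates =
  affine_coordinates[OF rsquarefree_E, folded E_curve_def, unfolded poly_E poly_pderiv_E]

lemmas E_infinite_coordinates =
  infinite_coordinates[OF rsquarefree_E, folded E_curve_def, unfolded half_degree_E poly_at_infinity_E]

abbreviation "E_inf \<equiv> infinite_incl 2"

lemma curve_piece_E:
  "curve_piece E_poly affine_incl E_poly" "curve_piece E_poly E_inf [:0, 1, 0, 0, 1:]"
  using curve_piece_affine[of E_poly] curve_piece_infinite[of E_poly] by (simp_all add: poly_at_infinity_E)

lemma E_piece_mem:
  "affine_incl u \<in> rs_points E_curve \<longleftrightarrow> u \<in> affine_curve E_poly"
  "E_inf u \<in> rs_points E_curve \<longleftrightarrow> u \<in> affine_curve [:0, 1, 0, 0, 1:]"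
  unfolding E_curve_def using piece_mem_points[OF rsquarefree_E] curve_piece_E by auto

definition half_y :: "curve_point \<Rightarrow> complex option" where
  "half_y P = (case P of Affine X Y \<Rightarrow> Some ((1 + Y) / 2) | Infinite V \<Rightarrow> None)"

definition half_y_degree :: "curve_point \<Rightarrow> nat" where
  "half_y_degree P = (case P of Affine X Y \<Rightarrow> if X = 0 then 3 else 1 | Infinite V \<Rightarrow> 3)"

lemma half_y_order:
  assumes P: "P \<in> rs_points E_curve"
  shows "map_order E_curve riemann_sphere half_y P (half_y_degree P)"
  using P
proof (cases rule: E_point_cases)
  case (1 X Y)
  note A = E_curve_atlas
  note crd = E_affine_coordinates[OF P[unfolded 1(1)]]
  let ?f = "\<lambda>Q. (1 + piece_y affine_incl Q) / 2"
  have ord: "local_order E_curve ?f P (half_y_degree P)"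
  proof (cases "X = 0")
    case False
    have "local_order E_curve ?f P 1"
      unfolding 1(1)
    proof (rule local_order_factor[OF A crd(4)])
      show "local_holo E_curve (\<lambda>Q. 1 / 2) (Affine X Y)" by (rule local_holo_const) (use P 1 in simp)
      show "\<forall>\<^sub>F Q in near E_curve (Affine X Y).
          ?f Q - ?f (Affine X Y) = 1 / 2 * (piece_y affine_incl Q - piece_y affine_incl (Affine X Y)) ^ 1"
        by (rule always_eventually) (simp add: field_simps)
    qed (use False in auto)
    then show ?thesis using False by (simp add: half_y_degree_def 1(1))
  next
    case True
    then have Y: "Y\<^sup>2 = 1" "Y \<noteq> 0" using 1(2) by auto
    have ev: "\<forall>\<^sub>F Q in near E_curve (Affine X Y). piece_y affine_incl Q \<noteq> - Y"
      by (rule local_holo_eventually_ne[OF A crd(2)]) (use Y in simp)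
    \<comment> \<open>Over X = 0 one has Y^2 = 1, and a nearby point satisfies (Y' - Y) (Y' + Y) =
      X'^3; so the difference is a unit times the cube of the local parameter.\<close>
    have "local_order E_curve ?f P 3"
      unfolding 1(1)
    proof (rule local_order_factor[OF A crd(3)[OF Y(2)]])
      show "local_holo E_curve (\<lambda>Q. 1 / (2 * (piece_y affine_incl Q + Y))) (Affine X Y)"
        by (intro local_holo_intros A crd) (use P 1 Y in simp_all)
      show "\<forall>\<^sub>F Q in near E_curve (Affine X Y). ?f Q - ?f (Affine X Y) =
          1 / (2 * (piece_y affine_incl Q + Y)) * (piece_x affine_incl Q - piece_x affine_incl (Affine X Y)) ^ 3"
        using crd(5) ev
      proof eventually_elim
        case (elim Q)
        then obtain X' Y' where Q: "Q = Affine X' Y'" "Y'\<^sup>2 = X' ^ 3 + 1" by auto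
        have nz: "Y' + Y \<noteq> 0" using elim(2) Q(1) by (simp add: eq_neg_iff_add_eq_0)
        have "(Y' - Y) * (Y' + Y) = X' ^ 3" using Q(2) Y(1) by algebra
        then have "Y' - Y = X' ^ 3 / (Y' + Y)" using nz by (simp add: field_simps)
        moreover have "(1 + Y') / 2 - (1 + Y) / 2 = (Y' - Y) / 2" by (simp add: field_simps)
        ultimately show ?case using True by (simp add: Q(1))
      qed
    qed (use Y in simp)
    then show ?thesis using True by (simp add: half_y_degree_def 1(1))
  qed
  show ?thesis
  proof (rule map_order_sphere_finite[OF ord _ A P])
    show "\<forall>\<^sub>F Q in near E_curve P. half_y Q = Some (?f Q)"
      unfolding 1(1) using crd(5) by eventually_elim (auto simp: half_y_def)
  qed
next
  case 2
  note A = E_curve_atlas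
  note crd = E_infinite_coordinates[OF P[unfolded 2]]
  let ?U = "piece_x E_inf" and ?V = "piece_y E_inf"
  \<comment> \<open>The reciprocal of (1 + V / U^2) / 2 without U in a denominator: V^4 = U^2 (1 +
    U^3)^2 gives V / U^2 = (1 + U^3)^2 / V^3. The result is a unit times V^3.\<close>
  let ?f = "\<lambda>Q. 2 / (?V Q ^ 3 + (1 + ?U Q ^ 3)\<^sup>2) * ?V Q ^ 3"
  have holo: "local_holo E_curve (\<lambda>Q. 2 / (?V Q ^ 3 + (1 + ?U Q ^ 3)\<^sup>2)) (Infinite 0)"
    by (intro local_holo_intros A crd) (use P 2 in simp_all)
  have ord: "local_order E_curve ?f P 3"
    unfolding 2
    by (rule local_order_factor[OF A crd(4) holo]) (simp_all add: pderiv_pCons)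
  have "local_holo E_curve (\<lambda>Q. 1 + ?U Q ^ 3) (Infinite 0)"
    "local_holo E_curve (\<lambda>Q. ?V Q ^ 3 + (1 + ?U Q ^ 3)\<^sup>2) (Infinite 0)"
    by (intro local_holo_intros A crd, use P 2 in simp)+
  from local_holo_eventually_ne[OF A this(1), of 0] local_holo_eventually_ne[OF A this(2), of 0]
  have ev: "\<forall>\<^sub>F Q in near E_curve (Infinite 0). 1 + ?U Q ^ 3 \<noteq> 0"
    "\<forall>\<^sub>F Q in near E_curve (Infinite 0). ?V Q ^ 3 + (1 + ?U Q ^ 3)\<^sup>2 \<noteq> 0"
    by simp_all
  have "map_order E_curve riemann_sphere half_y P 3"
  proof (rule map_order_sphere_infinite[OF ord _ A P])
    show "\<forall>\<^sub>F Q in near E_curve P. half_y Q = (if ?f Q = 0 then None else Some (1 / ?f Q))"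
      unfolding 2 using crd(5) ev
    proof eventually_elim
      case (elim Q)
      then obtain U V where Q: "Q = E_inf (U, V)" and "V\<^sup>2 = poly [:0, 1, 0, 0, 1:] U" by auto
      then have V: "V\<^sup>2 = U * (1 + U ^ 3)" by (simp add: algebra_simps eval_nat_numeral)
      have c: "?U Q = U" "?V Q = V" by (simp_all add: Q inj_infinite_incl)
      have D: "1 + U ^ 3 \<noteq> 0" "V ^ 3 + (1 + U ^ 3)\<^sup>2 \<noteq> 0" using elim(2,3) by (simp_all add: c)
      show ?case
      proof (cases "U = 0")
        case True
        then have "V = 0" using V by simp
        then have "?f Q = 0" "half_y Q = None"
          using True by (simp add: c, simp add: Q infinite_incl_Pair half_y_def)
        then show ?thesis by simp
      next
        case False
        then have V0: "V \<noteq> 0" using V D(1) by auto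
        have "V * V ^ 3 = U\<^sup>2 * (1 + U ^ 3)\<^sup>2" using V by algebra
        then have "V / U\<^sup>2 = (1 + U ^ 3)\<^sup>2 / V ^ 3" using False V0 by (simp add: field_simps)
        then have "(1 + V / U\<^sup>2) / 2 = 1 / ?f Q"
          using V0 D(2) by (simp add: c add_divide_distrib)
        moreover have "half_y Q = Some ((1 + V / U\<^sup>2) / 2)"
          using False by (simp add: Q infinite_incl_Pair half_y_def)
        moreover have "?f Q \<noteq> 0" using V0 D(2) by (simp add: c)
        ultimately show ?thesis by (simp only: if_False)
      qed
    qed
  qed
  then show ?thesis by (simp add: half_y_degree_def 2)
qed

text \<open>Over a finite w lie the cube roots of t^2 - 1 with t = 2 w - 1: a single one counted
  three times for t = 1 or t = -1, three of them otherwise.\<close>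

lemma half_y_fibre:
  shows "finite (fibre E_curve half_y c)" and "(\<Sum>P\<in>fibre E_curve half_y c. half_y_degree P) = 3"
proof -
  have "finite (fibre E_curve half_y c) \<and> (\<Sum>P\<in>fibre E_curve half_y c. half_y_degree P) = 3"
  proof (cases c)
    case None
    have "fibre E_curve half_y c = {Infinite 0}"
    proof (intro subset_antisym subsetI)
      fix P assume "P \<in> fibre E_curve half_y c"
      then show "P \<in> {Infinite 0}"
        by (cases P) (auto simp: fibre_def None half_y_def Infinite_in_E)
    qed (auto simp: fibre_def None half_y_def Infinite_in_E)
    then show ?thesis by (simp add: half_y_degree_def)
  next
    case (Some w)
    define t where "t = 2 * w - 1"
    have "fibre E_curve half_y c = (\<lambda>X. Affine X t) ` {X. X ^ 3 = t\<^sup>2 - 1}"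
    proof (intro subset_antisym subsetI)
      fix P assume "P \<in> fibre E_curve half_y c"
      then obtain X Y where "P = Affine X Y" "(1 + Y) / 2 = w" "Y\<^sup>2 = X ^ 3 + 1"
        by (auto simp: fibre_def Some half_y_def Affine_in_E split: curve_point.splits)
      moreover from this have "Y = t" by (simp add: t_def field_simps)
      ultimately show "P \<in> (\<lambda>X. Affine X t) ` {X. X ^ 3 = t\<^sup>2 - 1}" by auto
    next
      fix P assume "P \<in> (\<lambda>X. Affine X t) ` {X. X ^ 3 = t\<^sup>2 - 1}"
      then show "P \<in> fibre E_curve half_y c"
        by (auto simp: fibre_def Some half_y_def Affine_in_E t_def)
    qed
    moreover have "inj_on (\<lambda>X. Affine X t) A" for A by (auto simp: inj_on_def)
    moreover have "finite {X. X ^ 3 = t\<^sup>2 - 1} \<and> (\<Sum>X | X ^ 3 = t\<^sup>2 - 1. half_y_degree (Affine X t)) = 3"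
    proof (cases "t\<^sup>2 - 1 = 0")
      case True
      then have "{X. X ^ 3 = t\<^sup>2 - 1} = {0}" by auto
      then show ?thesis by (simp add: half_y_degree_def)
    next
      case False
      have "card {X. X ^ 3 = t\<^sup>2 - 1} = 3" using False by (intro card_nth_roots) auto
      moreover have "(\<Sum>X | X ^ 3 = t\<^sup>2 - 1. half_y_degree (Affine X t)) = (\<Sum>X | X ^ 3 = t\<^sup>2 - 1. 1)"
        using False by (intro sum.cong) (auto simp: half_y_degree_def)
      ultimately show ?thesis using card.infinite by fastforce
    qed
    ultimately show ?thesis by (simp add: sum.reindex)
  qed
  then show "finite (fibre E_curve half_y c)" "(\<Sum>P\<in>fibre E_curve half_y c. half_y_degree P) = 3" by auto
qed

section \<open>An involution of the elliptic curve\<close>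

text \<open>For a point \<open>Q = (q, r)\<close> of \<open>E\<close> with \<open>r \<noteq> 0\<close>, the involution \<open>P \<mapsto> Q - P\<close> sends \<open>P\<close> to the
  third point on the line through \<open>P\<close> and \<open>-Q\<close>, and exchanges \<open>Q\<close> with the point at infinity.
  Parametrising the lines through \<open>-Q\<close> by their slope \<open>l\<close> and writing \<open>s\<close> for \<open>x - q\<close>, the other two
  points on the line are the solutions of a quadratic equation for \<open>s\<close>, and are exchanged.\<close>

locale E_point =
  fixes q r :: complex
  assumes on_E: "r\<^sup>2 = q ^ 3 + 1" and r_nonzero: "r \<noteq> 0"
begin

text \<open>For X = q this is the slope of the tangent at -Q = (q, -r). The vertical line through Q
  has no slope; \<open>reflection\<close> treats Q separately.\<close>

definition slope :: "complex \<Rightarrow> complex \<Rightarrow> complex" where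
  "slope X Y = (if X = q then - 3 * q\<^sup>2 / (2 * r) else (Y + r) / (X - q))"

text \<open>The first coordinates of the three intersections of E with a line of slope l add up to
  l^2, which gives the third one; its second coordinate is read off from the line through
  -Q.\<close>

definition reflection :: "curve_point \<Rightarrow> curve_point" where
  "reflection P = (case P of
      Affine X Y \<Rightarrow> if X = q \<and> Y = r then Infinite 0
        else Affine ((slope X Y)\<^sup>2 - X - q) (- r + slope X Y * ((slope X Y)\<^sup>2 - X - 2 * q))
    | Infinite V \<Rightarrow> Affine q r)"

text \<open>Inserting the line into the equation of E leaves a cubic in s with the factor s, which
  belongs to -Q. At -Q itself the tangent slope makes the constant term of the remaining quadratic
  vanish.\<close>

lemma slope_equations:
  assumes "Y\<^sup>2 = X ^ 3 + 1" "\<not> (X = q \<and> Y = r)"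
  defines "l \<equiv> slope X Y" and "s \<equiv> X - q"
  shows "Y = - r + l * s" and "s\<^sup>2 + (3 * q - l\<^sup>2) * s + (3 * q\<^sup>2 + 2 * l * r) = 0"
proof -
  have "Y = - r + l * s \<and> s\<^sup>2 + (3 * q - l\<^sup>2) * s + (3 * q\<^sup>2 + 2 * l * r) = 0"
  proof (cases "X = q")
    case True
    then have "Y\<^sup>2 = r\<^sup>2" using assms(1) on_E by simp
    then have "Y = - r" using True assms(2) by (auto simp: power2_eq_iff)
    then show ?thesis using True r_nonzero by (simp add: l_def s_def slope_def)
  next
    case False
    then have Y: "Y = - r + l * s" and s: "s \<noteq> 0" by (simp_all add: l_def s_def slope_def)
    have "(- r + l * s)\<^sup>2 = (q + s) ^ 3 + 1" using assms(1) Y by (simp add: s_def)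
    then have "s * (s\<^sup>2 + (3 * q - l\<^sup>2) * s + (3 * q\<^sup>2 + 2 * l * r)) = 0" using on_E by algebra
    then show ?thesis using Y s by simp
  qed
  then show "Y = - r + l * s" "s\<^sup>2 + (3 * q - l\<^sup>2) * s + (3 * q\<^sup>2 + 2 * l * r) = 0" by auto
qed

text \<open>The converse direction: a root of the quadratic is a point of E whose slope is l again.
  It cannot be Q, since the line through Q and -Q is vertical.\<close>

lemma slope_point:
  assumes eq: "s\<^sup>2 + (3 * q - l\<^sup>2) * s + (3 * q\<^sup>2 + 2 * l * r) = 0"
  shows "(- r + l * s)\<^sup>2 = (q + s) ^ 3 + 1" and "\<not> (q + s = q \<and> - r + l * s = r)"
    and "slope (q + s) (- r + l * s) = l"
proof -
  show "(- r + l * s)\<^sup>2 = (q + s) ^ 3 + 1" using eq on_E by algebra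
  show "\<not> (q + s = q \<and> - r + l * s = r)"
  proof
    assume h: "q + s = q \<and> - r + l * s = r"
    then have "s = 0" by simp
    then have "2 * r = 0" using h by algebra
    then show False using r_nonzero by simp
  qed
  show "slope (q + s) (- r + l * s) = l"
  proof (cases "s = 0")
    case True
    then have "3 * q\<^sup>2 + 2 * l * r = 0" using eq by simp
    then have "l * (2 * r) = - 3 * q\<^sup>2" by algebra
    then show ?thesis using True r_nonzero by (simp add: slope_def field_simps)
  next
    case False
    then show ?thesis by (simp add: slope_def)
  qed
qed

text \<open>The two roots of the quadratic have sum l^2 - 3 q, so this is the exchange of the
  roots.\<close>

lemma reflection_slope:
  assumes eq: "s\<^sup>2 + (3 * q - l\<^sup>2) * s + (3 * q\<^sup>2 + 2 * l * r) = 0"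
  shows "reflection (Affine (q + s) (- r + l * s)) =
    Affine (q + (l\<^sup>2 - 3 * q - s)) (- r + l * (l\<^sup>2 - 3 * q - s))"
  using slope_point(2,3)[OF eq] unfolding reflection_def by (simp add: algebra_simps)

lemma reflection_involution:
  assumes "P \<in> rs_points E_curve"
  shows "reflection P \<in> rs_points E_curve" and "reflection (reflection P) = P"
proof -
  have "reflection P \<in> rs_points E_curve \<and> reflection (reflection P) = P"
    using assms
  proof (cases rule: E_point_cases)
    case 2
    then show ?thesis using on_E by (simp add: reflection_def Affine_in_E)
  next
    case (1 X Y)
    show ?thesis
    proof (cases "X = q \<and> Y = r")
      case True
      then show ?thesis using 1 by (simp add: reflection_def Infinite_in_E)
    next
      case False
      define l s where "l = slope X Y" and "s = X - q"
      note e = slope_equations[OF 1(2) False, folded l_def s_def]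
      have P: "P = Affine (q + s) (- r + l * s)" using 1(1) e(1) by (simp add: s_def)
      have e': "(l\<^sup>2 - 3 * q - s)\<^sup>2 + (3 * q - l\<^sup>2) * (l\<^sup>2 - 3 * q - s) + (3 * q\<^sup>2 + 2 * l * r) = 0"
        using e(2) by algebra
      show ?thesis
        unfolding P reflection_slope[OF e(2)] reflection_slope[OF e']
        using slope_point(1)[OF e'] by (simp add: Affine_in_E)
    qed
  qed
  then show "reflection P \<in> rs_points E_curve" "reflection (reflection P) = P" by auto
qed

lemma reflection_inj: "inj_on reflection (rs_points E_curve)"
  by (metis inj_onI reflection_involution(2))

text \<open>Any holomorphic function that agrees with the slope near P will do, so the chord formula
  can be replaced where it degenerates.\<close>

lemma reflection_map_holo_affine:
  assumes P: "P \<in> rs_points E_curve" and \<alpha>\<beta>: "local_holo E_curve l P"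
    and PA: "P = Affine X Y"
    and ev: "\<forall>\<^sub>F Q in near E_curve P. \<forall>X Y. Q = Affine X Y \<longrightarrow> Y\<^sup>2 = X ^ 3 + 1 \<longrightarrow>
      \<not> (X = q \<and> Y = r) \<and> l Q = slope X Y"
  shows "map_holo E_curve E_curve reflection P"
proof -
  note A = E_curve_atlas and crd = E_affine_coordinates[OF P[unfolded PA], folded PA]
  let ?X = "piece_x affine_incl"
  let ?a = "\<lambda>Q. l Q ^ 2 - ?X Q - q" and ?b = "\<lambda>Q. - r + l Q * (l Q ^ 2 - ?X Q - 2 * q)"
  have "local_holo E_curve ?a P" "local_holo E_curve ?b P"
    by (intro local_holo_intros A crd \<alpha>\<beta> P)+
  moreover have "\<forall>\<^sub>F Q in near E_curve P.
      reflection Q = affine_incl (?a Q, ?b Q) \<and> (?a Q, ?b Q) \<in> affine_curve E_poly"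
    using crd(5) ev
  proof eventually_elim
    case (elim Q)
    then obtain X' Y' where Q: "Q = Affine X' Y'" "Y'\<^sup>2 = X' ^ 3 + 1" by auto
    then have "reflection Q = affine_incl (?a Q, ?b Q)"
      using elim(2) by (auto simp: reflection_def affine_incl_Pair)
    moreover have "reflection Q \<in> rs_points E_curve"
      using reflection_involution(1) Q by (simp add: Affine_in_E)
    ultimately show ?case using E_piece_mem(1) by metis
  qed
  ultimately show ?thesis
    using map_holo_into_curve[OF curve_piece_E(1) rsquarefree_E A P] unfolding E_curve_def by blast
qed

text \<open>The chord formula degenerates at -Q, at Q and at infinity. In these cases it is
  rearranged with the equation of E until the denominators are nonzero at the point.\<close>

lemma reflection_map_holo:
  assumes P: "P \<in> rs_points E_curve"
  shows "map_holo E_curve E_curve reflection P"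
proof -
  note A = E_curve_atlas
  consider X Y where "P = Affine X Y" "Y\<^sup>2 = X ^ 3 + 1" "X \<noteq> q"
    | "P = Affine q (- r)" | "P = Affine q r" | "P = Infinite 0"
    using P
  proof (cases rule: E_point_cases)
    case (1 X Y)
    show ?thesis
    proof (cases "X = q")
      case True
      then have "Y\<^sup>2 = r\<^sup>2" using 1 on_E by simp
      then show ?thesis using that(2,3) 1 True by (auto simp: power2_eq_iff)
    qed (use that(1) 1 in blast)
  qed (use that(4) in blast)
  then show ?thesis
  proof cases
    case (1 X Y)
    note crd = E_affine_coordinates[OF P[unfolded 1(1)], folded 1(1)]
    show ?thesis
    proof (rule reflection_map_holo_affine[OF P _ 1(1)])
      show "local_holo E_curve (\<lambda>Q. (piece_y affine_incl Q + r) / (piece_x affine_incl Q - q)) P"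
        by (intro local_holo_intros A crd P) (use 1 in simp)
      have "\<forall>\<^sub>F Q in near E_curve P. piece_x affine_incl Q \<noteq> q"
        by (rule local_holo_eventually_ne[OF A crd(1)]) (use 1 in simp)
      then show "\<forall>\<^sub>F Q in near E_curve P. \<forall>X Y. Q = Affine X Y \<longrightarrow> Y\<^sup>2 = X ^ 3 + 1 \<longrightarrow>
          \<not> (X = q \<and> Y = r) \<and> (piece_y affine_incl Q + r) / (piece_x affine_incl Q - q) = slope X Y"
        by eventually_elim (auto simp: slope_def)
    qed
  next
    case 2
    note crd = E_affine_coordinates[OF P[unfolded 2], folded 2]
    let ?X = "piece_x affine_incl" and ?Y = "piece_y affine_incl"
    show ?thesis
    proof (rule reflection_map_holo_affine[OF P _ 2])
      \<comment> \<open>The conjugate form of the chord slope, from (Y + r) (Y - r) = X^3 - q^3: at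
        -Q its denominator is -2 r instead of 0.\<close>
      show "local_holo E_curve (\<lambda>Q. (?X Q ^ 2 + ?X Q * q + q\<^sup>2) / (?Y Q - r)) P"
        by (intro local_holo_intros A crd P) (use 2 r_nonzero in simp)
      have "\<forall>\<^sub>F Q in near E_curve P. ?Y Q \<noteq> r"
        by (rule local_holo_eventually_ne[OF A crd(2)]) (use 2 r_nonzero in simp)
      then show "\<forall>\<^sub>F Q in near E_curve P. \<forall>X Y. Q = Affine X Y \<longrightarrow> Y\<^sup>2 = X ^ 3 + 1 \<longrightarrow>
          \<not> (X = q \<and> Y = r) \<and> (?X Q ^ 2 + ?X Q * q + q\<^sup>2) / (?Y Q - r) = slope X Y"
      proof (eventually_elim, intro allI impI)
        fix Q X Y assume ne: "?Y Q \<noteq> r" and Q: "Q = Affine X Y" and E: "Y\<^sup>2 = X ^ 3 + 1"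
        have Yr: "Y - r \<noteq> 0" using ne Q by simp
        have nQ: "\<not> (X = q \<and> Y = r)" using Yr by simp
        have "slope X Y * (Y - r) = X\<^sup>2 + X * q + q\<^sup>2"
        proof (cases "X = q")
          case True
          have "Y = - r" using slope_equations(1)[OF E nQ] True by simp
          then show ?thesis using True r_nonzero by (simp add: slope_def power2_eq_square)
        next
          case False
          have "(Y + r) * (Y - r) = (X - q) * (X\<^sup>2 + X * q + q\<^sup>2)" using E on_E by algebra
          then show ?thesis using False by (simp add: slope_def field_simps)
        qed
        then show "\<not> (X = q \<and> Y = r) \<and> (?X Q ^ 2 + ?X Q * q + q\<^sup>2) / (?Y Q - r) = slope X Y"
          using nQ Yr Q by (simp add: field_simps)
      qed
    qed
  next
    case 3
    note crd = E_affine_coordinates[OF P[unfolded 3], folded 3]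
    let ?X = "piece_x affine_incl" and ?Y = "piece_y affine_incl"
    \<comment> \<open>With s = X - q the image has first coordinate N / s^2, so its coordinates at
      infinity are s^2 / N and a holomorphic multiple of s. At Q the value of N is 4 r^2.\<close>
    let ?N = "\<lambda>Q. 2 + 2 * ?Y Q * r + ?X Q * q * (?X Q + q)"
    let ?a = "\<lambda>Q. (?X Q - q) ^ 2 / ?N Q"
    let ?b = "\<lambda>Q. (- r * (?X Q - q) ^ 3 + (?Y Q + r) * (?N Q - q * (?X Q - q) ^ 2)) * (?X Q - q) / ?N Q ^ 2"
    have "2 + 2 * r * r + q * q * (q + q) = 4 * r\<^sup>2" using on_E by algebra
    then have NP: "?N P \<noteq> 0" using r_nonzero by (simp add: 3)
    have hN: "local_holo E_curve ?N P" by (intro local_holo_intros A crd P)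
    have hol: "local_holo E_curve ?a P" "local_holo E_curve ?b P"
      by (intro local_holo_intros A crd P hN, use NP in simp)+
    have "?Y P \<noteq> - r"
    proof
      assume "?Y P = - r"
      then have "2 * r = 0" unfolding 3 by simp
      then show False using r_nonzero by simp
    qed
    note YP = local_holo_eventually_ne[OF A crd(2) this]
    have "\<forall>\<^sub>F Q in near E_curve P. reflection Q = E_inf (?a Q, ?b Q) \<and>
        (?a Q, ?b Q) \<in> affine_curve [:0, 1, 0, 0, 1:]"
      using crd(5) local_holo_eventually_ne[OF A hN NP] YP
    proof eventually_elim
      case (elim Q)
      then obtain X Y where Q: "Q = Affine X Y" "Y\<^sup>2 = X ^ 3 + 1" by auto
      have Yr: "Y \<noteq> - r" using elim(3) Q(1) by simp
      define N where "N = 2 + 2 * Y * r + X * q * (X + q)"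
      have N0: "N \<noteq> 0" using elim(2) Q(1) by (simp add: N_def)
      have "reflection Q = E_inf (?a Q, ?b Q)"
      proof (cases "X = q")
        case True
        then have "Y\<^sup>2 = r\<^sup>2" using Q(2) on_E by simp
        then have "Y = r" using Yr by (auto simp: power2_eq_iff)
        then show ?thesis using True by (simp add: Q(1) reflection_def infinite_incl_Pair)
      next
        case False
        define s where "s = X - q"
        have s0: "s \<noteq> 0" using False by (simp add: s_def)
        have l: "slope X Y = (Y + r) / s" using False by (simp add: slope_def s_def)
        have H: "(Y + r)\<^sup>2 = N + (X + q) * s\<^sup>2"
          using Q(2) on_E unfolding N_def s_def by algebra
        have l2: "(slope X Y)\<^sup>2 - X - q = N / s\<^sup>2"
          using s0 H by (simp add: l power_divide field_simps)
        have "- r + slope X Y * ((slope X Y)\<^sup>2 - X - 2 * q) = - r + (Y + r) / s * (N / s\<^sup>2 - q)"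
          using l l2 by (simp add: algebra_simps)
        also have "\<dots> = (- r * s ^ 3 + (Y + r) * (N - q * s\<^sup>2)) * s / N\<^sup>2 / (s\<^sup>2 / N)\<^sup>2"
          using s0 N0 by (simp add: field_simps power2_eq_square power3_eq_cube)
        finally show ?thesis
          using False s0 N0 l2
          by (simp add: Q(1) reflection_def infinite_incl_Pair N_def [symmetric] s_def [symmetric])
      qed
      moreover have "reflection Q \<in> rs_points E_curve"
        using reflection_involution(1) Q by (simp add: Affine_in_E)
      ultimately show ?case using E_piece_mem(2) by metis
    qed
    with hol show ?thesis
      using map_holo_into_curve[OF curve_piece_E(2) rsquarefree_E A P] unfolding E_curve_def by blast
  next
    case 4
    note crd = E_infinite_coordinates[OF P[unfolded 4], folded 4]
    let ?U = "piece_x E_inf" and ?V = "piece_y E_inf"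
    \<comment> \<open>With X = 1 / U the slope is (V + r U^2) / (U D). The equation V^2 = U (1 +
      U^3) cancels the powers of U in the image, leaving the denominators D^2 and D^3, and D is 1 at
      infinity.\<close>
    let ?D = "\<lambda>Q. 1 - q * ?U Q"
    let ?a = "\<lambda>Q. (2 * ?U Q ^ 2 + 2 * ?V Q * r + q * (1 + q * ?U Q)) / ?D Q ^ 2"
    let ?b = "\<lambda>Q. - r + (?V Q * ((2 - q ^ 3) * ?U Q + 3 * q\<^sup>2) + 2 * r * (?U Q ^ 3 + 1)
        + r * ?U Q * ((2 - q ^ 3) * ?U Q ^ 2 + 2 * ?V Q * r + 3 * q\<^sup>2 * ?U Q)) / ?D Q ^ 3"
    have hD: "local_holo E_curve ?D P" by (intro local_holo_intros A crd P)
    have DP: "?D P \<noteq> 0" by (simp add: 4)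
    have hol: "local_holo E_curve ?a P" "local_holo E_curve ?b P"
      by (intro local_holo_intros A crd P hD, use DP in simp)+
    have "\<forall>\<^sub>F Q in near E_curve P. reflection Q = affine_incl (?a Q, ?b Q) \<and>
        (?a Q, ?b Q) \<in> affine_curve E_poly"
      using crd(5) local_holo_eventually_ne[OF A hD DP]
    proof eventually_elim
      case (elim Q)
      then obtain U V where Q: "Q = E_inf (U, V)" and V': "V\<^sup>2 = poly [:0, 1, 0, 0, 1:] U" by auto
      then have V: "V\<^sup>2 = U * (1 + U ^ 3)" by (simp add: algebra_simps eval_nat_numeral)
      have c: "?U Q = U" "?V Q = V" by (simp_all add: Q inj_infinite_incl)
      define D where "D = 1 - q * U"
      have D: "D \<noteq> 0" using elim(2) by (simp add: c D_def)
      have QE: "Q \<in> rs_points E_curve" unfolding Q E_piece_mem using V' by (simp add: affine_curve_iff)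
      have "reflection Q = affine_incl (?a Q, ?b Q)"
      proof (cases "U = 0")
        case True
        then have "V = 0" using V by simp
        then show ?thesis
          using True by (simp add: Q inj_infinite_incl infinite_incl_Pair reflection_def affine_incl_Pair)
      next
        case False
        have QA: "Q = Affine (1 / U) (V / U\<^sup>2)" using False by (simp add: Q infinite_incl_Pair)
        have Xq: "1 / U - q = D / U" using False by (simp add: D_def field_simps)
        then have ne: "1 / U \<noteq> q" using D False by auto
        define l where "l = (V + r * U\<^sup>2) / (U * D)"
        have l: "slope (1 / U) (V / U\<^sup>2) = l"
        proof -
          have "slope (1 / U) (V / U\<^sup>2) = (V / U\<^sup>2 + r) / (D / U)" using ne Xq by (simp add: slope_def)
          also have "\<dots> = l" using D False by (simp add: l_def field_simps power2_eq_square)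
          finally show ?thesis .
        qed
        have 1: "(V + r * U\<^sup>2)\<^sup>2 - U * D\<^sup>2 - q * U\<^sup>2 * D\<^sup>2 = U\<^sup>2 * (2 * U\<^sup>2 + 2 * V * r + q * (1 + q * U))"
          using V on_E unfolding D_def by algebra
        have a: "l\<^sup>2 - 1 / U - q = (2 * U\<^sup>2 + 2 * V * r + q * (1 + q * U)) / D\<^sup>2"
        proof -
          have "l\<^sup>2 - 1 / U - q = ((V + r * U\<^sup>2)\<^sup>2 - U * D\<^sup>2 - q * U\<^sup>2 * D\<^sup>2) / (U\<^sup>2 * D\<^sup>2)"
            using False D by (simp add: l_def field_simps power2_eq_square)
          then show ?thesis unfolding 1 using False by simp
        qed
        define M where "M = (2 - q ^ 3) * U\<^sup>2 + 2 * V * r + 3 * q\<^sup>2 * U"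
        have "l\<^sup>2 - 1 / U - 2 * q = (2 * U\<^sup>2 + 2 * V * r + q * (1 + q * U)) / D\<^sup>2 - q"
          unfolding a [symmetric] by simp
        also have "\<dots> = (2 * U\<^sup>2 + 2 * V * r + q * (1 + q * U) - q * D\<^sup>2) / D\<^sup>2"
          using D by (simp add: field_simps)
        also have "2 * U\<^sup>2 + 2 * V * r + q * (1 + q * U) - q * D\<^sup>2 = M"
          unfolding M_def D_def by algebra
        finally have b1: "l\<^sup>2 - 1 / U - 2 * q = M / D\<^sup>2" .
        \<comment> \<open>This exhibits the factor U that cancels the pole of l.\<close>
        have 2: "(V + r * U\<^sup>2) * M = U * (V * ((2 - q ^ 3) * U + 3 * q\<^sup>2) + 2 * r * (U ^ 3 + 1) + r * U * M)"
          using V unfolding M_def by algebra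
        have "l * (M / D\<^sup>2) = (V + r * U\<^sup>2) * M / (U * D ^ 3)"
          by (simp add: l_def power2_eq_square power3_eq_cube mult_ac)
        also have "\<dots> = (V * ((2 - q ^ 3) * U + 3 * q\<^sup>2) + 2 * r * (U ^ 3 + 1) + r * U * M) / D ^ 3"
          unfolding 2 using False by simp
        finally have b: "l * (l\<^sup>2 - 1 / U - 2 * q) = \<dots>" unfolding b1 .
        have "reflection Q = Affine (l\<^sup>2 - 1 / U - q) (- r + l * (l\<^sup>2 - 1 / U - 2 * q))"
          using ne by (simp add: QA reflection_def l)
        also have "\<dots> = affine_incl (?a Q, ?b Q)"
          unfolding a b by (simp add: c affine_incl_Pair D_def M_def)
        finally show ?thesis .
      qed
      moreover have "reflection Q \<in> rs_points E_curve" by (rule reflection_involution(1)[OF QE])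
      ultimately show ?case using E_piece_mem(1) by metis
    qed
    with hol show ?thesis
      using map_holo_into_curve[OF curve_piece_E(1) rsquarefree_E A P] unfolding E_curve_def by blast
  qed
qed

lemma reflection_order:
  assumes "P \<in> rs_points E_curve"
  shows "map_order E_curve E_curve reflection P 1"
  by (rule map_order_injective[OF E_curve_atlas E_curve_atlas reflection_map_holo[OF assms]
      reflection_inj assms])

lemma reflection_fibre:
  assumes "Q \<in> rs_points E_curve"
  shows "fibre E_curve reflection Q = {reflection Q}"
  using reflection_involution assms by (auto simp: fibre_def)

end

section \<open>The double cover\<close>

text \<open>The double cover is \<open>\<xi> = a X\<^sup>2 + q\<close>, \<open>\<eta> = c Y\<close>, and \<open>(q, \<plusminus>r)\<close> are its branch points.\<close>

locale X_point =
  fixes x y :: complex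
  assumes xy: "y\<^sup>2 = x ^ 3 + 1" and y_nonzero: "y \<noteq> 0"
begin

text \<open>The scalings \<open>a\<close> and \<open>c\<close> turn the identity 9 f(X) = (x + 1)
  ((2 - x - 3 X^2)^3 + (x + 1)^3) for f = \<open>X_poly x\<close> into eta^2 = xi^3 + 1.\<close>

definition "a = - 3 / (x + 1)"
definition "c = 3 / (x + 1)\<^sup>2"
definition "q = (2 - x) / (x + 1)"
text \<open>With this sign (0, -y) lies over Q, which the involution moves to infinity, and (0, y)
  lies over -Q.\<close>

definition "r = - (c * y)"

lemma d_nonzero: "x + 1 \<noteq> 0"
proof
  assume "x + 1 = 0"
  then have "y\<^sup>2 = 0" using xy by algebra
  then show False using y_nonzero by simp
qed

lemma a_nonzero: "a \<noteq> 0" and c_nonzero: "c \<noteq> 0"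
  using d_nonzero by (simp_all add: a_def c_def)

lemma X_poly_eq:
  "X_poly x = [:x ^ 3 + 1, 0, - ((x + 1) * (x - 2)\<^sup>2), 0, - (3 * (x + 1) * (x - 2)), 0, - (3 * (x + 1)):]"
  by (simp add: X_poly_def algebra_simps power2_eq_square power3_eq_cube)

lemma X_poly_cube: "smult (c\<^sup>2) (X_poly x) = [:q, 0, a:] ^ 3 + 1"
proof -
  have "poly (smult (c\<^sup>2) (X_poly x)) X = poly ([:q, 0, a:] ^ 3 + 1) X" for X
  proof -
    define N where "N = 2 - x - 3 * X\<^sup>2"
    have 1: "9 * poly (X_poly x) X = (x + 1) * (N ^ 3 + (x + 1) ^ 3)"
      by (simp add: X_poly_eq N_def algebra_simps power2_eq_square power3_eq_cube)
    have 2: "poly [:q, 0, a:] X = N / (x + 1)"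
      by (simp add: q_def a_def N_def diff_divide_distrib power2_eq_square mult_ac)
    have "c\<^sup>2 * poly (X_poly x) X = (9 * poly (X_poly x) X) / (x + 1) ^ 4"
      by (simp add: c_def power_divide flip: power_mult)
    also have "\<dots> = (N / (x + 1)) ^ 3 + 1"
    proof -
      have "d * (N ^ 3 + d ^ 3) / d ^ 4 = (N / d) ^ 3 + 1" if "d \<noteq> 0" for d :: complex
        using that by (simp add: field_simps eval_nat_numeral)
      then show ?thesis unfolding 1 using d_nonzero by blast
    qed
    finally show ?thesis by (simp only: poly_smult poly_add poly_power poly_1 2)
  qed
  then have "poly (smult (c\<^sup>2) (X_poly x)) = poly ([:q, 0, a:] ^ 3 + 1)" by (rule ext)
  then show ?thesis by (simp only: poly_eq_poly_eq_iff)
qed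

lemma X_poly_E: "Y\<^sup>2 = poly (X_poly x) X \<longleftrightarrow> (c * Y)\<^sup>2 = (a * X\<^sup>2 + q) ^ 3 + 1"
proof -
  have "c\<^sup>2 * poly (X_poly x) X = (a * X\<^sup>2 + q) ^ 3 + 1"
    using arg_cong[OF X_poly_cube, of "\<lambda>p. poly p X"] by (simp add: power2_eq_square algebra_simps)
  then have "(c * Y)\<^sup>2 = (a * X\<^sup>2 + q) ^ 3 + 1 \<longleftrightarrow> c\<^sup>2 * Y\<^sup>2 = c\<^sup>2 * poly (X_poly x) X"
    by (simp add: power_mult_distrib)
  then show ?thesis using c_nonzero by simp
qed

sublocale E_point q r
proof
  have "y\<^sup>2 = poly (X_poly x) 0" by (simp add: X_poly_eq xy)
  then show "r\<^sup>2 = q ^ 3 + 1" unfolding X_poly_E by (simp add: r_def)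
  show "r \<noteq> 0" using c_nonzero y_nonzero by (simp add: r_def)
qed

text \<open>A double root X would satisfy xi^3 = -1 and a X xi^2 = 0, hence X = 0; but there xi = q,
  and q^3 + 1 = r^2 is nonzero.\<close>

lemma rsquarefree_X: "rsquarefree (X_poly x)"
  unfolding rsquarefree_roots
proof (intro allI notI, elim conjE)
  fix X assume 0: "poly (X_poly x) X = 0" and 1: "poly (pderiv (X_poly x)) X = 0"
  let ?\<xi> = "a * X\<^sup>2 + q"
  have cube: "?\<xi> ^ 3 + 1 = 0" using X_poly_E[of 0 X] 0 by simp
  then have \<xi>: "?\<xi> \<noteq> 0" by auto
  have "pderiv (smult (c\<^sup>2) (X_poly x)) = pderiv ([:q, 0, a:] ^ Suc 2 + 1)"
    by (simp add: X_poly_cube numeral_3_eq_3)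
  then have "smult (c\<^sup>2) (pderiv (X_poly x)) = smult 3 ([:q, 0, a:]\<^sup>2) * pderiv [:q, 0, a:]"
    unfolding pderiv_smult pderiv_add pderiv_power_Suc by simp
  from arg_cong[OF this, of "\<lambda>p. poly p X"] have "3 * ?\<xi>\<^sup>2 * (2 * a * X) = 0"
    using 1 by (simp add: pderiv_pCons power2_eq_square algebra_simps)
  then have "X = 0" using \<xi> a_nonzero by simp
  then show False using cube on_E r_nonzero by simp
qed

lemma degree_X: "degree (X_poly x) = 6"
  using d_nonzero by (simp add: X_poly_eq del: distrib_left_numeral)

lemma half_degree_X: "half_degree (X_poly x) = 3"
  by (simp add: half_degree_def degree_X)

lemma X_curve_atlas: "holomorphic_atlas (X_curve x)"
  unfolding X_curve_def by (rule holomorphic_atlas_projective_curve)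

lemma compact_X_curve: "compact_riemann_surface (X_curve x)"
  unfolding X_curve_def
  by (rule compact_riemann_surface_projective_curve[OF rsquarefree_X]) (simp add: degree_X)

lemma Affine_in_X: "Affine X Y \<in> rs_points (X_curve x) \<longleftrightarrow> (c * Y)\<^sup>2 = (a * X\<^sup>2 + q) ^ 3 + 1"
  unfolding X_curve_def by (simp add: Affine_in_projective_curve[OF rsquarefree_X] X_poly_E)

lemma poly_infinity_X: "poly (poly_at_infinity (X_poly x)) 0 = - (3 * (x + 1))"
  using d_nonzero
  by (simp add: poly_at_infinity_def half_degree_X degree_X poly_monom)
    (simp add: X_poly_eq eval_nat_numeral)

lemma Infinite_in_X: "Infinite V \<in> rs_points (X_curve x) \<longleftrightarrow> V\<^sup>2 = - (3 * (x + 1))"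
  unfolding X_curve_def by (simp add: Infinite_in_projective_curve[OF rsquarefree_X] poly_infinity_X)

lemma over_q:
  assumes "Affine 0 Y \<in> rs_points (X_curve x)"
  shows "Y = y \<or> Y = - y"
proof -
  have "(c * Y)\<^sup>2 = (c * y)\<^sup>2" using assms on_E by (simp add: Affine_in_X r_def)
  then have "Y\<^sup>2 = y\<^sup>2" using c_nonzero by (simp add: power_mult_distrib)
  then show ?thesis by (simp add: power2_eq_iff)
qed

definition double_cover :: "curve_point \<Rightarrow> curve_point" where
  "double_cover P = (case P of Affine X Y \<Rightarrow> Affine (a * X\<^sup>2 + q) (c * Y) | Infinite V \<Rightarrow> Infinite 0)"

definition double_cover_degree :: "curve_point \<Rightarrow> nat" where
  "double_cover_degree P = (case P of Affine X Y \<Rightarrow> if X = 0 then 2 else 1 | Infinite V \<Rightarrow> 1)"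

lemma double_cover_points: "P \<in> rs_points (X_curve x) \<Longrightarrow> double_cover P \<in> rs_points E_curve"
  by (cases P) (auto simp: double_cover_def Affine_in_X Affine_in_E Infinite_in_E)

text \<open>For Y \<noteq> 0 the parameters are X and xi = a X^2 + q, with ramification exactly at X
  = 0. For Y = 0 they are Y and eta = c Y, and X \<noteq> 0 there.\<close>

lemma double_cover_order:
  assumes P: "P \<in> rs_points (X_curve x)"
  shows "map_order (X_curve x) E_curve double_cover P (double_cover_degree P)"
proof (cases P)
  case PA: (Affine X Y)
  note A = X_curve_atlas
  note crd = affine_coordinates[OF rsquarefree_X, folded X_curve_def, OF P[unfolded PA], folded PA]
  let ?X = "piece_x affine_incl" and ?Y = "piece_y affine_incl"
  let ?\<alpha> = "\<lambda>Q. a * ?X Q ^ 2 + q" and ?\<beta> = "\<lambda>Q. c * ?Y Q"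
  have hol: "local_holo (X_curve x) ?\<alpha> P" "local_holo (X_curve x) ?\<beta> P"
    by (intro local_holo_intros A crd P)+
  have curve: "(c * Y)\<^sup>2 = (a * X\<^sup>2 + q) ^ 3 + 1" using P by (simp add: PA Affine_in_X)
  have ev: "\<forall>\<^sub>F Q in near (X_curve x) P.
      double_cover Q = affine_incl (?\<alpha> Q, ?\<beta> Q) \<and> (?\<alpha> Q, ?\<beta> Q) \<in> affine_curve E_poly"
    using crd(5)
    by eventually_elim (auto simp: double_cover_def affine_incl_Pair affine_curve_iff poly_E X_poly_E)
  show ?thesis
  proof (cases "Y = 0")
    case False
    note t = crd(3)[OF False]
    have "local_order (X_curve x) ?\<alpha> P (double_cover_degree P)"
    proof (cases "X = 0")
      case True
      have "local_order (X_curve x) ?\<alpha> P 2"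
        by (rule local_order_factor[OF A t local_holo_const[OF P] a_nonzero])
          (use True in \<open>simp add: PA\<close>)
      then show ?thesis by (simp add: double_cover_degree_def PA True)
    next
      case X0: False
      have "local_order (X_curve x) ?\<alpha> P 1"
      proof (rule local_order_factor[OF A t])
        show "local_holo (X_curve x) (\<lambda>Q. a * (?X Q + X)) P" by (intro local_holo_intros A crd P)
        show "a * (?X P + X) \<noteq> 0" using X0 a_nonzero by (simp add: PA)
        show "\<forall>\<^sub>F Q in near (X_curve x) P.
            ?\<alpha> Q - ?\<alpha> P = a * (?X Q + X) * (?X Q - ?X P) ^ 1"
          by (rule always_eventually) (simp add: PA algebra_simps power2_eq_square)
      qed
      then show ?thesis by (simp add: double_cover_degree_def PA X0)
    qed
    then show ?thesis
      using map_order_into_curve_fst[OF curve_piece_E(1) A P _ hol(2) ev] False c_nonzero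
      unfolding E_curve_def by (simp add: PA)
  next
    case True
    have \<xi>: "a * X\<^sup>2 + q \<noteq> 0" using curve True by auto
    have X0: "X \<noteq> 0" using over_q[of 0] P True y_nonzero by (auto simp: PA)
    have "poly (pderiv (X_poly x)) X \<noteq> 0"
      using rsquarefree_X X_poly_E[of Y X] curve True by (auto simp: rsquarefree_roots)
    from local_order_factor[OF A crd(4)[OF this], of "\<lambda>Q. c" ?\<beta> 1]
    have "local_order (X_curve x) ?\<beta> P 1"
      using local_holo_const[OF P] c_nonzero by (simp add: algebra_simps)
    then show ?thesis
      using map_order_into_curve_snd[OF curve_piece_E(1) A P _ hol(1) ev] \<xi> X0
      unfolding E_curve_def by (simp add: PA poly_pderiv_E double_cover_degree_def)
  qed
next
  case PI: (Infinite V0)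
  note A = X_curve_atlas
  note crd = infinite_coordinates[OF rsquarefree_X, folded X_curve_def, unfolded half_degree_X,
      OF P[unfolded PI], folded PI]
  let ?\<kappa> = "infinite_incl 3"
  let ?U = "piece_x ?\<kappa>" and ?V = "piece_y ?\<kappa>"
  let ?D = "\<lambda>Q. a + q * ?U Q ^ 2"
  \<comment> \<open>The coordinates 1 / xi and eta / xi^2 of the image, with U = 1 / X and V = Y /
    X^3; the second is \<open>?g\<close> times U. It is the parameter of E at infinity and vanishes
    to first order because V is nonzero there.\<close>
  let ?\<alpha> = "\<lambda>Q. ?U Q ^ 2 / ?D Q" and ?g = "\<lambda>Q. c * ?V Q / ?D Q ^ 2"
  have V0: "V0 \<noteq> 0" using P d_nonzero by (auto simp: PI Infinite_in_X simp del: distrib_left_numeral)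
  have hD: "local_holo (X_curve x) ?D P" by (intro local_holo_intros A crd P)
  have DP: "?D P \<noteq> 0" using a_nonzero by (simp add: PI)
  have hol: "local_holo (X_curve x) ?\<alpha> P" by (intro local_holo_intros A crd P hD DP)
  have holg: "local_holo (X_curve x) ?g P"
    by (intro local_holo_intros A crd P hD) (use DP in simp)
  have gP: "?g P \<noteq> 0" using V0 a_nonzero c_nonzero by (simp add: PI)
  have ord: "local_order (X_curve x) (\<lambda>Q. ?g Q * ?U Q) P 1"
    by (rule local_order_factor[OF A crd(3)[OF V0] holg gP]) (simp add: PI)
  have "\<forall>\<^sub>F Q in near (X_curve x) P. Q \<in> rs_points (X_curve x)"
    using P A unfolding eventually_nhdsin by (metis openin_topspace topspace_rs)
  with crd(5) local_holo_eventually_ne[OF A hD DP]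
  have ev: "\<forall>\<^sub>F Q in near (X_curve x) P. double_cover Q = E_inf (?\<alpha> Q, ?g Q * ?U Q) \<and>
      (?\<alpha> Q, ?g Q * ?U Q) \<in> affine_curve [:0, 1, 0, 0, 1:]"
  proof eventually_elim
    case (elim Q)
    then obtain U V where Q: "Q = ?\<kappa> (U, V)" by auto
    have uv: "?U Q = U" "?V Q = V" by (simp_all add: Q inj_infinite_incl)
    define D where "D = a + q * U\<^sup>2"
    have D: "D \<noteq> 0" using elim(2) by (simp add: uv D_def)
    have "double_cover Q = E_inf (U\<^sup>2 / D, c * V / D\<^sup>2 * U)"
    proof (cases "U = 0")
      case True
      then show ?thesis by (simp add: Q infinite_incl_Pair double_cover_def)
    next
      case False
      have "a * (1 / U)\<^sup>2 + q = D / U\<^sup>2" using False by (simp add: D_def field_simps)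
      moreover have "c * (V / U ^ 3) = c * V / D\<^sup>2 * U / (U\<^sup>2 / D)\<^sup>2"
        using False D by (simp add: field_simps eval_nat_numeral)
      ultimately show ?thesis using False D by (simp add: Q infinite_incl_Pair double_cover_def)
    qed
    then have "double_cover Q = E_inf (?\<alpha> Q, ?g Q * ?U Q)" by (simp add: uv D_def)
    moreover have "double_cover Q \<in> rs_points E_curve" by (rule double_cover_points[OF elim(3)])
    ultimately show ?case using E_piece_mem(2) by metis
  qed
  have "map_order (X_curve x) E_curve double_cover P 1"
    using map_order_into_curve_snd[OF curve_piece_E(2) A P _ hol ev ord]
    unfolding E_curve_def by (simp add: PI pderiv_pCons)
  then show ?thesis by (simp add: double_cover_degree_def PI)
qed

lemma card_square_roots: "card {V :: complex. V\<^sup>2 = w} = 2" "finite {V :: complex. V\<^sup>2 = w}" if "w \<noteq> 0" for w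
proof -
  show "card {V :: complex. V\<^sup>2 = w} = 2" using that by (intro card_nth_roots) auto
  then show "finite {V :: complex. V\<^sup>2 = w}" using card.infinite by fastforce
qed

text \<open>Affine fibres come from the square roots of (xi - q) / a. Over infinity lie two points,
  the square roots of the nonzero leading coefficient of \<open>X_poly x\<close>.\<close>

lemma double_cover_fibre:
  assumes "R \<in> rs_points E_curve"
  shows "finite (fibre (X_curve x) double_cover R)"
    and "(\<Sum>P\<in>fibre (X_curve x) double_cover R. double_cover_degree P) = 2"
proof -
  have "finite (fibre (X_curve x) double_cover R) \<and>
      (\<Sum>P\<in>fibre (X_curve x) double_cover R. double_cover_degree P) = 2"
    using assms
  proof (cases rule: E_point_cases)
    case 2
    have "fibre (X_curve x) double_cover R = Infinite ` {V. V\<^sup>2 = - (3 * (x + 1))}"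
    proof (intro subset_antisym subsetI)
      fix P assume "P \<in> fibre (X_curve x) double_cover R"
      then show "P \<in> Infinite ` {V. V\<^sup>2 = - (3 * (x + 1))}"
        by (cases P) (auto simp: fibre_def 2 double_cover_def Infinite_in_X)
    qed (auto simp: fibre_def 2 double_cover_def Infinite_in_X)
    moreover have "- (3 * (x + 1)) \<noteq> 0" using d_nonzero by (simp del: distrib_left_numeral)
    note card_square_roots[OF this]
    moreover have "inj_on Infinite B" for B by (auto simp: inj_on_def)
    ultimately show ?thesis by (simp add: sum.reindex double_cover_degree_def)
  next
    case (1 \<xi> \<eta>)
    let ?S = "{X. X\<^sup>2 = (\<xi> - q) / a}"
    have eq: "a * X\<^sup>2 + q = \<xi> \<longleftrightarrow> X \<in> ?S" for X
      using a_nonzero by (auto simp: field_simps)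
    have "fibre (X_curve x) double_cover R = (\<lambda>X. Affine X (\<eta> / c)) ` ?S"
    proof (intro subset_antisym subsetI)
      fix P assume P: "P \<in> fibre (X_curve x) double_cover R"
      show "P \<in> (\<lambda>X. Affine X (\<eta> / c)) ` ?S"
      proof (cases P)
        case (Affine X Y)
        then have "a * X\<^sup>2 + q = \<xi>" "Y = \<eta> / c"
          using P c_nonzero by (auto simp: fibre_def 1 double_cover_def)
        then show ?thesis using eq Affine by blast
      qed (use P in \<open>auto simp: fibre_def 1 double_cover_def\<close>)
    next
      fix P assume "P \<in> (\<lambda>X. Affine X (\<eta> / c)) ` ?S"
      then obtain X where "P = Affine X (\<eta> / c)" "a * X\<^sup>2 + q = \<xi>" using eq by blast
      then show "P \<in> fibre (X_curve x) double_cover R"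
        using 1 c_nonzero by (simp add: fibre_def double_cover_def Affine_in_X)
    qed
    moreover have "inj_on (\<lambda>X. Affine X (\<eta> / c)) B" for B by (auto simp: inj_on_def)
    moreover have "finite ?S \<and> (\<Sum>X\<in>?S. double_cover_degree (Affine X (\<eta> / c))) = 2"
    proof (cases "(\<xi> - q) / a = 0")
      case True
      then have "?S = {0}" by auto
      then show ?thesis by (simp add: double_cover_degree_def)
    next
      case False
      have "(\<Sum>X\<in>?S. double_cover_degree (Affine X (\<eta> / c))) = (\<Sum>X\<in>?S. 1)"
        using False by (intro sum.cong) (auto simp: double_cover_degree_def)
      then show ?thesis using card_square_roots[OF False] by simp
    qed
    ultimately show ?thesis by (simp add: sum.reindex)
  qed
  then show "finite (fibre (X_curve x) double_cover R)"
    "(\<Sum>P\<in>fibre (X_curve x) double_cover R. double_cover_degree P) = 2" by auto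
qed

lemma double_cover_branched: "branched_covering (X_curve x) E_curve 2 double_cover"
  by (rule branched_coveringI[OF compact_X_curve compact_E_curve double_cover_order _
      double_cover_fibre]) auto

section \<open>The composite map and the given rational expression\<close>

definition phi :: "curve_point \<Rightarrow> complex option" where
  "phi = half_y \<circ> (reflection \<circ> double_cover)"

definition phi_degree :: "curve_point \<Rightarrow> nat" where
  "phi_degree P = half_y_degree (reflection (double_cover P)) * double_cover_degree P"

lemma phi_order:
  assumes P: "P \<in> rs_points (X_curve x)"
  shows "map_order (X_curve x) riemann_sphere phi P (phi_degree P)"
proof -
  note pE = double_cover_points[OF P]
  have "map_order (X_curve x) E_curve (reflection \<circ> double_cover) P (1 * double_cover_degree P)"
    by (rule map_order_compose[OF X_curve_atlas E_curve_atlas E_curve_atlas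
        double_cover_order[OF P] reflection_order[OF pE]])
  then have 1: "map_order (X_curve x) E_curve (reflection \<circ> double_cover) P (double_cover_degree P)"
    by simp
  have "map_order E_curve riemann_sphere half_y ((reflection \<circ> double_cover) P)
      (half_y_degree (reflection (double_cover P)))"
    using half_y_order[OF reflection_involution(1)[OF pE]] by simp
  from map_order_compose[OF X_curve_atlas E_curve_atlas holomorphic_atlas_sphere 1 this]
  show ?thesis unfolding phi_def phi_degree_def .
qed

lemma phi_local_degree:
  "P \<in> rs_points (X_curve x) \<Longrightarrow> local_degree (X_curve x) riemann_sphere phi P = phi_degree P"
  by (rule map_order_imp_local_degree[OF X_curve_atlas holomorphic_atlas_sphere phi_order])

text \<open>The degrees 2, 1 and 3 of the three factors multiply.\<close>

lemma phi_branched: "branched_covering (X_curve x) riemann_sphere 6 phi"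
proof -
  have r: "finite (fibre E_curve reflection R)" "(\<Sum>P\<in>fibre E_curve reflection R. 1) = (1 :: nat)"
    if "R \<in> rs_points E_curve" for R
    using that by (simp_all add: reflection_fibre)
  note rp = fibre_sum_compose[where F = double_cover and e = double_cover_degree and G = reflection
      and e' = "\<lambda>_. 1", OF double_cover_points double_cover_fibre r]
  have p: "(reflection \<circ> double_cover) P \<in> rs_points E_curve" if "P \<in> rs_points (X_curve x)" for P
    using reflection_involution(1)[OF double_cover_points[OF that]] by simp
  note hp = fibre_sum_compose[where F = "reflection \<circ> double_cover" and G = half_y
      and e' = half_y_degree, OF p rp half_y_fibre, folded phi_def]
  show ?thesis
  proof (rule branched_coveringI[OF compact_X_curve compact_riemann_surface_sphere phi_order])
    show "finite (fibre (X_curve x) phi w)" for w by (rule hp(1))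
    show "(\<Sum>P\<in>fibre (X_curve x) phi w. phi_degree P) = 6" for w
      using hp(2)[of w] by (simp add: phi_degree_def)
  qed simp_all
qed

text \<open>The value of the composite contains the cubic term (Y - y)^3; the equation of the curve
  makes it linear in Y, which yields the given expression.\<close>

lemma phi_Affine:
  assumes P: "Affine X Y \<in> rs_points (X_curve x)" and "X \<noteq> 0"
  shows "phi (Affine X Y) = Some (phi_num x y X Y / phi_den x X Y)"
proof -
  define d where "d = x + 1"
  have d: "d \<noteq> 0" using d_nonzero by (simp add: d_def)
  have Y2: "Y\<^sup>2 = poly (X_poly x) X" using P unfolding Affine_in_X X_poly_E .
  define W where "W = X\<^sup>2"
  have W: "W \<noteq> 0" using assms(2) by (simp add: W_def)
  have X6: "X ^ 6 = W ^ 3" "X ^ 4 = W\<^sup>2" by (simp_all add: W_def flip: power_mult)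
  \<comment> \<open>The slope (eta + r) / (xi - q) = c (Y - y) / (a X^2), with c / a = - 1 / (x +
    1).\<close>
  define l where "l = - (Y - y) / (d * W)"
  have ne: "a * W + q \<noteq> q" using W a_nonzero by simp
  have ad: "a = - 3 / d" and cd: "c = 3 / d\<^sup>2" and qd: "q = (2 - x) / d"
    by (simp_all add: a_def c_def q_def d_def)
  have l: "slope (a * W + q) (c * Y) = l"
  proof -
    have "slope (a * W + q) (c * Y) = (c * Y + r) / (a * W)"
      using ne by (simp add: slope_def)
    also have "c * Y + r = c * Y - c * y" by (simp add: r_def)
    also have "(c * Y - c * y) / (a * W) = l" unfolding l_def ad cd using d W by (simp add: field_simps power2_eq_square)
    finally show ?thesis .
  qed
  have "phi (Affine X Y) = Some ((1 + (- r + l * (l\<^sup>2 - (a * W + q) - 2 * q))) / 2)"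
    using ne l by (simp add: phi_def double_cover_def reflection_def half_y_def W_def)
  also have "(1 + (- r + l * (l\<^sup>2 - (a * W + q) - 2 * q))) / 2 = phi_num x y X Y / phi_den x X Y"
  proof -
    have x: "x = d - 1" by (simp add: d_def)
    \<comment> \<open>Eliminating Y^2 and y^2 brings out a factor d, which turns the denominator d^3
      of l^3 into the d^2 of the given expression.\<close>
    have cube: "(Y - y) ^ 3 = d * (4 * (x\<^sup>2 - x + 1) * (Y - y)
        - (3 * W ^ 3 + 3 * (x - 2) * W\<^sup>2 + (x - 2)\<^sup>2 * W) * (Y - 3 * y))"
    proof -
      have "Y\<^sup>2 = y\<^sup>2 - d * (3 * W ^ 3 + 3 * (x - 2) * W\<^sup>2 + (x - 2)\<^sup>2 * W)"
        unfolding Y2 xy by (simp add: X_poly_eq d_def W_def algebra_simps eval_nat_numeral)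
      moreover have "y\<^sup>2 = d * (x\<^sup>2 - x + 1)" unfolding xy d_def by algebra
      ultimately show ?thesis by algebra
    qed
    have "l * (l\<^sup>2 - (a * W + q) - 2 * q) =
        - ((Y - y) ^ 3 / (d ^ 3 * W ^ 3)) + 3 * (Y - y) * (2 - x - W) / (d\<^sup>2 * W)"
    proof -
      have "- e / (d * W) * ((- e / (d * W))\<^sup>2 - (- 3 / d * W + u / d) - 2 * (u / d)) =
          - (e ^ 3 / (d ^ 3 * W ^ 3)) + 3 * e * (u - W) / (d\<^sup>2 * W)" for e u
        using d W by (simp add: field_simps power2_eq_square power3_eq_cube)
      then show ?thesis unfolding l_def ad qd .
    qed
    also have "(Y - y) ^ 3 / (d ^ 3 * W ^ 3) = (4 * (x\<^sup>2 - x + 1) * (Y - y)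
        - (3 * W ^ 3 + 3 * (x - 2) * W\<^sup>2 + (x - 2)\<^sup>2 * W) * (Y - 3 * y)) / (d\<^sup>2 * W ^ 3)"
      unfolding cube using d W by (simp add: power3_eq_cube power2_eq_square)
    finally have "(1 + (- r + l * (l\<^sup>2 - (a * W + q) - 2 * q))) / 2 =
      (1 + (3 * y / d\<^sup>2 + (- ((4 * (x\<^sup>2 - x + 1) * (Y - y)
        - (3 * W ^ 3 + 3 * (x - 2) * W\<^sup>2 + (x - 2)\<^sup>2 * W) * (Y - 3 * y)) / (d\<^sup>2 * W ^ 3))
        + 3 * (Y - y) * (2 - x - W) / (d\<^sup>2 * W)))) / 2"
      by (simp add: r_def c_def d_def)
    also have "\<dots> = (d\<^sup>2 * W ^ 3 + 3 * y * W ^ 3 - (4 * (x\<^sup>2 - x + 1) * (Y - y)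
        - (3 * W ^ 3 + 3 * (x - 2) * W\<^sup>2 + (x - 2)\<^sup>2 * W) * (Y - 3 * y))
        + 3 * (Y - y) * (2 - x - W) * W\<^sup>2) / (2 * d\<^sup>2 * W ^ 3)"
    proof -
      have "(1 + (u / d\<^sup>2 + (- (v / (d\<^sup>2 * W ^ 3)) + w / (d\<^sup>2 * W)))) / 2 =
          (d\<^sup>2 * W ^ 3 + u * W ^ 3 - v + w * W\<^sup>2) / (2 * d\<^sup>2 * W ^ 3)" for u v w
        using d W by (simp add: field_simps power2_eq_square power3_eq_cube)
      then show ?thesis .
    qed
    also have "\<dots> = phi_num x y X Y / phi_den x X Y"
    proof -
      have "d\<^sup>2 * W ^ 3 + 3 * y * W ^ 3 - (4 * (x\<^sup>2 - x + 1) * (Y - y)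
        - (3 * W ^ 3 + 3 * (x - 2) * W\<^sup>2 + (x - 2)\<^sup>2 * W) * (Y - 3 * y))
        + 3 * (Y - y) * (2 - x - W) * W\<^sup>2 = phi_num x y X Y"
        unfolding phi_num_def X6 W_def [symmetric] d_def by algebra
      moreover have "2 * d\<^sup>2 * W ^ 3 = phi_den x X Y"
        unfolding phi_den_def X6 d_def by (simp add: add.commute)
      ultimately show ?thesis by simp
    qed
    finally show ?thesis .
  qed
  finally show ?thesis .
qed

lemma phi_rational: "given_by_rational_expression (X_poly x) (phi_num x y) (phi_den x) phi"
  unfolding given_by_rational_expression_def X_curve_def [symmetric]
proof (intro conjI allI impI)
  show "holomorphic_map (X_curve x) riemann_sphere phi"
    by (rule holomorphic_mapI[OF X_curve_atlas holomorphic_atlas_sphere map_order_imp_holo[OF phi_order]])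
  show "phi (Affine X Y) = Some (phi_num x y X Y / phi_den x X Y)"
    if "Affine X Y \<in> rs_points (X_curve x) \<and> phi_den x X Y \<noteq> 0" for X Y
    using that by (intro phi_Affine) (auto simp: phi_den_def)
qed

lemma base_point: "Affine 0 y \<in> rs_points (X_curve x)"
  using on_E by (simp add: Affine_in_X r_def)

text \<open>The point lies over -Q, where the chord becomes the tangent, so the involution sends it
  to 2 Q; its second coordinate is the one in \<open>branch_value\<close>.\<close>

lemma phi_base_point: "phi (Affine 0 y) = Some (branch_value x y)"
proof -
  define l where "l = - 3 * q\<^sup>2 / (2 * r)"
  have "c * y \<noteq> r" using c_nonzero y_nonzero by (simp add: r_def eq_neg_iff_add_eq_0)
  moreover have "slope q (c * y) = l" by (simp add: slope_def l_def)
  ultimately have "phi (Affine 0 y) = Some ((1 + (- r + l * (l\<^sup>2 - 3 * q))) / 2)"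
    by (simp add: phi_def double_cover_def reflection_def half_y_def)
  moreover have "- r + l * (l\<^sup>2 - 3 * q) = (x ^ 6 + 20 * x ^ 3 - 8) / (8 * y ^ 3)"
  proof -
    define d where "d = x + 1"
    have d: "d \<noteq> 0" using d_nonzero by (simp add: d_def)
    have y2: "y\<^sup>2 = d * (x\<^sup>2 - x + 1)" unfolding xy d_def by algebra
    have l: "l = (2 - x)\<^sup>2 / (2 * y)"
      using d y_nonzero by (simp add: l_def r_def c_def q_def d_def [symmetric] power_divide)
    have "8 * y ^ 3 * d\<^sup>2 * (3 / d\<^sup>2 * y + e\<^sup>2 / (2 * y) * ((e\<^sup>2 / (2 * y))\<^sup>2 - 3 * (e / d))) =
        24 * (y\<^sup>2)\<^sup>2 + e ^ 6 * d\<^sup>2 - 12 * y\<^sup>2 * e ^ 3 * d" for e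
      using d y_nonzero by (simp add: field_simps eval_nat_numeral)
    then have "8 * y ^ 3 * d\<^sup>2 * (- r + l * (l\<^sup>2 - 3 * q)) =
        24 * (y\<^sup>2)\<^sup>2 + (2 - x) ^ 6 * d\<^sup>2 - 12 * y\<^sup>2 * (2 - x) ^ 3 * d"
      by (simp only: l r_def c_def q_def d_def [symmetric] minus_minus)
    also have "\<dots> = d\<^sup>2 * (x ^ 6 + 20 * x ^ 3 - 8)"
      unfolding y2 d_def by algebra
    finally have "8 * y ^ 3 * (- r + l * (l\<^sup>2 - 3 * q)) = x ^ 6 + 20 * x ^ 3 - 8"
      using d by (simp add: mult_ac)
    then show ?thesis using y_nonzero by (simp add: field_simps)
  qed
  ultimately show ?thesis by (simp add: branch_value_def)
qed

section \<open>Ramification of the composite map\<close>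

lemma phi_conjugate_base_point: "phi (Affine 0 (- y)) = None"
proof -
  have "double_cover (Affine 0 (- y)) = Affine q r" by (simp add: double_cover_def r_def)
  then show ?thesis by (simp add: phi_def reflection_def half_y_def)
qed

text \<open>On E the values Y = 1 and Y = -1 occur exactly where X = 0; together with infinity these
  are the 3-torsion points.\<close>

lemma half_y_degree_over:
  assumes R: "R \<in> rs_points E_curve"
  shows "half_y R = Some 0 \<or> half_y R = Some 1 \<or> half_y R = None \<longleftrightarrow> half_y_degree R = 3"
    and "half_y_degree R \<noteq> 3 \<Longrightarrow> half_y_degree R = 1"
proof -
  show "half_y R = Some 0 \<or> half_y R = Some 1 \<or> half_y R = None \<longleftrightarrow> half_y_degree R = 3"
    using R
  proof (cases rule: E_point_cases)
    case (1 X Y)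
    have "(1 + Y) / 2 = 0 \<longleftrightarrow> Y = - 1" "(1 + Y) / 2 = 1 \<longleftrightarrow> Y = 1"
      by (auto simp: add_eq_0_iff add.commute)
    moreover have "Y = - 1 \<or> Y = 1 \<longleftrightarrow> X = 0"
    proof -
      have "Y = - 1 \<or> Y = 1 \<longleftrightarrow> Y\<^sup>2 = 1" by (metis power2_eq_1_iff)
      then show ?thesis using 1(2) by simp
    qed
    ultimately show ?thesis by (auto simp: 1(1) half_y_def half_y_degree_def)
  qed (simp add: half_y_def half_y_degree_def)
  show "half_y_degree R \<noteq> 3 \<Longrightarrow> half_y_degree R = 1"
    by (auto simp: half_y_degree_def split: curve_point.splits if_splits)
qed

text \<open>The factor 3 comes from \<open>half_y\<close> and the factor 2 from
  \<open>double_cover\<close>; the involution contributes 1.\<close>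

lemma phi_degree_cases:
  assumes P: "P \<in> rs_points (X_curve x)"
  shows "phi_degree P = (if phi P \<in> {Some 0, Some 1, None} then 3 else 1) *
    (if P = Affine 0 y \<or> P = Affine 0 (- y) then 2 else 1)"
proof -
  let ?R = "reflection (double_cover P)"
  have R: "?R \<in> rs_points E_curve" by (rule reflection_involution(1)[OF double_cover_points[OF P]])
  have "half_y_degree ?R = (if phi P \<in> {Some 0, Some 1, None} then 3 else 1)"
    using half_y_degree_over[OF R] by (auto simp: phi_def)
  moreover have "double_cover_degree P = (if P = Affine 0 y \<or> P = Affine 0 (- y) then 2 else 1)"
  proof (cases P)
    case (Affine X Y)
    then show ?thesis using over_q P by (auto simp: double_cover_degree_def)
  qed (simp add: double_cover_degree_def)
  ultimately show ?thesis by (simp add: phi_degree_def)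
qed

text \<open>Only the point at infinity of E has value infinity, only Q is moved there, and only (0,
  -y) lies over Q. The fibre is thus one point, of order 3 times 2.\<close>

lemma phi_None:
  assumes P: "P \<in> rs_points (X_curve x)" and "phi P = None"
  shows "P = Affine 0 (- y)"
proof -
  let ?R = "reflection (double_cover P)"
  have pE: "double_cover P \<in> rs_points E_curve" by (rule double_cover_points[OF P])
  have "?R = Infinite 0"
    using reflection_involution(1)[OF pE]
  proof (cases rule: E_point_cases)
    case (1 X Y)
    then show ?thesis using assms(2) by (simp add: phi_def half_y_def)
  qed
  then have "double_cover P = Affine q r"
    using reflection_involution(2)[OF pE] by (simp add: reflection_def)
  then obtain X Y where XY: "P = Affine X Y" "a * X\<^sup>2 + q = q" "c * Y = r"
    by (cases P) (auto simp: double_cover_def)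
  have "c * (Y + y) = 0" using XY(3) by (simp add: r_def distrib_left)
  then have "Y = - y" using c_nonzero by (simp add: eq_neg_iff_add_eq_0)
  then show ?thesis using XY(1,2) a_nonzero by simp
qed

end

text \<open>The guards concern the case x (x^3 - 8) = 0, in which the value at (0, y) is 0 or 1 by
  \<open>branch_value_eq_0_or_1_iff\<close>: then the factors 3 and 2 meet at this point, which has
  order 6 and fills its fibre.\<close>

theorem mainTheorem5:
  fixes x y :: complex
  assumes "y\<^sup>2 = x ^ 3 + 1" and "y \<noteq> 0"
  shows "has_genus (X_curve x) 2 \<and> has_genus E_curve 1 \<and>
    (\<exists>\<phi>. given_by_rational_expression (X_poly x) (phi_num x y) (phi_den x) \<phi> \<and>
       branched_covering (X_curve x) riemann_sphere 6 \<phi> \<and>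
       ramifies_totally_to_order (X_curve x) riemann_sphere \<phi> None 6 \<and>
       Affine 0 y \<in> rs_points (X_curve x) \<and>
       \<phi> (Affine 0 y) = Some (branch_value x y) \<and>
       (\<phi> (Affine 0 y) \<noteq> Some 0 \<longrightarrow>
          ramifies_totally_to_order (X_curve x) riemann_sphere \<phi> (Some 0) 3) \<and>
       (\<phi> (Affine 0 y) \<noteq> Some 1 \<longrightarrow>
          ramifies_totally_to_order (X_curve x) riemann_sphere \<phi> (Some 1) 3) \<and>
       (\<phi> (Affine 0 y) \<notin> {Some 0, Some 1} \<longrightarrow>
          branch_points (X_curve x) riemann_sphere \<phi> - {Some 0, Some 1, None} =
            {\<phi> (Affine 0 y)} \<and>
          (\<exists>p. ramification_points (X_curve x) riemann_sphere \<phi> \<inter>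
                 fibre (X_curve x) \<phi> (\<phi> (Affine 0 y)) = {p} \<and>
               local_degree (X_curve x) riemann_sphere \<phi> p = 2))) \<and>
    (\<exists>\<psi>. branched_covering (X_curve x) E_curve 2 \<psi>)"
proof -
  interpret X_point x y by unfold_locales (rule assms)+
  let ?b = "Affine 0 y"
  have deg: "local_degree (X_curve x) riemann_sphere phi P =
      (if phi P \<in> {Some 0, Some 1, None} then 3 else 1) *
      (if P = Affine 0 y \<or> P = Affine 0 (- y) then 2 else 1)" if "P \<in> rs_points (X_curve x)" for P
    using phi_local_degree[OF that] phi_degree_cases[OF that] by simp
  have genus: "has_genus (X_curve x) 2" "has_genus E_curve 1"
    using has_genus_projective_curve[OF rsquarefree_X] has_genus_projective_curve[OF rsquarefree_E]
    by (simp_all add: degree_X half_degree_X degree_E X_curve_def E_curve_def)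
  have at_None: "ramifies_totally_to_order (X_curve x) riemann_sphere phi None 6"
    unfolding ramifies_totally_to_order_def
  proof
    fix P assume "P \<in> fibre (X_curve x) phi None"
    then have P: "P \<in> rs_points (X_curve x)" "phi P = None" by (auto simp: fibre_def)
    then show "local_degree (X_curve x) riemann_sphere phi P = 6"
      using deg[OF P(1)] phi_None[OF P] by simp
  qed
  have at_w: "ramifies_totally_to_order (X_curve x) riemann_sphere phi (Some w) 3"
    if "w \<in> {0, 1}" "phi ?b \<noteq> Some w" for w
    unfolding ramifies_totally_to_order_def
  proof
    fix P assume "P \<in> fibre (X_curve x) phi (Some w)"
    then have P: "P \<in> rs_points (X_curve x)" "phi P = Some w" by (auto simp: fibre_def)
    \<comment> \<open>The double cover is unramified along this fibre: (0, -y) has value infinity,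
      and (0, y) a value other than w.\<close>
    moreover have "P \<noteq> ?b" "P \<noteq> Affine 0 (- y)"
      using P(2) that(2) phi_conjugate_base_point by auto
    ultimately show "local_degree (X_curve x) riemann_sphere phi P = 3"
      using deg[OF P(1)] that(1) by auto
  qed
  have generic: "branch_points (X_curve x) riemann_sphere phi - {Some 0, Some 1, None} = {phi ?b} \<and>
      (\<exists>p. ramification_points (X_curve x) riemann_sphere phi \<inter> fibre (X_curve x) phi (phi ?b) = {p} \<and>
        local_degree (X_curve x) riemann_sphere phi p = 2)"
    if b: "phi ?b \<notin> {Some 0, Some 1}"
  proof -
    have b': "phi ?b \<notin> {Some 0, Some 1, None}" using b phi_base_point by simp
    have db: "local_degree (X_curve x) riemann_sphere phi ?b = 2"
      using deg[OF base_point] b' by simp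
    \<comment> \<open>Outside the three fibres the factor 3 is absent, so only (0, y) and (0, -y)
      could ramify, and the latter lies over infinity.\<close>
    have ram: "P = ?b" if "P \<in> ramification_points (X_curve x) riemann_sphere phi"
      "phi P \<notin> {Some 0, Some 1, None}" for P
    proof (rule ccontr)
      assume "P \<noteq> ?b"
      moreover have "P \<noteq> Affine 0 (- y)" using that(2) phi_conjugate_base_point by auto
      moreover have "P \<in> rs_points (X_curve x)" "local_degree (X_curve x) riemann_sphere phi P \<ge> 2"
        using that(1) by (auto simp: ramification_points_def)
      ultimately show False using deg[of P] that(2) by (auto split: if_splits)
    qed
    have rb: "?b \<in> ramification_points (X_curve x) riemann_sphere phi"
      using base_point db by (simp add: ramification_points_def)
    have "branch_points (X_curve x) riemann_sphere phi - {Some 0, Some 1, None} = {phi ?b}"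
    proof (intro subset_antisym subsetI)
      fix w assume "w \<in> branch_points (X_curve x) riemann_sphere phi - {Some 0, Some 1, None}"
      then obtain P where P: "P \<in> ramification_points (X_curve x) riemann_sphere phi"
        "w = phi P" "phi P \<notin> {Some 0, Some 1, None}"
        unfolding branch_points_def by blast
      then show "w \<in> {phi ?b}" using ram[OF P(1,3)] by simp
    next
      fix w assume "w \<in> {phi ?b}"
      then have w: "w = phi ?b" by simp
      show "w \<in> branch_points (X_curve x) riemann_sphere phi - {Some 0, Some 1, None}"
        unfolding branch_points_def w by (rule DiffI, rule imageI, rule rb, rule b')
    qed
    moreover have "ramification_points (X_curve x) riemann_sphere phi \<inter>
        fibre (X_curve x) phi (phi ?b) = {?b}"
    proof (intro subset_antisym subsetI)
      fix P assume "P \<in> ramification_points (X_curve x) riemann_sphere phi \<inter> fibre (X_curve x) phi (phi ?b)"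
      then show "P \<in> {?b}" using ram[of P] b' by (auto simp: fibre_def)
    qed (use rb base_point in \<open>auto simp: fibre_def\<close>)
    ultimately show ?thesis using db by blast
  qed
  have "phi ?b \<noteq> Some 0 \<longrightarrow> ramifies_totally_to_order (X_curve x) riemann_sphere phi (Some 0) 3"
    "phi ?b \<noteq> Some 1 \<longrightarrow> ramifies_totally_to_order (X_curve x) riemann_sphere phi (Some 1) 3"
    using at_w[of 0] at_w[of 1] by auto
  note phi_facts = phi_rational phi_branched at_None base_point phi_base_point this impI[OF generic]
  show ?thesis
    by (rule conjI[OF genus(1) conjI[OF genus(2) conjI[OF exI[of _ phi] exI[of _ double_cover]]]];
        intro conjI phi_facts double_cover_branched)
qed

end
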